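(* Let $M$ be an $n$-dimensional Einstein totally real submanifold of an $m$-dimensional complex space form $N^{m}(4c)$ of constant holomorphic sectional curvature $4c$. Then for every positive integer $q<\frac{n}{2}$, $$\delta_q^{\mathrm{Ric}}\leq \left(n-1-\frac{2q}{n}\right)c+\frac{n(n-q-1)}{n-q}H^2$$ on $M$. The equality case of this inequality holds (that is, equality holds at every point of $M$) if and only if $M$ is a totally geodesic submanifold.
   Context: Intrinsic notions. Let $M$ be a Riemannian $n$-manifold. $K(\pi)$ denotes the sectional curvature of a plane section $\pi\subset T_pM$. For a unit vector $X\in T_pM$, $\mathrm{Ric}(X)=\sum_{j=2}^n K(X\wedge e_j)$, where $\{e_1=X,e_2,\ldots,e_n\}$ is an orthonormal basis of $T_pM$. $M$ is Einstein if $\mathrm{Ric}(X)$ is independent of the choice of the unit vector $X$; then $\mathrm{Ric}(X)=\frac{2}{n}\tau(p)$ for every unit $X\in T_pM$, where $\tau(p)=\sum_{1\le i<j\le n}K(e_i\wedge e_j)$. For a positive integer $q\le n/2$ define $$K_q^{\inf}(p)=\inf_{\pi_1\perp\cdots\perp\pi_q}\frac{K(\pi_1)+\cdots+K(\pi_q)}{q},$$ where $\pi_1,\ldots,\pi_q$ run over all $q$ mutually orthogonal plane sections in $T_pM$, and define the function $\delta_q^{\mathrm{Ric}}$ on $M$ by $$\delta_q^{\mathrm{Ric}}(p)=\sup_{X\in T_p^1M}\mathrm{Ric}(X)-\frac{2q}{n}K_q^{\inf}(p),\qquad T_p^1M=\{X\in T_pM:\|X\|=1\}.$$ Extrinsic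 notions. A complex space form $N^m(4c)$ is a Kähler manifold of complex dimension $m$, with complex structure $J$, of constant holomorphic sectional curvature $4c$, $c\in\mathbb{R}$. A submanifold $M$ of $N^m(4c)$, with the induced metric, is totally real if $J(T_pM)\subset T_p^\perp M$ for every $p\in M$, where $T_p^\perp M$ is the normal space. $h$ denotes the second fundamental form of $M$ in $N^m(4c)$. The mean curvature vector is $\overrightarrow{H}=\frac1n\operatorname{trace}h$, and $H=\|\overrightarrow{H}\|$. $M$ is totally geodesic if $h=0$. *)

theory Defs
  imports "HOL-Analysis.Analysis" "HOL-Library.Function_Algebras"
begin

section \<open>Smooth manifolds\<close>

text \<open>Tangent vectors are represented below as functions on charts; the pointwise vector space
  structure makes each tangent space a \<open>subspace\<close> of a \<open>real_vector\<close> type.\<close>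

instantiation "fun" :: (type, real_vector) real_vector
begin

definition scaleR_fun :: "real \<Rightarrow> ('a \<Rightarrow> 'b) \<Rightarrow> 'a \<Rightarrow> 'b"
  where "scaleR_fun r f = (\<lambda>x. r *\<^sub>R f x)"

instance
  by standard
    (simp_all add: scaleR_fun_def plus_fun_def scaleR_add_right scaleR_add_left)

end

primrec Ck_on :: "nat \<Rightarrow> 'e::euclidean_space set \<Rightarrow> ('e \<Rightarrow> 'f::euclidean_space) \<Rightarrow> bool" where
  "Ck_on 0 S f \<longleftrightarrow> continuous_on S f"
| "Ck_on (Suc k) S f \<longleftrightarrow> (\<forall>x\<in>S. f differentiable (at x)) \<and>
     (\<forall>v. Ck_on k S (\<lambda>x. frechet_derivative f (at x) v))"

text \<open>Only used on open sets.\<close>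

definition smooth_on :: "'e::euclidean_space set \<Rightarrow> ('e \<Rightarrow> 'f::euclidean_space) \<Rightarrow> bool"
  where "smooth_on S f \<longleftrightarrow> (\<forall>k. Ck_on k S f)"

type_synonym ('a, 'e) chart = "'a set \<times> ('a \<Rightarrow> 'e)"

abbreviation chart_dom :: "('a, 'e) chart \<Rightarrow> 'a set"
  where "chart_dom \<phi> \<equiv> fst \<phi>"

abbreviation coord :: "('a, 'e) chart \<Rightarrow> 'a \<Rightarrow> 'e"
  where "coord \<phi> \<equiv> snd \<phi>"

definition param :: "('a, 'e) chart \<Rightarrow> 'e \<Rightarrow> 'a"
  where "param \<phi> = inv_into (chart_dom \<phi>) (coord \<phi>)"

definition is_chart :: "('a::topological_space, 'e::euclidean_space) chart \<Rightarrow> bool"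
  where "is_chart \<phi> \<longleftrightarrow> open (chart_dom \<phi>) \<and> open (coord \<phi> ` chart_dom \<phi>) \<and>
    homeomorphism (chart_dom \<phi>) (coord \<phi> ` chart_dom \<phi>) (coord \<phi>) (param \<phi>)"

text \<open>A manifold of dimension \<open>DIM('e)\<close> is the type \<open>'a\<close> with a smooth atlas modelled on \<open>'e\<close>;
  the atlas need not be maximal.\<close>

definition smooth_atlas ::
  "('a::{t2_space,second_countable_topology}, 'e::euclidean_space) chart set \<Rightarrow> bool"
  where "smooth_atlas A \<longleftrightarrow> (\<forall>\<phi>\<in>A. is_chart \<phi>) \<and> (\<Union>\<phi>\<in>A. chart_dom \<phi>) = UNIV \<and>
    (\<forall>\<phi>\<in>A. \<forall>\<psi>\<in>A. smooth_on (coord \<phi> ` (chart_dom \<phi> \<inter> chart_dom \<psi>)) (coord \<psi> \<circ> param \<phi>))"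

definition charts_at :: "('a, 'e) chart set \<Rightarrow> 'a \<Rightarrow> ('a, 'e) chart set"
  where "charts_at A p = {\<phi>\<in>A. p \<in> chart_dom \<phi>}"

text \<open>An arbitrary chart around \<open>p\<close>. The objects computed with it below (differential, curvature
  tensor, second fundamental form) are tensorial, hence do not depend on the choice.\<close>

definition chart_at :: "('a, 'e) chart set \<Rightarrow> 'a \<Rightarrow> ('a, 'e) chart"
  where "chart_at A p = (SOME \<phi>. \<phi> \<in> charts_at A p)"

text \<open>A tangent vector at \<open>p\<close> is the family of its coordinate vectors in all charts around \<open>p\<close>,
  which transform by the derivatives of the coordinate changes; the family is set to \<open>0\<close>
  at all other charts.\<close>

type_synonym ('a, 'e) tvec = "('a, 'e) chart \<Rightarrow> 'e"

definition tangent_space ::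
  "('a, 'e::euclidean_space) chart set \<Rightarrow> 'a \<Rightarrow> ('a, 'e) tvec set"
  where "tangent_space A p = {X. (\<forall>\<phi>. \<phi> \<notin> charts_at A p \<longrightarrow> X \<phi> = 0) \<and>
    (\<forall>\<phi>\<in>charts_at A p. \<forall>\<psi>\<in>charts_at A p.
       X \<psi> = frechet_derivative (coord \<psi> \<circ> param \<phi>) (at (coord \<phi> p)) (X \<phi>))}"

text \<open>The tangent vector at \<open>p\<close> with coordinate vector \<open>u\<close> in the chart \<open>\<phi>\<close>.\<close>

definition of_coord ::
  "('a, 'e::euclidean_space) chart set \<Rightarrow> ('a, 'e) chart \<Rightarrow> 'a \<Rightarrow> 'e \<Rightarrow> ('a, 'e) tvec"
  where "of_coord A \<phi> p u = (\<lambda>\<psi>. if \<psi> \<in> charts_at A p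
     then frechet_derivative (coord \<psi> \<circ> param \<phi>) (at (coord \<phi> p)) u else 0)"

section \<open>Riemannian manifolds\<close>

type_synonym ('a, 'e) metric = "'a \<Rightarrow> ('a, 'e) tvec \<Rightarrow> ('a, 'e) tvec \<Rightarrow> real"

definition local_metric ::
  "('a, 'e::euclidean_space) chart set \<Rightarrow> ('a, 'e) metric \<Rightarrow> ('a, 'e) chart \<Rightarrow> 'e \<Rightarrow> 'e \<Rightarrow> 'e \<Rightarrow> real"
  where "local_metric A g \<phi> x u v =
    g (param \<phi> x) (of_coord A \<phi> (param \<phi> x) u) (of_coord A \<phi> (param \<phi> x) v)"

definition riemannian_manifold ::
  "('a::{t2_space,second_countable_topology}, 'e::euclidean_space) chart set \<Rightarrow> ('a, 'e) metric \<Rightarrow> bool"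
  where "riemannian_manifold A g \<longleftrightarrow> smooth_atlas A \<and>
    (\<forall>p. \<forall>X\<in>tangent_space A p. \<forall>Y\<in>tangent_space A p. g p X Y = g p Y X) \<and>
    (\<forall>p. \<forall>X\<in>tangent_space A p. \<forall>Y\<in>tangent_space A p. \<forall>Z\<in>tangent_space A p. \<forall>r.
       g p (r *\<^sub>R X + Y) Z = r * g p X Z + g p Y Z) \<and>
    (\<forall>p. \<forall>X\<in>tangent_space A p. X \<noteq> 0 \<longrightarrow> g p X X > 0) \<and>
    (\<forall>\<phi>\<in>A. \<forall>u v. smooth_on (coord \<phi> ` chart_dom \<phi>) (\<lambda>x. local_metric A g \<phi> x u v))"

subsection \<open>Levi-Civita connection and curvature in a chart\<close>

text \<open>Here \<open>G x u v\<close> is a metric on an open subset of the model space. \<open>christoffel G x u v\<close> is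
  \<open>\<nabla>\<^sub>u v\<close> for the fields with constant coordinates \<open>u\<close>, \<open>v\<close>, given by the Koszul formula.\<close>

definition christoffel ::
  "('e::euclidean_space \<Rightarrow> 'e \<Rightarrow> 'e \<Rightarrow> real) \<Rightarrow> 'e \<Rightarrow> 'e \<Rightarrow> 'e \<Rightarrow> 'e"
  where "christoffel G x u v = (THE w. \<forall>z. 2 * G x w z =
      frechet_derivative (\<lambda>y. G y v z) (at x) u
    + frechet_derivative (\<lambda>y. G y u z) (at x) v
    - frechet_derivative (\<lambda>y. G y u v) (at x) z)"

text \<open>Covariant derivative at \<open>x\<close> in direction \<open>u\<close> of a vector field \<open>V\<close> along a map \<open>F\<close>,
  with respect to a metric \<open>G\<close> on the target of \<open>F\<close>.\<close>

definition cov_along ::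
  "('f::euclidean_space \<Rightarrow> 'f \<Rightarrow> 'f \<Rightarrow> real) \<Rightarrow> ('e::euclidean_space \<Rightarrow> 'f) \<Rightarrow> ('e \<Rightarrow> 'f) \<Rightarrow> 'e \<Rightarrow> 'e \<Rightarrow> 'f"
  where "cov_along G F V x u = frechet_derivative V (at x) u
    + christoffel G (F x) (frechet_derivative F (at x) u) (V x)"

abbreviation cov_deriv ::
  "('e::euclidean_space \<Rightarrow> 'e \<Rightarrow> 'e \<Rightarrow> real) \<Rightarrow> ('e \<Rightarrow> 'e) \<Rightarrow> 'e \<Rightarrow> 'e \<Rightarrow> 'e"
  where "cov_deriv G V x u \<equiv> cov_along G (\<lambda>y. y) V x u"

text \<open>\<open>R(u,v)w = \<nabla>\<^sub>u\<nabla>\<^sub>v w - \<nabla>\<^sub>v\<nabla>\<^sub>u w - \<nabla>\<^bsub>[u,v]\<^esub> w\<close> for fields with constant coordinates, whose brackets vanish.\<close>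

definition local_curvature ::
  "('e::euclidean_space \<Rightarrow> 'e \<Rightarrow> 'e \<Rightarrow> real) \<Rightarrow> 'e \<Rightarrow> 'e \<Rightarrow> 'e \<Rightarrow> 'e \<Rightarrow> 'e"
  where "local_curvature G x u v w =
      cov_deriv G (\<lambda>y. cov_deriv G (\<lambda>_. w) y v) x u
    - cov_deriv G (\<lambda>y. cov_deriv G (\<lambda>_. w) y u) x v"

subsection \<open>Curvature invariants\<close>

text \<open>\<open>g(R(X,Y)Z, W)\<close>\<close>

definition curvature_tensor ::
  "('a, 'e::euclidean_space) chart set \<Rightarrow> ('a, 'e) metric \<Rightarrow> 'a \<Rightarrow>
   ('a, 'e) tvec \<Rightarrow> ('a, 'e) tvec \<Rightarrow> ('a, 'e) tvec \<Rightarrow> ('a, 'e) tvec \<Rightarrow> real"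
  where "curvature_tensor A g p X Y Z W =
    (let \<phi> = chart_at A p; G = local_metric A g \<phi>; x = coord \<phi> p
     in G x (local_curvature G x (X \<phi>) (Y \<phi>) (Z \<phi>)) (W \<phi>))"

definition plane_section ::
  "('a, 'e::euclidean_space) chart set \<Rightarrow> 'a \<Rightarrow> ('a, 'e) tvec set \<Rightarrow> bool"
  where "plane_section A p \<pi> \<longleftrightarrow> subspace \<pi> \<and> \<pi> \<subseteq> tangent_space A p \<and> dim \<pi> = 2"

definition sectional_curvature ::
  "('a, 'e::euclidean_space) chart set \<Rightarrow> ('a, 'e) metric \<Rightarrow> 'a \<Rightarrow> ('a, 'e) tvec set \<Rightarrow> real"
  where "sectional_curvature A g p \<pi> = (THE k. \<forall>X\<in>\<pi>. \<forall>Y\<in>\<pi>.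
     g p X X = 1 \<and> g p Y Y = 1 \<and> g p X Y = 0 \<longrightarrow> k = curvature_tensor A g p X Y Y X)"

definition orthonormal_basis ::
  "('a, 'e::euclidean_space) chart set \<Rightarrow> ('a, 'e) metric \<Rightarrow> 'a \<Rightarrow> ('a, 'e) tvec set \<Rightarrow> bool"
  where "orthonormal_basis A g p E \<longleftrightarrow> finite E \<and> span E = tangent_space A p \<and>
    (\<forall>X\<in>E. \<forall>Y\<in>E. g p X Y = (if X = Y then 1 else 0))"

definition unit_tangent ::
  "('a, 'e::euclidean_space) chart set \<Rightarrow> ('a, 'e) metric \<Rightarrow> 'a \<Rightarrow> ('a, 'e) tvec set"
  where "unit_tangent A g p = {X \<in> tangent_space A p. g p X X = 1}"

definition Ric ::
  "('a, 'e::euclidean_space) chart set \<Rightarrow> ('a, 'e) metric \<Rightarrow> 'a \<Rightarrow> ('a, 'e) tvec \<Rightarrow> real"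
  where "Ric A g p X = (THE r. \<forall>E. orthonormal_basis A g p E \<and> X \<in> E \<longrightarrow>
     r = (\<Sum>Y\<in>E - {X}. sectional_curvature A g p (span {X, Y})))"

definition einstein :: "('a, 'e::euclidean_space) chart set \<Rightarrow> ('a, 'e) metric \<Rightarrow> bool"
  where "einstein A g \<longleftrightarrow>
    (\<forall>p. \<forall>X\<in>unit_tangent A g p. \<forall>Y\<in>unit_tangent A g p. Ric A g p X = Ric A g p Y)"

definition orthogonal_planes ::
  "('a, 'e::euclidean_space) chart set \<Rightarrow> ('a, 'e) metric \<Rightarrow> 'a \<Rightarrow> nat \<Rightarrow> (nat \<Rightarrow> ('a, 'e) tvec set) \<Rightarrow> bool"
  where "orthogonal_planes A g p q \<pi> \<longleftrightarrow> (\<forall>i\<in>{1..q}. plane_section A p (\<pi> i)) \<and>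
    (\<forall>i\<in>{1..q}. \<forall>j\<in>{1..q}. i \<noteq> j \<longrightarrow> (\<forall>X\<in>\<pi> i. \<forall>Y\<in>\<pi> j. g p X Y = 0))"

definition K_inf ::
  "('a, 'e::euclidean_space) chart set \<Rightarrow> ('a, 'e) metric \<Rightarrow> nat \<Rightarrow> 'a \<Rightarrow> real"
  where "K_inf A g q p = (INF \<pi>\<in>{\<pi>. orthogonal_planes A g p q \<pi>}.
     (\<Sum>i=1..q. sectional_curvature A g p (\<pi> i)) / real q)"

definition delta_Ric ::
  "('a, 'e::euclidean_space) chart set \<Rightarrow> ('a, 'e) metric \<Rightarrow> nat \<Rightarrow> 'a \<Rightarrow> real"
  where "delta_Ric A g q p = (SUP X\<in>unit_tangent A g p. Ric A g p X)
     - 2 * real q / real DIM('e) * K_inf A g q p"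

section \<open>Complex space forms\<close>

type_synonym ('a, 'e) endo_field = "'a \<Rightarrow> ('a, 'e) tvec \<Rightarrow> ('a, 'e) tvec"

definition local_endo ::
  "('a, 'e::euclidean_space) chart set \<Rightarrow> ('a, 'e) endo_field \<Rightarrow> ('a, 'e) chart \<Rightarrow> 'e \<Rightarrow> 'e \<Rightarrow> 'e"
  where "local_endo A J \<phi> x u = J (param \<phi> x) (of_coord A \<phi> (param \<phi> x) u) \<phi>"

definition almost_complex_structure ::
  "('a, 'e::euclidean_space) chart set \<Rightarrow> ('a, 'e) endo_field \<Rightarrow> bool"
  where "almost_complex_structure A J \<longleftrightarrow>
    (\<forall>p. \<forall>X\<in>tangent_space A p. J p X \<in> tangent_space A p \<and> J p (J p X) = - X) \<and>
    (\<forall>p. \<forall>X\<in>tangent_space A p. \<forall>Y\<in>tangent_space A p. \<forall>r.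
       J p (r *\<^sub>R X + Y) = r *\<^sub>R J p X + J p Y) \<and>
    (\<forall>\<phi>\<in>A. \<forall>u. smooth_on (coord \<phi> ` chart_dom \<phi>) (\<lambda>x. local_endo A J \<phi> x u))"

text \<open>The last condition is \<open>\<nabla>J = 0\<close>, i.e. \<open>\<nabla>\<^sub>u (J v) = J (\<nabla>\<^sub>u v)\<close>, which for an almost Hermitian
  structure also gives the integrability of \<open>J\<close>.\<close>

definition kaehler_manifold ::
  "('a::{t2_space,second_countable_topology}, 'e::euclidean_space) chart set \<Rightarrow>
   ('a, 'e) metric \<Rightarrow> ('a, 'e) endo_field \<Rightarrow> bool"
  where "kaehler_manifold A g J \<longleftrightarrow> riemannian_manifold A g \<and> almost_complex_structure A J \<and>
    (\<forall>p. \<forall>X\<in>tangent_space A p. \<forall>Y\<in>tangent_space A p. g p (J p X) (J p Y) = g p X Y) \<and>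
    (\<forall>\<phi>\<in>A. \<forall>x\<in>coord \<phi> ` chart_dom \<phi>. \<forall>u v.
       cov_deriv (local_metric A g \<phi>) (\<lambda>y. local_endo A J \<phi> y v) x u =
       local_endo A J \<phi> x (cov_deriv (local_metric A g \<phi>) (\<lambda>_. v) x u))"

text \<open>\<open>k\<close> is the constant holomorphic sectional curvature.\<close>

definition complex_space_form ::
  "('a::{t2_space,second_countable_topology}, 'e::euclidean_space) chart set \<Rightarrow>
   ('a, 'e) metric \<Rightarrow> ('a, 'e) endo_field \<Rightarrow> real \<Rightarrow> bool"
  where "complex_space_form A g J k \<longleftrightarrow> kaehler_manifold A g J \<and>
    (\<forall>p. \<forall>X\<in>tangent_space A p. X \<noteq> 0 \<longrightarrow> sectional_curvature A g p (span {X, J p X}) = k)"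

section \<open>Submanifolds\<close>

definition local_map ::
  "('a, 'e) chart \<Rightarrow> ('b, 'f) chart \<Rightarrow> ('a \<Rightarrow> 'b) \<Rightarrow> 'e \<Rightarrow> 'f"
  where "local_map \<phi> \<psi> f = coord \<psi> \<circ> f \<circ> param \<phi>"

definition smooth_map ::
  "('a::topological_space, 'e::euclidean_space) chart set \<Rightarrow>
   ('b::topological_space, 'f::euclidean_space) chart set \<Rightarrow> ('a \<Rightarrow> 'b) \<Rightarrow> bool"
  where "smooth_map A B f \<longleftrightarrow> continuous_on UNIV f \<and>
    (\<forall>\<phi>\<in>A. \<forall>\<psi>\<in>B. smooth_on (coord \<phi> ` (chart_dom \<phi> \<inter> f -` chart_dom \<psi>)) (local_map \<phi> \<psi> f))"

definition differential ::
  "('a, 'e::euclidean_space) chart set \<Rightarrow> ('b, 'f::euclidean_space) chart set \<Rightarrow> ('a \<Rightarrow> 'b) \<Rightarrow>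
   'a \<Rightarrow> ('a, 'e) tvec \<Rightarrow> ('b, 'f) tvec"
  where "differential A B f p X =
    (let \<phi> = chart_at A p; \<psi> = chart_at B (f p)
     in of_coord B \<psi> (f p) (frechet_derivative (local_map \<phi> \<psi> f) (at (coord \<phi> p)) (X \<phi>)))"

text \<open>\<open>M\<close>, with atlas \<open>A\<close>, is a submanifold of \<open>N\<close>, with atlas \<open>B\<close>, via the immersion \<open>f\<close>, and
  \<open>g\<close> is the metric on \<open>M\<close> induced from the metric \<open>g'\<close> on \<open>N\<close>.\<close>

definition riemannian_submanifold ::
  "('a::{t2_space,second_countable_topology}, 'e::euclidean_space) chart set \<Rightarrow> ('a, 'e) metric \<Rightarrow>
   ('b::{t2_space,second_countable_topology}, 'f::euclidean_space) chart set \<Rightarrow> ('b, 'f) metric \<Rightarrow>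
   ('a \<Rightarrow> 'b) \<Rightarrow> bool"
  where "riemannian_submanifold A g B g' f \<longleftrightarrow>
    riemannian_manifold A g \<and> riemannian_manifold B g' \<and> smooth_map A B f \<and>
    (\<forall>p. inj_on (differential A B f p) (tangent_space A p)) \<and>
    (\<forall>p. \<forall>X\<in>tangent_space A p. \<forall>Y\<in>tangent_space A p.
       g p X Y = g' (f p) (differential A B f p X) (differential A B f p Y))"

definition normal_space ::
  "('a, 'e::euclidean_space) chart set \<Rightarrow> ('b, 'f::euclidean_space) chart set \<Rightarrow> ('b, 'f) metric \<Rightarrow>
   ('a \<Rightarrow> 'b) \<Rightarrow> 'a \<Rightarrow> ('b, 'f) tvec set"
  where "normal_space A B g' f p =
    {\<xi> \<in> tangent_space B (f p). \<forall>X\<in>tangent_space A p. g' (f p) \<xi> (differential A B f p X) = 0}"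

definition totally_real ::
  "('a, 'e::euclidean_space) chart set \<Rightarrow> ('b, 'f::euclidean_space) chart set \<Rightarrow> ('b, 'f) metric \<Rightarrow>
   ('b, 'f) endo_field \<Rightarrow> ('a \<Rightarrow> 'b) \<Rightarrow> bool"
  where "totally_real A B g' J f \<longleftrightarrow>
    (\<forall>p. J (f p) ` differential A B f p ` tangent_space A p \<subseteq> normal_space A B g' f p)"

text \<open>The Gauss formula \<open>h(X,Y) = \<nabla>'\<^sub>X Y - \<nabla>\<^sub>X Y\<close>, with \<open>Y\<close> extended to the field with constant
  coordinates, where \<open>\<nabla>'\<close> and \<open>\<nabla>\<close> are the Levi-Civita connections of \<open>N\<close> and \<open>M\<close>.\<close>

definition second_fundamental_form ::
  "('a, 'e::euclidean_space) chart set \<Rightarrow> ('a, 'e) metric \<Rightarrow>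
   ('b, 'f::euclidean_space) chart set \<Rightarrow> ('b, 'f) metric \<Rightarrow> ('a \<Rightarrow> 'b) \<Rightarrow>
   'a \<Rightarrow> ('a, 'e) tvec \<Rightarrow> ('a, 'e) tvec \<Rightarrow> ('b, 'f) tvec"
  where "second_fundamental_form A g B g' f p X Y =
    (let \<phi> = chart_at A p; \<psi> = chart_at B (f p); F = local_map \<phi> \<psi> f; x = coord \<phi> p
     in of_coord B \<psi> (f p)
          (cov_along (local_metric B g' \<psi>) F (\<lambda>y. frechet_derivative F (at y) (Y \<phi>)) x (X \<phi>)
           - frechet_derivative F (at x) (cov_deriv (local_metric A g \<phi>) (\<lambda>_. Y \<phi>) x (X \<phi>))))"

definition totally_geodesic ::
  "('a, 'e::euclidean_space) chart set \<Rightarrow> ('a, 'e) metric \<Rightarrow>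
   ('b, 'f::euclidean_space) chart set \<Rightarrow> ('b, 'f) metric \<Rightarrow> ('a \<Rightarrow> 'b) \<Rightarrow> bool"
  where "totally_geodesic A g B g' f \<longleftrightarrow>
    (\<forall>p. \<forall>X\<in>tangent_space A p. \<forall>Y\<in>tangent_space A p. second_fundamental_form A g B g' f p X Y = 0)"

definition mean_curvature_vector ::
  "('a, 'e::euclidean_space) chart set \<Rightarrow> ('a, 'e) metric \<Rightarrow>
   ('b, 'f::euclidean_space) chart set \<Rightarrow> ('b, 'f) metric \<Rightarrow> ('a \<Rightarrow> 'b) \<Rightarrow> 'a \<Rightarrow> ('b, 'f) tvec"
  where "mean_curvature_vector A g B g' f p = (1 / real DIM('e)) *\<^sub>R
    (THE t. \<forall>E. orthonormal_basis A g p E \<longrightarrow>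
       t = (\<Sum>X\<in>E. second_fundamental_form A g B g' f p X X))"

definition mean_curvature ::
  "('a, 'e::euclidean_space) chart set \<Rightarrow> ('a, 'e) metric \<Rightarrow>
   ('b, 'f::euclidean_space) chart set \<Rightarrow> ('b, 'f) metric \<Rightarrow> ('a \<Rightarrow> 'b) \<Rightarrow> 'a \<Rightarrow> real"
  where "mean_curvature A g B g' f p =
    sqrt (g' (f p) (mean_curvature_vector A g B g' f p) (mean_curvature_vector A g B g' f p))"

end

theory Submission
  imports Defs
begin

text \<open>
  In a Kaehler manifold of constant holomorphic sectional curvature \<open>4c\<close> every totally real plane has
  curvature \<open>c\<close>, so at each point the Gauss equation expresses the curvature of \<open>M\<close> by \<open>c\<close> and \<open>h\<close>.
  Complete orthonormal bases of the planes \<open>\<pi>\<^sub>1\<close>, \<dots>, \<open>\<pi>\<^sub>q\<close> to one of the tangent space, split it into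
  the \<open>N = n - q\<close> groups consisting of these planes and the remaining single vectors, and let \<open>t\<^sub>k\<close> be the
  trace of \<open>h\<close> over the \<open>k\<close>-th group and \<open>t = \<Sum> t\<^sub>k = n H\<close>. Then, with \<open>Off \<ge> 0\<close> the sum of the \<open>|h|\<^sup>2\<close>
  of ordered pairs of basis vectors from different groups,
  \<open>n Ric - 2 \<Sum> K(\<pi>\<^sub>i) = n (n - 1) c - 2 q c + |t|\<^sup>2 - \<Sum> |t\<^sub>k|\<^sup>2 - Off\<close>, and \<open>\<Sum> |t\<^sub>k|\<^sup>2 \<ge> |t|\<^sup>2 / N\<close> gives
  the inequality with deficit \<open>\<delta> = \<Sum> |t\<^sub>k - t / N|\<^sup>2 + Off\<close>.

  Since \<open>2 q < n\<close>, there is a basis vector outside the planes. Comparing its Ricci curvature with the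
  mean of all Ricci curvatures and using \<open>|u|\<^sup>2 + |v|\<^sup>2 \<ge> |u + v|\<^sup>2 / 2\<close> on each plane yields
  \<open>|h|\<^sup>2 \<le> C \<delta>\<close> with \<open>C\<close> depending on \<open>n\<close> and \<open>q\<close> only. Equality means that \<open>\<delta>\<close> has infimum \<open>0\<close>
  over all choices of planes, whence \<open>h = 0\<close>.
\<close>

section \<open>Calculus\<close>

text \<open>The overview only names the comparison that forces \<open>h\<close> to vanish; here is
  why it works. Put \<mu> = t / N and m = |\<mu>|^2, and call a quantity negligible if it is bounded
  by a multiple of \<delta>. Up to negligible terms every group trace is \<mu> and \<open>h\<close>
  vanishes on pairs from different groups. For a basis vector z outside the planes h(z,z) is itself
  a group trace, so Ric(z) is about (n - 1) c + N m - m, while the mean of all Ricci curvatures is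
  (n - 1) c + (N^2 m - |h|^2) / n. The Einstein condition equates the two, so |h|^2 is about (n - q
  N) m. The traces alone already give |h|^2 at least about (q / 2 + n - 2 q) m = (N - q / 2) m. The
  second coefficient exceeds the first by q (N - 3 / 2), which is at least 1 / 2 because N \<ge> q +
  1 \<ge> 2. Hence m is negligible, and with it |h|^2. The negligible terms also contain inner
  products with \<mu>, which are only of the order of the square root of \<delta> m; a weighted
  Young inequality splits them into a small multiple of m and a multiple of \<delta>.\<close>

abbreviation dd :: "('x::real_normed_vector \<Rightarrow> 'y::real_normed_vector) \<Rightarrow> 'x \<Rightarrow> 'x \<Rightarrow> 'y"
  where "dd F x v \<equiv> frechet_derivative F (at x) v"

lemma dd_eq: "(F has_derivative F') (at x) \<Longrightarrow> dd F x v = F' v"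
  by (metis frechet_derivative_at)

lemma has_derivative_dd: "F differentiable (at x) \<Longrightarrow> (F has_derivative (\<lambda>v. dd F x v)) (at x)"
  by (simp add: frechet_derivative_works)

lemma has_derivative_compose_dd:
  assumes "(F has_derivative F') (at x within T)" "G differentiable (at (F x))"
  shows "((\<lambda>y. G (F y)) has_derivative (\<lambda>k. dd G (F x) (F' k))) (at x within T)"
  by (rule has_derivative_compose[OF assms(1) has_derivative_dd[OF assms(2)]])

lemma dd_linear: "F differentiable (at x) \<Longrightarrow> linear (dd F x)"
  by (simp add: linear_frechet_derivative)

lemma has_derivative_cong_open:
  assumes "open S" "x \<in> S" "\<And>y. y \<in> S \<Longrightarrow> F y = G y"
  shows "(F has_derivative F') (at x) \<longleftrightarrow> (G has_derivative F') (at x)"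
  using assms by (metis has_derivative_transform_within_open)

lemma dd_cong_open:
  assumes "open S" "x \<in> S" "\<And>y. y \<in> S \<Longrightarrow> F y = G y"
  shows "dd F x = dd G x"
  using has_derivative_cong_open[OF assms] by (simp add: frechet_derivative_def)

lemma differentiable_cong_open:
  assumes "open S" "x \<in> S" "\<And>y. y \<in> S \<Longrightarrow> F y = G y"
  shows "F differentiable (at x) \<longleftrightarrow> G differentiable (at x)"
  using has_derivative_cong_open[OF assms] by (simp add: differentiable_def)

lemma dd_chain:
  assumes "F differentiable (at x)" "G differentiable (at (F x))"
  shows "dd (G \<circ> F) x v = dd G (F x) (dd F x v)"
  using frechet_derivative_compose[OF assms] by simp

lemma dd_add:
  assumes "F differentiable (at x)" "G differentiable (at x)"
  shows "dd (\<lambda>y. F y + G y) x v = dd F x v + dd G x v"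
  by (rule dd_eq) (intro has_derivative_add has_derivative_dd assms)

lemma dd_scaleR:
  assumes "F differentiable (at x)"
  shows "dd (\<lambda>y. r *\<^sub>R F y) x v = r *\<^sub>R dd F x v"
  by (rule dd_eq) (intro has_derivative_scaleR_right has_derivative_dd assms)

lemma dd_id [simp]: "dd (\<lambda>y. y) x v = v"
  by (rule dd_eq) (rule has_derivative_ident)

lemma dd_const [simp]: "dd (\<lambda>y. a) x v = 0"
  by (rule dd_eq) (rule has_derivative_const)

lemma smooth_on_differentiable: "smooth_on S F \<Longrightarrow> x \<in> S \<Longrightarrow> F differentiable (at x)"
  unfolding smooth_on_def using Ck_on.simps(2) by blast

lemma smooth_on_dd: "smooth_on S F \<Longrightarrow> smooth_on S (\<lambda>x. dd F x v)"
  unfolding smooth_on_def using Ck_on.simps(2) by blast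

lemma smooth_on_continuous: "smooth_on S F \<Longrightarrow> continuous_on S F"
  unfolding smooth_on_def by (metis Ck_on.simps(1))

section \<open>Symmetry of mixed second derivatives\<close>

lemma second_difference:
  fixes F :: "'x::real_normed_vector \<Rightarrow> real"
  assumes t: "0 < t"
    and box: "\<And>s s'. 0 \<le> s \<Longrightarrow> s \<le> t \<Longrightarrow> 0 \<le> s' \<Longrightarrow> s' \<le> t \<Longrightarrow> x + s *\<^sub>R u + s' *\<^sub>R v \<in> S"
    and F: "\<And>y. y \<in> S \<Longrightarrow> F differentiable (at y)"
    and Fu: "\<And>y. y \<in> S \<Longrightarrow> (\<lambda>y. dd F y u) differentiable (at y)"
  shows "\<exists>s s'. 0 \<le> s \<and> s \<le> t \<and> 0 \<le> s' \<and> s' \<le> t \<and>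
    F (x + t *\<^sub>R u + t *\<^sub>R v) - F (x + t *\<^sub>R u) - F (x + t *\<^sub>R v) + F x
      = t * t * dd (\<lambda>y. dd F y u) (x + s *\<^sub>R u + s' *\<^sub>R v) v"
proof -
  \<comment> \<open>The second difference is the increment of \<open>k\<close> over [0, t]. The mean
    value theorem in direction \<open>u\<close> turns it into a difference of
    \<open>u\<close>-derivatives, and a second application in direction \<open>v\<close> into a
    mixed derivative.\<close>
  define k where "k s = F (x + s *\<^sub>R u + t *\<^sub>R v) - F (x + s *\<^sub>R u + 0 *\<^sub>R v)" for s
  have dk: "((\<lambda>s. F (x + s *\<^sub>R u + a *\<^sub>R v)) has_derivative
      (\<lambda>h. dd F (x + s *\<^sub>R u + a *\<^sub>R v) (h *\<^sub>R u))) (at s within {0..t})"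
    if "0 \<le> s" "s \<le> t" "0 \<le> a" "a \<le> t" for s a
  proof -
    have "((\<lambda>s. x + s *\<^sub>R u + a *\<^sub>R v) has_derivative (\<lambda>h. h *\<^sub>R u)) (at s)"
      by (auto intro!: derivative_eq_intros)
    then show ?thesis
      by (rule has_derivative_at_withinI[OF has_derivative_compose_dd[where G = F]])
        (rule F[OF box[OF that]])
  qed
  have "\<exists>s\<in>{0<..<t}. k t - k 0 = (\<lambda>h. dd F (x + s *\<^sub>R u + t *\<^sub>R v) (h *\<^sub>R u)
      - dd F (x + s *\<^sub>R u + 0 *\<^sub>R v) (h *\<^sub>R u)) (t - 0)"
    unfolding k_def by (rule mvt_simple[OF t]; rule has_derivative_diff; rule dk) (use t in auto)
  then obtain s where s: "0 < s" "s < t"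
    and ks: "k t - k 0 = dd F (x + s *\<^sub>R u + t *\<^sub>R v) (t *\<^sub>R u) - dd F (x + s *\<^sub>R u + 0 *\<^sub>R v) (t *\<^sub>R u)"
    by auto
  have lin: "dd F (x + s *\<^sub>R u + a *\<^sub>R v) (t *\<^sub>R u) = t * dd F (x + s *\<^sub>R u + a *\<^sub>R v) u"
    if "0 \<le> a" "a \<le> t" for a
    using linear_scale[OF dd_linear[OF F[OF box]], of s a] s that by simp
  have "\<exists>s'\<in>{0<..<t}. dd F (x + s *\<^sub>R u + t *\<^sub>R v) u - dd F (x + s *\<^sub>R u + 0 *\<^sub>R v) u
     = (\<lambda>h. dd (\<lambda>y. dd F y u) (x + s *\<^sub>R u + s' *\<^sub>R v) (h *\<^sub>R v)) (t - 0)"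
  proof (rule mvt_simple[OF t, where f = "\<lambda>a. dd F (x + s *\<^sub>R u + a *\<^sub>R v) u"])
    fix a assume a: "0 \<le> a" "a \<le> t"
    show "((\<lambda>a. dd F (x + s *\<^sub>R u + a *\<^sub>R v) u) has_derivative
        (\<lambda>h. dd (\<lambda>y. dd F y u) (x + s *\<^sub>R u + a *\<^sub>R v) (h *\<^sub>R v))) (at a within {0..t})"
    proof -
      have "x + s *\<^sub>R u + a *\<^sub>R v \<in> S" using s a by (intro box) auto
      moreover have "((\<lambda>a. x + s *\<^sub>R u + a *\<^sub>R v) has_derivative (\<lambda>h. h *\<^sub>R v)) (at a)"
        by (auto intro!: derivative_eq_intros)
      ultimately show ?thesis
        by - (rule has_derivative_at_withinI[OF has_derivative_compose_dd[where G = "\<lambda>y. dd F y u"]], assumption, rule Fu)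
    qed
  qed
  then obtain s' where s': "0 < s'" "s' < t"
    and ks': "dd F (x + s *\<^sub>R u + t *\<^sub>R v) u - dd F (x + s *\<^sub>R u + 0 *\<^sub>R v) u
      = dd (\<lambda>y. dd F y u) (x + s *\<^sub>R u + s' *\<^sub>R v) (t *\<^sub>R v)"
    by auto
  have "k t - k 0 = t * dd F (x + s *\<^sub>R u + t *\<^sub>R v) u - t * dd F (x + s *\<^sub>R u + 0 *\<^sub>R v) u"
    using ks lin[of t] lin[of 0] t by simp
  also have "\<dots> = t * (dd (\<lambda>y. dd F y u) (x + s *\<^sub>R u + s' *\<^sub>R v) (t *\<^sub>R v))"
    using ks' by (simp add: algebra_simps)
  also have "\<dots> = t * t * dd (\<lambda>y. dd F y u) (x + s *\<^sub>R u + s' *\<^sub>R v) v"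
    using linear_scale[OF dd_linear[OF Fu[OF box]], of s s'] s s' by simp
  finally show ?thesis
    using s s' unfolding k_def by (intro exI[of _ s] exI[of _ s']) auto
qed

text \<open>The second difference is symmetric in \<open>u\<close> and \<open>v\<close>, so both
  mixed derivatives, each at some point near \<open>x\<close>, equal the same number divided by t^2.
  Continuity at \<open>x\<close> then excludes a gap of 2 e between their values there.\<close>

lemma mixed_partials_real:
  fixes F :: "'x::real_normed_vector \<Rightarrow> real"
  assumes "open S" "x \<in> S"
    and F: "\<And>y. y \<in> S \<Longrightarrow> F differentiable (at y)"
    and F1: "\<And>y w. y \<in> S \<Longrightarrow> (\<lambda>y. dd F y w) differentiable (at y)"
    and F2: "\<And>w z. continuous_on S (\<lambda>y. dd (\<lambda>y. dd F y w) y z)"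
  shows "dd (\<lambda>y. dd F y u) x v = dd (\<lambda>y. dd F y v) x u"
proof (rule ccontr)
  let ?A = "\<lambda>y. dd (\<lambda>y. dd F y u) y v" and ?B = "\<lambda>y. dd (\<lambda>y. dd F y v) y u"
  assume ne: "?A x \<noteq> ?B x"
  define e where "e = \<bar>?A x - ?B x\<bar> / 2"
  have "e > 0" using ne by (simp add: e_def)
  obtain r0 where r0: "r0 > 0" "ball x r0 \<subseteq> S"
    using assms(1,2) open_contains_ball by blast
  obtain r1 where r1: "r1 > 0" "\<And>y. y \<in> S \<Longrightarrow> dist y x < r1 \<Longrightarrow> dist (?A y) (?A x) < e"
    using F2[of u v] \<open>e > 0\<close> \<open>x \<in> S\<close> unfolding continuous_on_iff by blast
  obtain r2 where r2: "r2 > 0" "\<And>y. y \<in> S \<Longrightarrow> dist y x < r2 \<Longrightarrow> dist (?B y) (?B x) < e"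
    using F2[of v u] \<open>e > 0\<close> \<open>x \<in> S\<close> unfolding continuous_on_iff by blast
  define r where "r = min r0 (min r1 r2)"
  have "r > 0" using r0 r1 r2 by (simp add: r_def)
  \<comment> \<open>With this scale the whole parallelogram spanned by \<open>t *\<^sub>R u\<close>
    and \<open>t *\<^sub>R v\<close> stays within r / 2 of \<open>x\<close>; the summand 1 covers
    the case u = v = 0.\<close>
  define t where "t = r / (2 * (norm u + norm v + 1))"
  have pos: "norm u + norm v + 1 > 0"
    by (smt (verit) norm_ge_zero)
  then have t: "t > 0" using \<open>r > 0\<close> by (simp add: t_def)
  have near: "dist (x + s *\<^sub>R a + s' *\<^sub>R b) x < r"
    if "0 \<le> s" "s \<le> t" "0 \<le> s'" "s' \<le> t" "norm a + norm b = norm u + norm v" for s s' a b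
  proof -
    have "dist (x + s *\<^sub>R a + s' *\<^sub>R b) x = norm (s *\<^sub>R a + s' *\<^sub>R b)"
      by (simp add: dist_norm algebra_simps)
    also have "\<dots> \<le> s * norm a + s' * norm b"
      using that by (intro norm_triangle_le) auto
    also have "\<dots> \<le> t * norm a + t * norm b"
      using that by (intro add_mono mult_right_mono) auto
    also have "\<dots> = t * (norm u + norm v)"
      using that by (simp add: algebra_simps flip: that(5))
    also have "\<dots> \<le> t * (norm u + norm v + 1)" using t by simp
    also have "\<dots> = r / 2" using pos by (simp add: t_def field_simps)
    also have "\<dots> < r" using \<open>r > 0\<close> by simp
    finally show ?thesis .
  qed
  have inS: "y \<in> S" if "dist y x < r" for y
    using that r0 by (auto simp: r_def dist_commute subset_iff)
  obtain s s' where s: "0 \<le> s" "s \<le> t" "0 \<le> s'" "s' \<le> t"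
    and A: "F (x + t *\<^sub>R u + t *\<^sub>R v) - F (x + t *\<^sub>R u) - F (x + t *\<^sub>R v) + F x
      = t * t * ?A (x + s *\<^sub>R u + s' *\<^sub>R v)"
    using second_difference[OF t inS[OF near] F F1, where u = u and v = v] by auto
  obtain z z' where z: "0 \<le> z" "z \<le> t" "0 \<le> z'" "z' \<le> t"
    and B: "F (x + t *\<^sub>R v + t *\<^sub>R u) - F (x + t *\<^sub>R v) - F (x + t *\<^sub>R u) + F x
      = t * t * ?B (x + z *\<^sub>R v + z' *\<^sub>R u)"
    using second_difference[OF t inS[OF near] F F1, where u = v and v = u] by auto
  have "t * t * ?A (x + s *\<^sub>R u + s' *\<^sub>R v) = t * t * ?B (x + z *\<^sub>R v + z' *\<^sub>R u)"
    using A B by (simp add: algebra_simps)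
  then have "?A (x + s *\<^sub>R u + s' *\<^sub>R v) = ?B (x + z *\<^sub>R v + z' *\<^sub>R u)"
    using t by simp
  moreover have "dist (?A (x + s *\<^sub>R u + s' *\<^sub>R v)) (?A x) < e"
    using near[OF s, of u v] by (intro r1(2) inS) (auto simp: r_def)
  moreover have "dist (?B (x + z *\<^sub>R v + z' *\<^sub>R u)) (?B x) < e"
    using near[OF z, of v u] by (intro r2(2) inS) (auto simp: r_def)
  ultimately show False
    unfolding e_def dist_real_def by argo
qed

lemma mixed_partials:
  fixes F :: "'x::euclidean_space \<Rightarrow> 'y::euclidean_space"
  assumes "open S" "x \<in> S" "smooth_on S F"
  shows "dd (\<lambda>y. dd F y u) x v = dd (\<lambda>y. dd F y v) x u"
proof (rule euclidean_eqI)
  fix b :: 'y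
  have 1: "dd (\<lambda>z. F z \<bullet> b) y w = dd F y w \<bullet> b" if "y \<in> S" for y w
    by (rule dd_eq) (intro has_derivative_inner_left has_derivative_dd
        smooth_on_differentiable[OF assms(3) that])
  have 2: "dd (\<lambda>z. dd F z w \<bullet> b) y k = dd (\<lambda>z. dd F z w) y k \<bullet> b" if "y \<in> S" for y w k
    by (rule dd_eq) (intro has_derivative_inner_left has_derivative_dd
        smooth_on_differentiable[OF smooth_on_dd[OF assms(3)] that])
  have 3: "dd (\<lambda>z. dd (\<lambda>z. F z \<bullet> b) z w) y k = dd (\<lambda>z. dd F z w) y k \<bullet> b" if "y \<in> S" for y w k
    using 1 2[OF that] dd_cong_open[OF assms(1) that, of "\<lambda>z. dd (\<lambda>z. F z \<bullet> b) z w" "\<lambda>z. dd F z w \<bullet> b"]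
    by simp
  have "dd (\<lambda>z. dd (\<lambda>z. F z \<bullet> b) z u) x v = dd (\<lambda>z. dd (\<lambda>z. F z \<bullet> b) z v) x u"
  proof (rule mixed_partials_real[OF assms(1,2)])
    show "(\<lambda>z. F z \<bullet> b) differentiable (at y)" if "y \<in> S" for y
      using smooth_on_differentiable[OF assms(3) that] by (intro differentiable_inner) auto
    show "(\<lambda>z. dd (\<lambda>z. F z \<bullet> b) z w) differentiable (at y)" if "y \<in> S" for y w
      using differentiable_cong_open[OF assms(1) that, of "\<lambda>z. dd (\<lambda>z. F z \<bullet> b) z w" "\<lambda>z. dd F z w \<bullet> b"]
        1 smooth_on_differentiable[OF smooth_on_dd[OF assms(3)] that]
      by (simp add: differentiable_inner)
    show "continuous_on S (\<lambda>z. dd (\<lambda>z. dd (\<lambda>z. F z \<bullet> b) z w) z k)" for w k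
      using continuous_on_inner[OF smooth_on_continuous[OF smooth_on_dd[OF smooth_on_dd[OF assms(3)]]] continuous_on_const]
      by (subst continuous_on_cong[OF refl 3]) auto
  qed
  then show "dd (\<lambda>y. dd F y u) x v \<bullet> b = dd (\<lambda>y. dd F y v) x u \<bullet> b"
    using 3[OF assms(2)] by simp
qed

section \<open>Product rules and linear equations depending on a parameter\<close>

lemma linear_sum_basis:
  fixes L :: "'x::euclidean_space \<Rightarrow> 'y::real_vector"
  assumes "linear L"
  shows "L w = (\<Sum>b\<in>Basis. (w \<bullet> b) *\<^sub>R L b)"
proof -
  have "L w = L (\<Sum>b\<in>Basis. (w \<bullet> b) *\<^sub>R b)" by (simp add: euclidean_representation)
  also have "\<dots> = (\<Sum>b\<in>Basis. (w \<bullet> b) *\<^sub>R L b)"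
    by (simp add: linear_sum[OF assms] linear_scale[OF assms])
  finally show ?thesis .
qed

text \<open>Differentiability is assumed only for each fixed argument \<open>w\<close>. In finite
  dimension this suffices: expanding \<open>V y\<close> in the basis leaves finitely many products
  of differentiable functions.\<close>

lemma has_derivative_linear_family:
  fixes L :: "'z::real_normed_vector \<Rightarrow> 'x::euclidean_space \<Rightarrow> 'y::real_normed_vector"
  assumes "open S" "x \<in> S" and lin: "\<And>y. y \<in> S \<Longrightarrow> linear (L y)"
    and L: "\<And>w. (\<lambda>y. L y w) differentiable (at x)" and V: "V differentiable (at x)"
  shows "((\<lambda>y. L y (V y)) has_derivative
    (\<lambda>k. dd (\<lambda>y. L y (V x)) x k + L x (dd V x k))) (at x)"
proof -
  have 1: "((\<lambda>y. \<Sum>b\<in>Basis. (V y \<bullet> b) *\<^sub>R L y b) has_derivative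
    (\<lambda>k. \<Sum>b\<in>Basis. (V x \<bullet> b) *\<^sub>R dd (\<lambda>y. L y b) x k + (dd V x k \<bullet> b) *\<^sub>R L x b)) (at x)"
    by (intro has_derivative_sum has_derivative_scaleR has_derivative_inner_left has_derivative_dd L V)
  have "((\<lambda>y. \<Sum>b\<in>Basis. (V x \<bullet> b) *\<^sub>R L y b) has_derivative
    (\<lambda>k. \<Sum>b\<in>Basis. (V x \<bullet> b) *\<^sub>R dd (\<lambda>y. L y b) x k)) (at x)"
    by (intro has_derivative_sum has_derivative_scaleR_right has_derivative_dd L)
  then have "((\<lambda>y. L y (V x)) has_derivative
    (\<lambda>k. \<Sum>b\<in>Basis. (V x \<bullet> b) *\<^sub>R dd (\<lambda>y. L y b) x k)) (at x)"
    by (subst has_derivative_cong_open[OF assms(1,2)]) (auto intro: linear_sum_basis lin)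
  then have "dd (\<lambda>y. L y (V x)) x k = (\<Sum>b\<in>Basis. (V x \<bullet> b) *\<^sub>R dd (\<lambda>y. L y b) x k)" for k
    by (rule dd_eq)
  then have "(\<lambda>k. \<Sum>b\<in>Basis. (V x \<bullet> b) *\<^sub>R dd (\<lambda>y. L y b) x k + (dd V x k \<bullet> b) *\<^sub>R L x b)
    = (\<lambda>k. dd (\<lambda>y. L y (V x)) x k + L x (dd V x k))"
    by (simp add: sum.distrib linear_sum_basis[OF lin[OF assms(2)], of "dd V x _"])
  with 1 show ?thesis
    by (subst has_derivative_cong_open[OF assms(1,2), where G = "\<lambda>y. \<Sum>b\<in>Basis. (V y \<bullet> b) *\<^sub>R L y b"])
      (auto intro: linear_sum_basis lin)
qed

text \<open>The linear case is applied to one slot at a time, first with \<open>V x\<close> frozen.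
  Metrics and Christoffel symbols evaluated along a map have this form.\<close>

lemma has_derivative_bilinear_family:
  fixes B :: "'z::real_normed_vector \<Rightarrow> 'x::euclidean_space \<Rightarrow> 'x \<Rightarrow> 'y::real_normed_vector"
  assumes "open S" "open U" "x \<in> U" and FS: "\<And>y. y \<in> U \<Longrightarrow> F y \<in> S"
    and lin1: "\<And>y w. y \<in> S \<Longrightarrow> linear (\<lambda>v. B y v w)"
    and lin2: "\<And>y v. y \<in> S \<Longrightarrow> linear (\<lambda>w. B y v w)"
    and B: "\<And>v w. (\<lambda>y. B y v w) differentiable (at (F x))"
    and F: "F differentiable (at x)" and V: "V differentiable (at x)" and W: "W differentiable (at x)"
  shows "((\<lambda>y. B (F y) (V y) (W y)) has_derivative
    (\<lambda>k. dd (\<lambda>z. B z (V x) (W x)) (F x) (dd F x k) + B (F x) (dd V x k) (W x)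
      + B (F x) (V x) (dd W x k))) (at x)"
proof -
  have BF: "((\<lambda>y. B (F y) v w) has_derivative (\<lambda>k. dd (\<lambda>z. B z v w) (F x) (dd F x k))) (at x)" for v w
    by (rule has_derivative_compose[OF has_derivative_dd[OF F] has_derivative_dd[OF B]])
  have dBF: "(\<lambda>y. B (F y) v w) differentiable (at x)" for v w
    using BF unfolding differentiable_def by blast
  have 1: "((\<lambda>y. B (F y) v (W y)) has_derivative
    (\<lambda>k. dd (\<lambda>z. B z v (W x)) (F x) (dd F x k) + B (F x) v (dd W x k))) (at x)" for v
    using has_derivative_linear_family[OF assms(2,3) lin2[OF FS] dBF W, of v] dd_eq[OF BF] by simp
  have d1: "(\<lambda>y. B (F y) v (W y)) differentiable (at x)" for v
    using 1 unfolding differentiable_def by blast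
  have "((\<lambda>y. B (F y) (V y) (W y)) has_derivative
    (\<lambda>k. dd (\<lambda>y. B (F y) (V x) (W y)) x k + B (F x) (dd V x k) (W x))) (at x)"
    by (rule has_derivative_linear_family[OF assms(2,3) lin1[OF FS] d1 V])
  then show ?thesis
    unfolding dd_eq[OF 1] by (simp add: algebra_simps)
qed

text \<open>Continuity of \<open>k\<close> replaces differentiability because the term with the
  derivative of \<open>k\<close> would carry the factor M x = 0. Explicitly, k(y) M(y) - k(x) M'(y -
  x) is k(y) (M(y) - M'(y - x)) plus (k(y) - k(x)) M'(y - x), and both are o(|y - x|).\<close>

lemma differentiable_mult_vanishing:
  fixes k :: "'x::real_normed_vector \<Rightarrow> real" and M :: "'x \<Rightarrow> 'y::real_normed_vector"
  assumes "isCont k x" "(M has_derivative M') (at x)" "M x = 0"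
  shows "((\<lambda>y. k y *\<^sub>R M y) has_derivative (\<lambda>h. k x *\<^sub>R M' h)) (at x)"
proof -
  have lim: "((\<lambda>y. (1 / norm (y - x)) *\<^sub>R (M y - M' (y - x))) \<longlongrightarrow> 0) (at x)"
    using assms(2,3) by - (rule tendsto_norm_zero_cancel, simp add: has_derivative_iff_norm)
  have bl: "bounded_linear M'" using assms(2) by (rule has_derivative_bounded_linear)
  obtain C where C: "\<And>h. norm (M' h) \<le> norm h * C" using bounded_linear.bounded[OF bl] by blast
  have z: "((\<lambda>y. k y - k x) \<longlongrightarrow> 0) (at x)"
    using assms(1) by (simp add: isCont_def LIM_zero)
  have t2: "((\<lambda>y. (k y - k x) *\<^sub>R ((1 / norm (y - x)) *\<^sub>R M' (y - x))) \<longlongrightarrow> 0) (at x)"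
  proof (rule Lim_null_comparison)
    show "\<forall>\<^sub>F y in at x. norm ((k y - k x) *\<^sub>R ((1 / norm (y - x)) *\<^sub>R M' (y - x))) \<le> \<bar>k y - k x\<bar> * \<bar>C\<bar>"
      unfolding eventually_at_topological
    proof (intro exI[of _ UNIV] conjI ballI impI)
      fix y assume "y \<noteq> x"
      then have "norm (M' (y - x)) / norm (y - x) \<le> \<bar>C\<bar>"
        using C[of "y - x"] by (simp add: field_simps)
          (smt (verit) mult_right_mono norm_ge_zero mult.commute abs_ge_self)
      then show "norm ((k y - k x) *\<^sub>R ((1 / norm (y - x)) *\<^sub>R M' (y - x))) \<le> \<bar>k y - k x\<bar> * \<bar>C\<bar>"
        using mult_left_mono[of "norm (M' (y - x)) / norm (y - x)" "\<bar>C\<bar>" "\<bar>k y - k x\<bar>"] by simp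
    qed auto
    show "((\<lambda>y. \<bar>k y - k x\<bar> * \<bar>C\<bar>) \<longlongrightarrow> 0) (at x)"
      using tendsto_mult_right[OF tendsto_rabs[OF z], of "\<bar>C\<bar>"] by simp
  qed
  have t1: "((\<lambda>y. k y *\<^sub>R ((1 / norm (y - x)) *\<^sub>R (M y - M' (y - x)))) \<longlongrightarrow> 0) (at x)"
    using tendsto_scaleR[OF assms(1)[unfolded isCont_def] lim] by simp
  have "((\<lambda>y. (1 / norm (y - x)) *\<^sub>R (k y *\<^sub>R M y - k x *\<^sub>R M x - k x *\<^sub>R M' (y - x))) \<longlongrightarrow> 0) (at x)"
    using tendsto_add[OF t1 t2] by (simp add: assms(3) algebra_simps diff_divide_distrib)
  then have "((\<lambda>y. norm (k y *\<^sub>R M y - k x *\<^sub>R M x - k x *\<^sub>R M' (y - x)) / norm (y - x)) \<longlongrightarrow> 0) (at x)"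
    by (drule_tac tendsto_norm_zero) (simp add: divide_inverse mult.commute)
  then show ?thesis
    using bounded_linear_const_scaleR[OF bl, of "k x"] by (simp add: has_derivative_iff_norm)
qed

text \<open>With \<open>P y = M \<circ> L y\<close>, \<open>M\<close> the inverse of \<open>L x\<close>, the equation becomes
  \<open>W y = M (b y) - (P y - id) (W y)\<close>; the last term is a product of a function that is continuous at
  \<open>x\<close> and one that vanishes there.\<close>

lemma differentiable_solution:
  fixes L :: "'z::euclidean_space \<Rightarrow> 'x::euclidean_space \<Rightarrow> 'x"
  assumes "open S" "x \<in> S" and lin: "\<And>y. y \<in> S \<Longrightarrow> linear (L y)"
    and inj: "inj (L x)"
    and L: "\<And>w. (\<lambda>y. L y w) differentiable (at x)" and b: "b differentiable (at x)"
    and W: "\<And>y. y \<in> S \<Longrightarrow> L y (W y) = b y"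
  shows "W differentiable (at x)"
proof -
  obtain M where M: "linear M" "M \<circ> L x = id"
    using linear_injective_left_inverse[OF lin[OF assms(2)] inj] by blast
  have blM: "bounded_linear M" using M(1) linear_conv_bounded_linear by blast
  define m where "m i y = M (L y i) - i" for i y
  have mx: "m i x = 0" for i using M(2) by (simp add: m_def fun_eq_iff)
  have dm: "m i differentiable (at x)" for i
    using bounded_linear.has_derivative[OF blM has_derivative_dd[OF L[of i]]]
    unfolding m_def differentiable_def by (auto intro!: exI has_derivative_diff derivative_intros)
  have cm: "isCont (m i) x" for i using dm by (rule differentiable_imp_continuous_within)
  have dMb: "(\<lambda>y. M (b y)) differentiable (at x)"
    using bounded_linear.has_derivative[OF blM has_derivative_dd[OF b]] by (auto simp: differentiable_def)
  then have cMb: "isCont (\<lambda>y. M (b y)) x" by (rule differentiable_imp_continuous_within)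
  have eq: "W y = M (b y) - (\<Sum>i\<in>Basis. (W y \<bullet> i) *\<^sub>R m i y)" if "y \<in> S" for y
  proof -
    have "M (b y) = M (L y (W y))" using W[OF that] by simp
    also have "\<dots> = (\<Sum>i\<in>Basis. (W y \<bullet> i) *\<^sub>R M (L y i))"
      using linear_sum_basis[OF linear_compose[OF lin[OF that] M(1)], of "W y"] by simp
    finally have "M (b y) - (\<Sum>i\<in>Basis. (W y \<bullet> i) *\<^sub>R m i y) = (\<Sum>i\<in>Basis. (W y \<bullet> i) *\<^sub>R i)"
      by (simp add: m_def scaleR_diff_right sum_subtractf)
    then show ?thesis by (simp add: euclidean_representation)
  qed
  define \<eta> where "\<eta> y = (\<Sum>i\<in>Basis. norm (m i y))" for y
  have c\<eta>: "(\<eta> \<longlongrightarrow> 0) (at x)"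
    using tendsto_sum[of Basis "\<lambda>i y. norm (m i y)" "\<lambda>i. 0" "at x"] cm mx
    unfolding \<eta>_def isCont_def by (auto intro: tendsto_norm_zero)
  have inS: "\<forall>\<^sub>F y in at x. y \<in> S"
    using assms(1,2) by (rule eventually_at_in_open')
  have sb: "norm (\<Sum>i\<in>Basis. (W y \<bullet> i) *\<^sub>R m i y) \<le> \<eta> y * norm (W y)" for y
  proof -
    have "norm (\<Sum>i\<in>Basis. (W y \<bullet> i) *\<^sub>R m i y) \<le> (\<Sum>i\<in>Basis. norm (W y) * norm (m i y))"
      by (rule sum_norm_le) (auto intro: mult_right_mono Basis_le_norm)
    then show ?thesis by (simp add: \<eta>_def sum_distrib_left mult.commute)
  qed
  \<comment> \<open>Nothing is known about \<open>W\<close> near \<open>x\<close> at first. Once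
    \<eta> is below 1 / 2 the term containing \<open>W\<close> is absorbed, so \<open>W\<close> is
    bounded; boundedness makes that term tend to 0, so \<open>W\<close> is continuous at
    \<open>x\<close>; and continuity is what \<open>differentiable_mult_vanishing\<close>
    needs.\<close>
  have "\<forall>\<^sub>F y in at x. \<eta> y < 1/2"
    using order_tendstoD(2)[OF c\<eta>, of "1/2"] by simp
  then have bd: "\<forall>\<^sub>F y in at x. norm (W y) \<le> 2 * norm (M (b y))"
    using inS
  proof eventually_elim
    case (elim y)
    have "norm (W y) \<le> norm (M (b y)) + \<eta> y * norm (W y)"
      using sb[of y] norm_triangle_ineq4[of "M (b y)" "\<Sum>i\<in>Basis. (W y \<bullet> i) *\<^sub>R m i y"] eq[OF elim(2)]
      by (metis add_left_mono order_trans)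
    also have "\<dots> \<le> norm (M (b y)) + (1/2) * norm (W y)"
      using elim by (intro add_left_mono mult_right_mono) auto
    finally show ?case by simp
  qed
  have "((\<lambda>y. \<Sum>i\<in>Basis. (W y \<bullet> i) *\<^sub>R m i y) \<longlongrightarrow> 0) (at x)"
  proof (rule Lim_null_comparison)
    show "\<forall>\<^sub>F y in at x. norm (\<Sum>i\<in>Basis. (W y \<bullet> i) *\<^sub>R m i y) \<le> \<eta> y * (2 * norm (M (b y)))"
      using bd
    proof eventually_elim
      case (elim y)
      have "\<eta> y \<ge> 0" by (simp add: \<eta>_def sum_nonneg)
      then show ?case using sb[of y] elim by (meson mult_left_mono order_trans)
    qed
    show "((\<lambda>y. \<eta> y * (2 * norm (M (b y)))) \<longlongrightarrow> 0) (at x)"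
      using tendsto_mult[OF c\<eta> tendsto_mult[OF tendsto_const tendsto_norm[OF cMb[unfolded isCont_def]]], of 2]
      by simp
  qed
  then have "((\<lambda>y. M (b y) - (\<Sum>i\<in>Basis. (W y \<bullet> i) *\<^sub>R m i y)) \<longlongrightarrow> M (b x) - 0) (at x)"
    by (intro tendsto_diff cMb[unfolded isCont_def])
  moreover have "M (b x) = W x"
    using eq[OF assms(2)] mx by simp
  moreover have "\<forall>\<^sub>F y in at x. M (b y) - (\<Sum>i\<in>Basis. (W y \<bullet> i) *\<^sub>R m i y) = W y"
    using inS by (rule eventually_mono) (rule eq[symmetric])
  ultimately have "isCont W x"
    unfolding isCont_def using Lim_transform_eventually by fastforce
  then have ci: "isCont (\<lambda>y. W y \<bullet> i) x" for i by (intro continuous_intros)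
  have "((\<lambda>y. \<Sum>i\<in>Basis. (W y \<bullet> i) *\<^sub>R m i y) has_derivative
      (\<lambda>h. \<Sum>i\<in>Basis. (W x \<bullet> i) *\<^sub>R dd (m i) x h)) (at x)"
    by (intro has_derivative_sum differentiable_mult_vanishing ci has_derivative_dd dm mx)
  from has_derivative_diff[OF has_derivative_dd[OF dMb] this]
  show ?thesis
    by (subst differentiable_cong_open[OF assms(1,2) eq]) (auto simp: differentiable_def)
qed

section \<open>Levi-Civita connection, curvature and the Gauss equation in a chart\<close>

lemma linear_dd_family:
  fixes L :: "'z::real_normed_vector \<Rightarrow> 'x::real_vector \<Rightarrow> 'y::real_normed_vector"
  assumes "open S" "x \<in> S" and lin: "\<And>y. y \<in> S \<Longrightarrow> linear (L y)"
    and L: "\<And>w. (\<lambda>y. L y w) differentiable (at x)"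
  shows "linear (\<lambda>w. dd (\<lambda>y. L y w) x k)"
proof (rule linearI)
  show "dd (\<lambda>y. L y (a + b)) x k = dd (\<lambda>y. L y a) x k + dd (\<lambda>y. L y b) x k" for a b
    using dd_cong_open[OF assms(1,2), of "\<lambda>y. L y (a + b)" "\<lambda>y. L y a + L y b"] dd_add[OF L L]
    by (simp add: linear_add[OF lin])
  show "dd (\<lambda>y. L y (r *\<^sub>R a)) x k = r *\<^sub>R dd (\<lambda>y. L y a) x k" for r a
    using dd_cong_open[OF assms(1,2), of "\<lambda>y. L y (r *\<^sub>R a)" "\<lambda>y. r *\<^sub>R L y a"] dd_scaleR[OF L]
    by (simp add: linear_scale[OF lin])
qed

locale local_riemannian =
  fixes S :: "'e::euclidean_space set" and G :: "'e \<Rightarrow> 'e \<Rightarrow> 'e \<Rightarrow> real"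
  assumes open_S: "open S"
    and sym: "x \<in> S \<Longrightarrow> G x u v = G x v u"
    and linear_left: "x \<in> S \<Longrightarrow> linear (\<lambda>u. G x u v)"
    and pos: "x \<in> S \<Longrightarrow> u \<noteq> 0 \<Longrightarrow> G x u u > 0"
    and smooth: "smooth_on S (\<lambda>x. G x u v)"
begin

abbreviation "\<Gamma> \<equiv> christoffel G"
abbreviation "R \<equiv> local_curvature G"

definition koszul :: "'e \<Rightarrow> 'e \<Rightarrow> 'e \<Rightarrow> 'e \<Rightarrow> real"
  where "koszul x u v z = dd (\<lambda>y. G y v z) x u + dd (\<lambda>y. G y u z) x v - dd (\<lambda>y. G y u v) x z"

lemma linear_right: "x \<in> S \<Longrightarrow> linear (G x u)"
  using linear_left[of x u] sym[of x u] by presburger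

lemma differentiable: "x \<in> S \<Longrightarrow> (\<lambda>y. G y u v) differentiable (at x)"
  by (rule smooth_on_differentiable[OF smooth])

lemma nondegenerate:
  assumes "x \<in> S" "\<And>z. G x u z = G x v z" shows "u = v"
proof (rule ccontr)
  assume "u \<noteq> v"
  then have "G x (u - v) (u - v) > 0" using pos[OF assms(1), of "u - v"] by simp
  then show False
    using assms(2)[of "u - v"] by (simp add: linear_diff[OF linear_left[OF assms(1)]])
qed

lemma linear_koszul: "x \<in> S \<Longrightarrow> linear (koszul x u v)"
  unfolding koszul_def
  by (intro linear_compose_add linear_compose_sub linear_dd_family[OF open_S] linear_right
      differentiable dd_linear) auto

lemma linear_koszul_left:
  assumes "x \<in> S" shows "linear (\<lambda>u. koszul x u v z)"
  unfolding koszul_def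
  using assms by (intro linear_compose_add linear_compose_sub linear_dd_family[OF open_S] linear_left
      differentiable dd_linear) auto

lemma koszul_sym: "x \<in> S \<Longrightarrow> koszul x u v z = koszul x v u z"
  using dd_cong_open[OF open_S, of x "\<lambda>y. G y u v" "\<lambda>y. G y v u"] sym
  by (simp add: koszul_def)

text \<open>The Gram matrix of \<open>G x\<close> as an endomorphism of the model space:
  \<open>flat x w\<close> represents the functional \<open>G x w\<close> by the Euclidean inner
  product. It turns the implicit definition of \<open>christoffel\<close> into a linear
  equation.\<close>

definition flat :: "'e \<Rightarrow> 'e \<Rightarrow> 'e"
  where "flat x w = (\<Sum>b\<in>Basis. G x w b *\<^sub>R b)"

lemma linear_flat: "x \<in> S \<Longrightarrow> linear (flat x)"
  by (rule linearI) (simp_all add: flat_def linear_add[OF linear_left] linear_scale[OF linear_left]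
      scaleR_add_left sum.distrib scaleR_sum_right)

lemma flat_inner:
  assumes "x \<in> S" shows "flat x w \<bullet> z = G x w z"
proof -
  have "G x w z = (\<Sum>b\<in>Basis. (z \<bullet> b) *\<^sub>R G x w b)"
    by (rule linear_sum_basis[OF linear_right[OF assms]])
  then show ?thesis by (simp add: flat_def inner_sum_left inner_commute[of z] mult.commute)
qed

lemma inj_flat: "x \<in> S \<Longrightarrow> inj (flat x)"
  by (rule injI) (metis flat_inner nondegenerate)

text \<open>Makes the definite description meaningful: surjectivity of \<open>flat\<close> solves
  the equation and nondegeneracy makes the solution unique.\<close>

lemma christoffel_koszul:
  assumes "x \<in> S" shows "2 * G x (\<Gamma> x u v) z = koszul x u v z"
proof -
  have "\<exists>w. \<forall>z. 2 * G x w z = koszul x u v z"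
  proof -
    have "surj (flat x)"
      using linear_injective_imp_surjective[OF linear_flat inj_flat] assms by blast
    then obtain w where w: "flat x w = (\<Sum>b\<in>Basis. (koszul x u v b / 2) *\<^sub>R b)"
      by (metis surjD)
    have "2 * G x w z = koszul x u v z" for z
      using linear_sum_basis[OF linear_koszul[OF assms], of u v z] flat_inner[OF assms, of w z] w
      by (simp add: inner_sum_left inner_commute[of z] mult.commute flip: sum_divide_distrib)
    then show ?thesis by blast
  qed
  then have "\<exists>!w. \<forall>z. 2 * G x w z = koszul x u v z"
    using nondegenerate[OF assms]
    by (metis mult_cancel_left zero_neq_numeral)
  from theI'[OF this] show ?thesis
    unfolding christoffel_def koszul_def by simp
qed

lemma christoffel_eqI:
  assumes "x \<in> S" "\<And>z. 2 * G x w z = koszul x u v z" shows "\<Gamma> x u v = w"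
  using christoffel_koszul[OF assms(1)] assms(2) nondegenerate[OF assms(1)]
  by (metis mult_cancel_left zero_neq_numeral)

lemma christoffel_sym: "x \<in> S \<Longrightarrow> \<Gamma> x u v = \<Gamma> x v u"
  by (rule christoffel_eqI) (auto simp: christoffel_koszul koszul_sym)

lemma linear_christoffel_left:
  assumes "x \<in> S" shows "linear (\<lambda>u. \<Gamma> x u v)"
  using assms
  by (intro linearI christoffel_eqI)
    (simp_all add: linear_add[OF linear_left] linear_scale[OF linear_left] distrib_left
      christoffel_koszul linear_add[OF linear_koszul_left] linear_scale[OF linear_koszul_left])

lemma linear_christoffel_right: "x \<in> S \<Longrightarrow> linear (\<Gamma> x u)"
  using linear_christoffel_left[of x u] christoffel_sym[of x u] by presburger

text \<open>The symbols solve \<open>flat y W = b y\<close> with differentiable coefficients and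
  right side, so \<open>differentiable_solution\<close> applies without inverting the Gram matrix as
  a function of \<open>y\<close>.\<close>

lemma christoffel_differentiable:
  assumes "x \<in> S" shows "(\<lambda>y. \<Gamma> y u v) differentiable (at x)"
proof (rule differentiable_solution[where L = flat, OF open_S assms])
  show "linear (flat y)" if "y \<in> S" for y by (rule linear_flat[OF that])
  show "inj (flat x)" by (rule inj_flat[OF assms])
  show "(\<lambda>y. flat y w) differentiable (at x)" for w
    unfolding flat_def using differentiable[OF assms]
    by (intro differentiable_sum differentiable_scaleR) auto
  show "(\<lambda>y. \<Sum>b\<in>Basis. (koszul y u v b / 2) *\<^sub>R b) differentiable (at x)"
    unfolding koszul_def using smooth_on_differentiable[OF smooth_on_dd[OF smooth] assms]
    by (intro differentiable_sum differentiable_scaleR differentiable_divide differentiable_diff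
        differentiable_add) auto
  show "flat y (\<Gamma> y u v) = (\<Sum>b\<in>Basis. (koszul y u v b / 2) *\<^sub>R b)" if "y \<in> S" for y
    unfolding flat_def by (simp add: christoffel_koszul[OF that, symmetric])
qed

text \<open>Adding the Koszul formulas for (u, v, w) and (u, w, v), the derivatives in directions
  \<open>v\<close> and \<open>w\<close> cancel.\<close>

lemma metric_compatible:
  assumes "x \<in> S"
  shows "dd (\<lambda>y. G y v w) x u = G x (\<Gamma> x u v) w + G x v (\<Gamma> x u w)"
proof -
  have "dd (\<lambda>y. G y v w) x u = dd (\<lambda>y. G y w v) x u"
    using dd_cong_open[OF open_S assms, of "\<lambda>y. G y v w" "\<lambda>y. G y w v"] sym by simp
  moreover have "G x v (\<Gamma> x u w) = G x (\<Gamma> x u w) v" by (rule sym[OF assms])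
  ultimately show ?thesis
    using christoffel_koszul[OF assms, of u v w] christoffel_koszul[OF assms, of u w v]
    by (simp add: koszul_def)
qed

section \<open>Covariant derivatives along maps and the curvature tensor\<close>

lemma metric_along:
  assumes "open U" "x \<in> U" "\<And>y. y \<in> U \<Longrightarrow> F y \<in> S" "F differentiable (at x)"
    "V differentiable (at x)" "W differentiable (at x)"
  shows "((\<lambda>y. G (F y) (V y) (W y)) has_derivative (\<lambda>u. G (F x) (cov_along G F V x u) (W x)
    + G (F x) (V x) (cov_along G F W x u))) (at x)"
proof -
  have Fx: "F x \<in> S" using assms(2,3) by blast
  show ?thesis
    by (rule has_derivative_eq_rhs[OF has_derivative_bilinear_family[OF open_S assms(1-3) linear_left
            linear_right differentiable[OF Fx] assms(4-6)]])
      (simp_all add: cov_along_def metric_compatible[OF Fx] linear_add[OF linear_left[OF Fx]]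
        linear_add[OF linear_right[OF Fx]] algebra_simps fun_eq_iff)
qed

lemma cov_along_has_derivative:
  assumes "open U" "x \<in> U" "\<And>y. y \<in> U \<Longrightarrow> F y \<in> S" "smooth_on U F" "smooth_on U V"
  shows "((\<lambda>y. cov_along G F V y v) has_derivative (\<lambda>k. dd (\<lambda>y. dd V y v) x k
    + (dd (\<lambda>z. \<Gamma> z (dd F x v) (V x)) (F x) (dd F x k)
      + \<Gamma> (F x) (dd (\<lambda>y. dd F y v) x k) (V x) + \<Gamma> (F x) (dd F x v) (dd V x k)))) (at x)"
  unfolding cov_along_def
  by (rule has_derivative_add[OF has_derivative_dd[OF smooth_on_differentiable[OF smooth_on_dd[OF assms(5)] assms(2)]]
        has_derivative_bilinear_family[OF open_S assms(1-3) linear_christoffel_left linear_christoffel_right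
          christoffel_differentiable[OF assms(3)[OF assms(2)]] smooth_on_differentiable[OF assms(4,2)]
          smooth_on_differentiable[OF smooth_on_dd[OF assms(4)] assms(2)]
          smooth_on_differentiable[OF assms(5,2)]]])

lemma cov_along_differentiable:
  assumes "open U" "x \<in> U" "\<And>y. y \<in> U \<Longrightarrow> F y \<in> S" "smooth_on U F" "smooth_on U V"
  shows "(\<lambda>y. cov_along G F V y v) differentiable (at x)"
  using cov_along_has_derivative[OF assms] by (auto simp: differentiable_def)

lemma cov_deriv_const: "cov_deriv G (\<lambda>_. w) = (\<lambda>x u. \<Gamma> x u w)"
  by (simp add: cov_along_def fun_eq_iff)

lemma curvature_eq: "R x u v w = dd (\<lambda>y. \<Gamma> y v w) x u - dd (\<lambda>y. \<Gamma> y u w) x v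
    + \<Gamma> x u (\<Gamma> x v w) - \<Gamma> x v (\<Gamma> x u w)"
  by (simp add: local_curvature_def cov_deriv_const) (simp add: cov_along_def)

text \<open>In the commutator the second derivatives of \<open>V\<close> and \<open>F\<close> cancel
  by symmetry, and what remains is the coordinate expression of the curvature at \<open>F x\<close>.
  With \<open>F\<close> the identity this lets the curvature act on a nonconstant field; with
  \<open>F\<close> an immersion it produces the ambient curvature in the Gauss equation.\<close>

lemma curvature_along:
  assumes "open U" "x \<in> U" "\<And>y. y \<in> U \<Longrightarrow> F y \<in> S" "smooth_on U F" "smooth_on U V"
  shows "cov_along G F (\<lambda>y. cov_along G F V y v) x u - cov_along G F (\<lambda>y. cov_along G F V y u) x v
    = R (F x) (dd F x u) (dd F x v) (V x)"
proof -
  have Fx: "F x \<in> S" using assms(2,3) by blast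
  have "dd (\<lambda>y. cov_along G F V y a) x b = dd (\<lambda>y. dd V y a) x b
    + (dd (\<lambda>z. \<Gamma> z (dd F x a) (V x)) (F x) (dd F x b)
      + \<Gamma> (F x) (dd (\<lambda>y. dd F y a) x b) (V x) + \<Gamma> (F x) (dd F x a) (dd V x b))" for a b
    by (rule dd_eq[OF cov_along_has_derivative[OF assms]])
  then have D: "cov_along G F (\<lambda>y. cov_along G F V y a) x b = dd (\<lambda>y. dd V y a) x b
    + (dd (\<lambda>z. \<Gamma> z (dd F x a) (V x)) (F x) (dd F x b)
      + \<Gamma> (F x) (dd (\<lambda>y. dd F y a) x b) (V x) + \<Gamma> (F x) (dd F x a) (dd V x b))
    + (\<Gamma> (F x) (dd F x b) (dd V x a) + \<Gamma> (F x) (dd F x b) (\<Gamma> (F x) (dd F x a) (V x)))" for a b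
    unfolding cov_along_def[of G F "\<lambda>y. cov_along G F V y a"]
    by (simp only:) (simp add: cov_along_def linear_add[OF linear_christoffel_right[OF Fx]])
  show ?thesis
    unfolding D curvature_eq
      mixed_partials[OF assms(1,2,5), of u v] mixed_partials[OF assms(1,2,4), of u v]
    by (simp add: algebra_simps)
qed

lemma curvature_antisym: "R x u v w = - R x v u w"
  by (simp add: curvature_eq)

lemma bianchi:
  assumes "x \<in> S" shows "R x u v w + R x v w u + R x w u v = 0"
proof -
  have "dd (\<lambda>y. \<Gamma> y a b) x = dd (\<lambda>y. \<Gamma> y b a) x" for a b
    by (rule dd_cong_open[OF open_S assms]) (rule christoffel_sym)
  then show ?thesis
    unfolding curvature_eq christoffel_sym[OF assms, of v w] christoffel_sym[OF assms, of w u]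
      christoffel_sym[OF assms, of u v]
    by (simp add: algebra_simps)
qed

lemma linear_curvature:
  assumes "x \<in> S"
  shows "linear (\<lambda>u. R x u v w)" "linear (\<lambda>v. R x u v w)" "linear (\<lambda>w. R x u v w)"
proof -
  note L = linear_christoffel_left[OF assms] linear_christoffel_right[OF assms]
  note D = christoffel_differentiable[OF assms]
  have 1: "linear (\<lambda>u. \<Gamma> x u (\<Gamma> x v w))" "linear (\<lambda>u. \<Gamma> x v (\<Gamma> x u w))" for v w
    using L linear_compose[OF L(1) L(2), unfolded o_def] by auto
  have 2: "linear (\<lambda>w. \<Gamma> x u (\<Gamma> x v w))" for u v
    using linear_compose[OF L(2) L(2), unfolded o_def] by auto
  show 3: "linear (\<lambda>u. R x u v w)" for v w
    unfolding curvature_eq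
    by (intro linear_compose_add linear_compose_sub 1 dd_linear[OF D]
        linear_dd_family[OF open_S assms] D linear_christoffel_left)
  show "linear (\<lambda>v. R x u v w)"
    unfolding curvature_antisym[of x u] by (rule linear_compose_neg[OF 3])
  show "linear (\<lambda>w. R x u v w)"
    unfolding curvature_eq
    by (intro linear_compose_add linear_compose_sub 2
        linear_dd_family[OF open_S assms] D linear_christoffel_right)
qed

text \<open>Metric compatibility trades derivatives of the Christoffel symbols for derivatives of
  the scalar functions \<open>G y (\<Gamma> y v w) z\<close>. These are easier to identify: for z =
  w they are half first derivatives of the metric, and on a submanifold they have an ambient
  expression.\<close>

lemma curvature_lower:
  assumes "x \<in> S"
  shows "G x (R x u v w) z =
      (dd (\<lambda>y. G y (\<Gamma> y v w) z) x u - G x (\<Gamma> x v w) (\<Gamma> x u z))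
    - (dd (\<lambda>y. G y (\<Gamma> y u w) z) x v - G x (\<Gamma> x u w) (\<Gamma> x v z))"
proof -
  have "dd (\<lambda>y. G y (\<Gamma> y a w) z) x b =
    G x (cov_deriv G (\<lambda>y. \<Gamma> y a w) x b) z + G x (\<Gamma> x a w) (cov_deriv G (\<lambda>_. z) x b)" for a b
    by (rule dd_eq[OF metric_along[OF open_S assms]]) (auto intro: christoffel_differentiable assms)
  then show ?thesis
    by (simp add: local_curvature_def cov_deriv_const linear_diff[OF linear_left[OF assms]])
qed

text \<open>\<open>G y (\<Gamma> y a w) w\<close> is half the derivative of \<open>G y w w\<close>
  in direction \<open>a\<close>, so the two derivative terms of \<open>curvature_lower\<close> are
  the two mixed partials of one function.\<close>

lemma curvature_skew:
  assumes "x \<in> S" shows "G x (R x u v w) w = 0"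
proof -
  have 1: "G y (\<Gamma> y a w) w = dd (\<lambda>z. G z w w) y a / 2" if "y \<in> S" for y a
    using metric_compatible[OF that, of w w a] sym[OF that, of "\<Gamma> y a w" w] by simp
  have "dd (\<lambda>y. G y (\<Gamma> y a w) w) x b = dd (\<lambda>y. dd (\<lambda>z. G z w w) y a / 2) x b" for a b
    using dd_cong_open[OF open_S assms 1] by simp
  also have "dd (\<lambda>y. dd (\<lambda>z. G z w w) y a / 2) x b = dd (\<lambda>y. dd (\<lambda>z. G z w w) y a) x b / 2" for a b
    using dd_scaleR[OF smooth_on_differentiable[OF smooth_on_dd[OF smooth] assms], of "1/2"] by simp
  finally have D: "dd (\<lambda>y. G y (\<Gamma> y a w) w) x b = dd (\<lambda>y. dd (\<lambda>z. G z w w) y a) x b / 2" for a b .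
  then show ?thesis
    using mixed_partials[OF open_S assms smooth, of w w u v] sym[OF assms, of "\<Gamma> x u w" "\<Gamma> x v w"]
    unfolding curvature_lower[OF assms] D by simp
qed

lemma smooth_on_id: "smooth_on S (\<lambda>y::'e. y)"
proof -
  have c: "Ck_on k S (\<lambda>y::'e. c)" for k and c :: 'e by (induction k arbitrary: c) auto
  have "Ck_on k S (\<lambda>y::'e. y)" for k by (cases k) (auto simp: c)
  then show ?thesis by (simp add: smooth_on_def)
qed

text \<open>By parallelism and the product rule \<open>j\<close> commutes with covariant
  differentiation of the nonconstant fields \<open>\<Gamma> y a w\<close> as well, so it passes
  through both derivatives in the commutator. \<open>curvature_along\<close> with the identity map
  identifies the commutator on \<open>j y w\<close> as curvature.\<close>

lemma curvature_parallel_endo: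
  assumes "x \<in> S" and lin: "\<And>y. y \<in> S \<Longrightarrow> linear (j y)" and j: "\<And>v. smooth_on S (\<lambda>y. j y v)"
    and par: "\<And>y u v. y \<in> S \<Longrightarrow>
      cov_deriv G (\<lambda>y. j y v) y u = j y (cov_deriv G (\<lambda>_. v) y u)"
  shows "R x u v (j x w) = j x (R x u v w)"
proof -
  have jd: "(\<lambda>y. j y a) differentiable (at y)" if "y \<in> S" for y a
    by (rule smooth_on_differentiable[OF j that])
  have *: "cov_deriv G (\<lambda>y. cov_deriv G (\<lambda>y. j y w) y a) x b = j x (cov_deriv G (\<lambda>y. \<Gamma> y a w) x b)"
    for a b
  proof -
    have "dd (\<lambda>y. cov_deriv G (\<lambda>y. j y w) y a) x = dd (\<lambda>y. j y (\<Gamma> y a w)) x"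
      by (rule dd_cong_open[OF open_S assms(1)]) (simp only: par cov_deriv_const)
    moreover have "dd (\<lambda>y. j y (\<Gamma> y a w)) x b
      = dd (\<lambda>y. j y (\<Gamma> x a w)) x b + j x (dd (\<lambda>y. \<Gamma> y a w) x b)"
      by (intro dd_eq has_derivative_linear_family[OF open_S assms(1)] lin jd assms(1)
          christoffel_differentiable)
    moreover have "cov_deriv G (\<lambda>y. j y w) x a = j x (\<Gamma> x a w)"
      by (simp only: par[OF assms(1)] cov_deriv_const)
    moreover have "dd (\<lambda>y. j y (\<Gamma> x a w)) x b + \<Gamma> x b (j x (\<Gamma> x a w)) = j x (\<Gamma> x b (\<Gamma> x a w))"
      using par[OF assms(1), of "\<Gamma> x a w" b] unfolding cov_deriv_const by (simp add: cov_along_def)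
    ultimately show ?thesis
      unfolding cov_along_def[of G "\<lambda>y. y" "\<lambda>y. cov_deriv G (\<lambda>y. j y w) y a"]
        cov_along_def[of G "\<lambda>y. y" "\<lambda>y. \<Gamma> y a w"]
      by (simp add: linear_add[OF lin[OF assms(1)]])
  qed
  have "R x u v (j x w) = cov_deriv G (\<lambda>y. cov_deriv G (\<lambda>y. j y w) y v) x u
      - cov_deriv G (\<lambda>y. cov_deriv G (\<lambda>y. j y w) y u) x v"
    using curvature_along[OF open_S assms(1) _ smooth_on_id j, of w v u] by simp
  also have "\<dots> = j x (R x u v w)"
    unfolding * by (simp add: local_curvature_def cov_deriv_const linear_diff[OF lin[OF assms(1)]])
  finally show ?thesis .
qed

end

text \<open>\<open>U\<close> is kept apart from \<open>S\<close> because the image of a whole chart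
  of the submanifold need not lie in one chart of the ambient manifold.\<close>

locale isometric_immersion = M: local_riemannian S G + N: local_riemannian S' G'
  for S :: "'e::euclidean_space set" and G and S' :: "'f::euclidean_space set" and G' +
  fixes U :: "'e set" and F :: "'e \<Rightarrow> 'f"
  assumes open_U: "open U" and U_S: "U \<subseteq> S" and F_S': "x \<in> U \<Longrightarrow> F x \<in> S'"
    and smooth_F: "smooth_on U F"
    and isometric: "x \<in> U \<Longrightarrow> G x u v = G' (F x) (dd F x u) (dd F x v)"
begin

definition sff :: "'e \<Rightarrow> 'e \<Rightarrow> 'e \<Rightarrow> 'f"
  where "sff x u v = cov_along G' F (\<lambda>y. dd F y v) x u - dd F x (M.\<Gamma> x u v)"

lemma F_differentiable: "x \<in> U \<Longrightarrow> F differentiable (at x)"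
  by (rule smooth_on_differentiable[OF smooth_F])

lemma linear_dd_F: "x \<in> U \<Longrightarrow> linear (dd F x)"
  by (rule dd_linear[OF F_differentiable])

lemma dd_F_differentiable: "x \<in> U \<Longrightarrow> (\<lambda>y. dd F y v) differentiable (at x)"
  by (rule smooth_on_differentiable[OF smooth_on_dd[OF smooth_F]])

lemma cov_along_dd_sym:
  assumes "x \<in> U"
  shows "cov_along G' F (\<lambda>y. dd F y v) x u = cov_along G' F (\<lambda>y. dd F y u) x v"
  using mixed_partials[OF open_U assms smooth_F, of v u] N.christoffel_sym[OF F_S'[OF assms]]
  by (simp add: cov_along_def)

lemma sff_sym: "x \<in> U \<Longrightarrow> sff x u v = sff x v u"
  using cov_along_dd_sym[of x v u] M.christoffel_sym[of x u v] U_S by (auto simp: sff_def)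

lemma linear_sff:
  assumes "x \<in> U" shows "linear (\<lambda>u. sff x u v)"
proof -
  have xS: "x \<in> S" using assms U_S by blast
  show ?thesis
    unfolding sff_def cov_along_def
    using linear_compose[OF linear_dd_F[OF assms] N.linear_christoffel_left[OF F_S'[OF assms]]]
      linear_compose[OF M.linear_christoffel_left[OF xS] linear_dd_F[OF assms]]
    by (intro linear_compose_sub linear_compose_add dd_linear[OF dd_F_differentiable[OF assms]])
      (simp_all add: o_def)
qed

lemma isometric_derivative:
  assumes "x \<in> U"
  shows "dd (\<lambda>y. G y v w) x u = G' (F x) (cov_along G' F (\<lambda>y. dd F y v) x u) (dd F x w)
    + G' (F x) (dd F x v) (cov_along G' F (\<lambda>y. dd F y w) x u)"
proof -
  have "dd (\<lambda>y. G y v w) x = dd (\<lambda>y. G' (F y) (dd F y v) (dd F y w)) x"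
    by (rule dd_cong_open[OF open_U assms isometric])
  then show ?thesis
    using dd_eq[OF N.metric_along[OF open_U assms F_S' F_differentiable[OF assms]
          dd_F_differentiable[OF assms] dd_F_differentiable[OF assms]]] by simp
qed

text \<open>The trilinear form on the left is symmetric in \<open>u\<close>, \<open>v\<close> and satisfies the product rule, which
  determines it by Koszul's argument.\<close>

lemma tangential_part:
  assumes "x \<in> U"
  shows "G' (F x) (cov_along G' F (\<lambda>y. dd F y v) x u) (dd F x z) = G x (M.\<Gamma> x u v) z"
proof -
  have xS: "x \<in> S" using assms U_S by blast
  let ?c = "\<lambda>u v z. G' (F x) (cov_along G' F (\<lambda>y. dd F y v) x u) (dd F x z)"
  have d: "dd (\<lambda>y. G y v w) x u = ?c u v w + ?c u w v" for u v w
    using isometric_derivative[OF assms] N.sym[OF F_S'[OF assms]] by simp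
  have s: "?c u v z = ?c v u z" for u v z using cov_along_dd_sym[OF assms, of u v] by simp
  have "2 * G x (M.\<Gamma> x u v) z = 2 * ?c u v z"
    unfolding M.christoffel_koszul[OF xS] M.koszul_def d using s[of u z v] s[of v z u] s[of u v z]
    by simp
  then show ?thesis by simp
qed

lemma sff_normal:
  assumes "x \<in> U" shows "G' (F x) (sff x u v) (dd F x z) = 0"
  unfolding sff_def linear_diff[OF N.linear_left[OF F_S'[OF assms]]]
  using isometric[OF assms] tangential_part[OF assms] by simp

text \<open>In \<open>curvature_lower\<close> for \<open>G\<close> the scalar functions are replaced
  by their ambient expressions from \<open>tangential_part\<close>. Differentiating those gives
  second covariant derivatives along \<open>F\<close>, which commute up to ambient curvature, and
  products of first ones, which split into a tangential and a normal part.\<close>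

lemma gauss_equation:
  assumes "x \<in> U"
  shows "G x (M.R x u v w) z = G' (F x) (N.R (F x) (dd F x u) (dd F x v) (dd F x w)) (dd F x z)
    + G' (F x) (sff x v w) (sff x u z) - G' (F x) (sff x u w) (sff x v z)"
proof -
  have xS: "x \<in> S" using assms U_S by blast
  note Fx = F_S'[OF assms]
  let ?c = "\<lambda>w y v. cov_along G' F (\<lambda>y. dd F y w) y v"
  have split: "?c w x v = dd F x (M.\<Gamma> x v w) + sff x v w" for v w by (simp add: sff_def)
  have prod: "G' (F x) (?c w x v) (?c z x u)
    = G x (M.\<Gamma> x v w) (M.\<Gamma> x u z) + G' (F x) (sff x v w) (sff x u z)" for u v w z
    unfolding split linear_add[OF N.linear_left[OF Fx]] linear_add[OF N.linear_right[OF Fx]]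
    using sff_normal[OF assms] N.sym[OF Fx, of "dd F x _" "sff x _ _"] isometric[OF assms] by simp
  have "dd (\<lambda>y. G y (M.\<Gamma> y v w) z) x u = dd (\<lambda>y. G' (F y) (?c w y v) (dd F y z)) x u" for u v
    using dd_cong_open[OF open_U assms tangential_part] by simp
  also have "dd (\<lambda>y. G' (F y) (?c w y v) (dd F y z)) x u
    = G' (F x) (cov_along G' F (\<lambda>y. ?c w y v) x u) (dd F x z) + G' (F x) (?c w x v) (?c z x u)" for u v
    by (rule dd_eq[OF N.metric_along[OF open_U assms F_S' F_differentiable]])
      (auto intro!: N.cov_along_differentiable[OF open_U] assms F_S' smooth_F smooth_on_dd
        dd_F_differentiable)
  finally have D: "dd (\<lambda>y. G y (M.\<Gamma> y v w) z) x u - G x (M.\<Gamma> x v w) (M.\<Gamma> x u z)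
    = G' (F x) (cov_along G' F (\<lambda>y. ?c w y v) x u) (dd F x z) + G' (F x) (sff x v w) (sff x u z)" for u v
    by (simp add: prod)
  have "N.R (F x) (dd F x u) (dd F x v) (dd F x w) =
      cov_along G' F (\<lambda>y. ?c w y v) x u - cov_along G' F (\<lambda>y. ?c w y u) x v"
    by (rule N.curvature_along[OF open_U assms F_S' smooth_F smooth_on_dd[OF smooth_F], symmetric])
  then show ?thesis
    unfolding M.curvature_lower[OF xS] D by (simp add: linear_diff[OF N.linear_left[OF Fx]])
qed

end

section \<open>Orthonormal sets and algebraic curvature forms\<close>

text \<open>The type carries its own inner product, but lengths and angles are measured by
  \<open>g\<close>, the metric at one point in coordinates. Orthonormality below always refers to
  \<open>g\<close>.\<close>

locale inner_form =
  fixes g :: "'v::euclidean_space \<Rightarrow> 'v \<Rightarrow> real"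
  assumes sym: "g u v = g v u"
    and linear_left: "linear (\<lambda>u. g u v)"
    and pos: "u \<noteq> 0 \<Longrightarrow> g u u > 0"
begin

lemma linear_right: "linear (g u)"
  using linear_left[of u] sym[of u] by presburger

lemmas add_left = linear_add[OF linear_left] and add_right = linear_add[OF linear_right]
  and diff_left = linear_diff[OF linear_left] and diff_right = linear_diff[OF linear_right]
  and scale_left = linear_scale[OF linear_left] and scale_right = linear_scale[OF linear_right]
  and sum_left = linear_sum[OF linear_left] and sum_right = linear_sum[OF linear_right]
  and zero_left = linear_0[OF linear_left]

lemma nonneg: "g u u \<ge> 0"
  using pos[of u] zero_left by (cases "u = 0") auto

lemma eq_0_iff: "g u u = 0 \<longleftrightarrow> u = 0"
  using pos[of u] zero_left by (cases "u = 0") auto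

definition orthonormal :: "'v set \<Rightarrow> bool"
  where "orthonormal E \<longleftrightarrow> (\<forall>u\<in>E. \<forall>v\<in>E. g u v = (if u = v then 1 else 0))"

lemma orthonormal_independent:
  assumes "orthonormal E" shows "independent E"
proof (rule independent_if_scalars_zero)
  have *: "r x = 0" if "finite A" "A \<subseteq> E" "(\<Sum>x\<in>A. r x *\<^sub>R x) = 0" "x \<in> A" for A r x
  proof -
    have "0 = g (\<Sum>y\<in>A. r y *\<^sub>R y) x" using that zero_left by simp
    also have "\<dots> = (\<Sum>y\<in>A. r y * (if y = x then 1 else 0))"
      using that(2,4) assms
      by (simp add: sum_left scale_left orthonormal_def subset_iff cong: sum.cong)
    also have "\<dots> = r x" using that by (simp add: if_distrib cong: if_cong)
    finally show ?thesis by simp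
  qed
  \<comment> \<open>Finite orthonormal subsets are independent, so their size is at most the
    dimension; an infinite \<open>E\<close> would contain a larger one.\<close>
  show "finite E"
  proof (rule ccontr)
    assume "infinite E"
    then obtain A where A: "finite A" "card A = Suc DIM('v)" "A \<subseteq> E"
      by (meson infinite_arbitrarily_large)
    have "independent A"
      using * A by (intro independent_if_scalars_zero) (auto dest: subset_trans)
    then show False using independent_bound[of A] A by simp
  qed
  then show "r x = 0" if "(\<Sum>x\<in>E. r x *\<^sub>R x) = 0" "x \<in> E" for r x
    using * that by blast
qed

lemma orthonormal_finite: "orthonormal E \<Longrightarrow> finite E"
  using orthonormal_independent finiteI_independent by blast

lemma orthonormal_expansion:
  assumes E: "orthonormal E" and w: "w \<in> span E"
  shows "w = (\<Sum>e\<in>E. g w e *\<^sub>R e)"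
proof -
  obtain r where r: "w = (\<Sum>e\<in>E. r e *\<^sub>R e)"
    using w span_finite[OF orthonormal_finite[OF E]] by auto
  have "g w x = r x" if "x \<in> E" for x
  proof -
    have "g w x = (\<Sum>y\<in>E. r y * (if y = x then 1 else 0))"
      using that E by (auto simp: r sum_left scale_left orthonormal_def intro!: sum.cong)
    then show ?thesis using that orthonormal_finite[OF E] by (simp add: if_distrib cong: if_cong)
  qed
  then show ?thesis using r by simp
qed

text \<open>Gram-Schmidt, one vector per induction step. The measure decreases because orthonormal
  sets have at most \<open>DIM('v)\<close> elements.\<close>

lemma orthonormal_extend:
  assumes "subspace V" "orthonormal E" "E \<subseteq> V"
  shows "\<exists>E'. E \<subseteq> E' \<and> orthonormal E' \<and> span E' = V"
  using assms
proof (induction "DIM('v) - card E" arbitrary: E rule: less_induct)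
  case less
  show ?case
  proof (cases "span E = V")
    case False
    then obtain w where w: "w \<in> V" "w \<notin> span E"
      using span_minimal[OF less.prems(3,1)] by blast
    define z where "z = w - (\<Sum>e\<in>E. g w e *\<^sub>R e)"
    have fin: "finite E" using less.prems orthonormal_finite by blast
    have "(\<Sum>e\<in>E. g w e *\<^sub>R e) \<in> span E"
      by (intro span_sum span_scale span_base)
    then have z: "z \<in> V" "z \<noteq> 0"
      using w span_minimal[OF less.prems(3,1)] less.prems(1) by (auto simp: z_def intro: subspace_diff)
    have ze: "g z e = 0" if "e \<in> E" for e
    proof -
      have "g (\<Sum>y\<in>E. g w y *\<^sub>R y) e = (\<Sum>y\<in>E. g w y * (if y = e then 1 else 0))"
        using that less.prems(2) by (auto simp: sum_left scale_left orthonormal_def intro!: sum.cong)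
      also have "\<dots> = g w e" using fin that by (simp add: if_distrib cong: if_cong)
      finally show ?thesis by (simp add: z_def diff_left)
    qed
    define k where "k = (1 / sqrt (g z z)) *\<^sub>R z"
    have gzz: "g z z > 0" by (rule pos[OF z(2)])
    have kk: "g k k = 1"
      using gzz by (simp add: k_def scale_left scale_right flip: real_sqrt_mult)
    have ke: "g k e = 0" "g e k = 0" if "e \<in> E" for e
      using ze[OF that] sym[of e k] by (simp_all add: k_def scale_left)
    have kE: "k \<notin> E" using ke kk by force
    have on: "orthonormal (insert k E)"
      using less.prems(2) kk ke kE by (auto simp: orthonormal_def)
    have kV: "insert k E \<subseteq> V"
      using z(1) less.prems by (auto simp: k_def intro: subspace_scale)
    have "card (insert k E) \<le> DIM('v)"
      using independent_bound[OF orthonormal_independent[OF on]] by simp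
    then have "DIM('v) - card (insert k E) < DIM('v) - card E"
      using fin kE by simp
    from less.hyps[OF this less.prems(1) on kV] show ?thesis by blast
  qed (use less.prems in blast)
qed

lemma orthonormal_basis_card:
  assumes "orthonormal E" "span E = UNIV" shows "card E = DIM('v)"
  using dim_eq_card[of E UNIV] orthonormal_independent[OF assms(1)] assms(2) by simp

lemma orthonormal_pair_span:
  assumes "subspace \<pi>" "dim \<pi> = 2"
  shows "\<exists>u v. u \<noteq> v \<and> orthonormal {u, v} \<and> span {u, v} = \<pi>"
proof -
  obtain E where E: "orthonormal E" "span E = \<pi>"
    using orthonormal_extend[OF assms(1), of "{}"] by (auto simp: orthonormal_def)
  have "card E = 2"
    using dim_eq_card[of E \<pi>] orthonormal_independent[OF E(1)] E(2) assms
    by (metis span_span)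
  then show ?thesis using E unfolding card_2_iff by blast
qed

text \<open>The matrix with entries \<open>g e x\<close> is orthogonal, so the double expansion of
  the trace over \<open>E\<close> collapses to the diagonal of \<open>E'\<close>. Vector values are
  allowed because the mean curvature vector is such a trace, besides the real-valued Ricci
  curvature.\<close>

lemma trace_independent:
  fixes b :: "'v \<Rightarrow> 'v \<Rightarrow> 'w::real_vector"
  assumes l: "\<And>v. linear (\<lambda>u. b u v)" "\<And>u. linear (b u)"
    and E: "orthonormal E" and E': "orthonormal E'" and sp: "span E = span E'"
  shows "(\<Sum>e\<in>E. b e e) = (\<Sum>e\<in>E'. b e e)"
proof -
  note fin = orthonormal_finite[OF E] orthonormal_finite[OF E']
  have ex: "b e e = (\<Sum>x\<in>E'. \<Sum>y\<in>E'. (g e x * g e y) *\<^sub>R b x y)" if "e \<in> E" for e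
  proof -
    have e: "e = (\<Sum>x\<in>E'. g e x *\<^sub>R x)"
      by (rule orthonormal_expansion[OF E']) (use that sp span_base in blast)
    have "b e e = b (\<Sum>x\<in>E'. g e x *\<^sub>R x) (\<Sum>x\<in>E'. g e x *\<^sub>R x)"
      using e by simp
    also have "\<dots> = (\<Sum>x\<in>E'. \<Sum>y\<in>E'. (g e x * g e y) *\<^sub>R b x y)"
      by (simp only: linear_sum[OF l(1)])
        (simp add: linear_sum[OF l(2)] linear_scale[OF l(1)] linear_scale[OF l(2)] scaleR_sum_right
          mult.commute)
    finally show ?thesis .
  qed
  have gxy: "(\<Sum>e\<in>E. g e x * g e y) = (if x = y then 1 else 0)" if "x \<in> E'" "y \<in> E'" for x y
  proof -
    have "x = (\<Sum>e\<in>E. g x e *\<^sub>R e)"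
      by (rule orthonormal_expansion[OF E]) (use that sp span_base in blast)
    then have "g x y = g (\<Sum>e\<in>E. g x e *\<^sub>R e) y" by simp
    also have "\<dots> = (\<Sum>e\<in>E. g e x * g e y)"
      by (simp add: sum_left scale_left sym[of x])
    finally show ?thesis using that E' by (simp add: orthonormal_def)
  qed
  have "(\<Sum>e\<in>E. b e e) = (\<Sum>e\<in>E. \<Sum>x\<in>E'. \<Sum>y\<in>E'. (g e x * g e y) *\<^sub>R b x y)"
    using ex by simp
  also have "\<dots> = (\<Sum>x\<in>E'. \<Sum>y\<in>E'. \<Sum>e\<in>E. (g e x * g e y) *\<^sub>R b x y)"
    by (subst sum.swap) (intro sum.cong refl sum.swap)
  also have "\<dots> = (\<Sum>x\<in>E'. \<Sum>y\<in>E'. (if x = y then 1 else 0) *\<^sub>R b x y)"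
    by (intro sum.cong refl) (simp add: gxy flip: scaleR_sum_left)
  also have "\<dots> = (\<Sum>x\<in>E'. b x x)"
    using fin by (simp add: if_distrib[of "\<lambda>r. r *\<^sub>R _"] cong: if_cong)
  finally show ?thesis .
qed

end

text \<open>An algebraic curvature tensor; on an orthonormal pair \<open>Rm u v v u\<close> is the
  sectional curvature. \<open>skew34\<close> is the diagonal form in which the coordinate
  computation delivers antisymmetry; polarisation follows in \<open>antisym34\<close>.\<close>

locale curvature_form = inner_form g for g :: "'v::euclidean_space \<Rightarrow> 'v \<Rightarrow> real" +
  fixes Rm :: "'v \<Rightarrow> 'v \<Rightarrow> 'v \<Rightarrow> 'v \<Rightarrow> real"
  assumes linear1: "linear (\<lambda>u. Rm u v w z)" and linear2: "linear (\<lambda>v. Rm u v w z)"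
    and linear3: "linear (\<lambda>w. Rm u v w z)" and linear4: "linear (\<lambda>z. Rm u v w z)"
    and antisym12: "Rm u v w z = - Rm v u w z" and skew34: "Rm u v w w = 0"
    and bianchi: "Rm u v w z + Rm v w u z + Rm w u v z = 0"
begin

lemmas Rm_add = linear_add[OF linear1] linear_add[OF linear2] linear_add[OF linear3] linear_add[OF linear4]
lemmas Rm_diff = linear_diff[OF linear1] linear_diff[OF linear2] linear_diff[OF linear3] linear_diff[OF linear4]
lemmas Rm_neg = linear_neg[OF linear1] linear_neg[OF linear2] linear_neg[OF linear3] linear_neg[OF linear4]
lemmas Rm_scale = linear_scale[OF linear1] linear_scale[OF linear2] linear_scale[OF linear3] linear_scale[OF linear4]

lemma antisym34: "Rm u v w z = - Rm u v z w"
  using skew34[of u v "w + z"] skew34[of u v w] skew34[of u v z] by (simp add: Rm_add)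

lemma skew12: "Rm u u w z = 0"
  using antisym12[of u u w z] by simp

text \<open>The four Bianchi identities, with each of the arguments once in the last place, combine
  linearly modulo the two antisymmetries.\<close>

lemma pair_sym: "Rm u v w z = Rm w z u v"
  using bianchi[of u v w z] bianchi[of v w z u] bianchi[of w z u v] bianchi[of z u v w]
    antisym12[of u v w z] antisym12[of v w u z] antisym12[of w u v z] antisym12[of z u v w]
    antisym34[of u v w z] antisym34[of v w u z] antisym34[of w u v z] antisym34[of w z v u]
    antisym34[of v w z u] antisym34[of w z u v] antisym34[of z v w u] antisym34[of z u v w]
    antisym34[of u v z w] antisym34[of v z u w] antisym34[of u w z v] antisym12[of z v w u]
    antisym34[of u w v z] antisym12[of u w v z] antisym12[of u w z v] antisym12[of v z u w]
  by argo

text \<open>Passing to another pair multiplies the value by the squared determinant of the change of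
  basis, which is 1 by Lagrange's identity. This is why sectional curvature depends on the plane
  only.\<close>

lemma rotate:
  assumes "orthonormal {u, v}" "u \<noteq> v" "orthonormal {u', v'}" "u' \<noteq> v'"
    "u' \<in> span {u, v}" "v' \<in> span {u, v}"
  shows "Rm u' v' v' u' = Rm u v v u"
proof -
  have ex: "w = g w u *\<^sub>R u + g w v *\<^sub>R v" if "w \<in> span {u, v}" for w
    using orthonormal_expansion[OF assms(1) that] assms(2) by simp
  define a b c d where "a = g u' u" "b = g u' v" "c = g v' u" "d = g v' v"
  have u': "u' = a *\<^sub>R u + b *\<^sub>R v" and v': "v' = c *\<^sub>R u + d *\<^sub>R v"
    using ex[OF assms(5)] ex[OF assms(6)] by (simp_all add: a_b_c_d_def)
  have uv: "g u u = 1" "g v v = 1" "g u v = 0" "g v u = 0"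
    using assms(1,2) by (auto simp: orthonormal_def)
  have uv': "g u' u' = 1" "g v' v' = 1" "g u' v' = 0"
    using assms(3,4) by (auto simp: orthonormal_def)
  have 1: "a * a + b * b = 1" "c * c + d * d = 1" "a * c + b * d = 0"
    using uv' unfolding u' v' by (simp_all add: add_left add_right scale_left scale_right uv mult.commute)
  have "Rm u' v' v' u' = (a * d - b * c)\<^sup>2 * Rm u v v u"
    unfolding u' v'
    using antisym12[of v u v u] antisym34[of u v u v] antisym34[of v u u v] antisym12[of v u u v]
    by (simp add: Rm_add Rm_scale skew34 skew12 power2_eq_square algebra_simps)
  moreover have "(a * d - b * c)\<^sup>2 = (a * a + b * b) * (c * c + d * d) - (a * c + b * d)\<^sup>2"
    by (simp add: power2_eq_square algebra_simps)
  ultimately show ?thesis by (simp add: 1)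
qed

text \<open>Polarising \<open>hol\<close> gives 6 K(u, Jv) + 2 K(u, v) = 8 c for every orthonormal
  pair. If moreover u is orthogonal to Jv, then (u, Jv) is such a pair too and the equation holds
  with the roles exchanged, so both curvatures equal c.\<close>

lemma constant_holomorphic:
  assumes J: "linear J" "\<And>u. J (J u) = - u" and RJ: "\<And>u v w z. Rm u v (J w) (J z) = Rm u v w z"
    and gJ: "\<And>u v. g (J u) (J v) = g u v"
    and hol: "\<And>u. Rm u (J u) (J u) u = 4 * c * (g u u)\<^sup>2"
    and on: "g u u = 1" "g v v = 1" "g u v = 0" "g u (J v) = 0"
  shows "Rm u v v u = c"
proof -
  have RJ': "Rm (J u) (J v) w z = Rm u v w z" for u v w z
    using pair_sym RJ by metis
  have step: "6 * Rm u (J v) (J v) u + 2 * Rm u v v u = 8 * c"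
    if on: "g u u = 1" "g v v = 1" "g u v = 0" for u v
  proof -
    let ?K = "Rm u (J v) (J v) u"
    have "Rm v (J u) (J v) u = ?K"
      using RJ'[of v "J u" "J v" u] antisym12[of u "J v" "J v" u] by (simp add: J Rm_neg)
    moreover have "Rm u (J v) (J u) v = ?K"
      using RJ[of u "J v" "J u" v] antisym34[of u "J v" u "J v"] by (simp add: J Rm_neg)
    moreover have "Rm v (J u) (J u) v = ?K"
      using RJ'[of v "J u" "J u" v] RJ[of "J v" u "J u" v] antisym12[of u "J v" "J v" u]
        antisym34[of "J v" u "J v" u] by (simp add: J Rm_neg)
    moreover have "Rm u (J u) (J v) v = Rm v (J v) (J u) u"
      using pair_sym[of u "J u" "J v" v] antisym12[of "J v" v u "J u"] antisym34[of v "J v" u "J u"]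
      by simp
    moreover have "Rm v (J v) (J u) u = Rm u v v u + ?K"
      using bianchi[of v "J v" "J u" u] RJ'[of v u v u] antisym12[of u v v u]
        antisym12[of v "J u" "J v" u] \<open>Rm v (J u) (J v) u = ?K\<close> by simp
    moreover have "Rm u (J u) (J u) u = 4 * c" "Rm v (J v) (J v) v = 4 * c"
      using hol[of u] hol[of v] on by simp_all
    \<comment> \<open>In the sum of these two expansions the terms odd in \<open>v\<close> cancel.
      The six mixed terms left in each are those computed above and add up to
      \<open>6 * ?K + 2 * Rm u v v u\<close>.\<close>
    moreover have "Rm (u + v) (J (u + v)) (J (u + v)) (u + v) = 16 * c"
      "Rm (u - v) (J (u - v)) (J (u - v)) (u - v) = 16 * c"
      unfolding hol using on sym[of v u] by (simp_all add: add_left add_right diff_left diff_right)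
    ultimately show ?thesis
      unfolding linear_add[OF J(1)] linear_diff[OF J(1)] Rm_add Rm_diff by argo
  qed
  have "g v u = 0" using on(3) sym[of v u] by simp
  then show ?thesis
    using step[OF on(1-3)] step[of u "J v"] on by (simp add: J gJ Rm_neg)
qed

end

section \<open>Chen's inequality for mutually orthogonal planes\<close>

context inner_form
begin

text \<open>Young's inequality from the squares of \<open>2 *\<^sub>R s *\<^sub>R d - m\<close> and
  \<open>2 *\<^sub>R s *\<^sub>R d + m\<close>. A large weight \<open>s\<close> makes the share of
  \<open>m\<close> small at the expense of \<open>d\<close>.\<close>

lemma inner_le_weighted:
  assumes "s > 0"
  shows "g d m \<le> g m m / (4 * s) + s * g d d" "- g d m \<le> g m m / (4 * s) + s * g d d"
proof -
  have "0 \<le> g (2 *\<^sub>R s *\<^sub>R d - m) (2 *\<^sub>R s *\<^sub>R d - m)" "0 \<le> g (2 *\<^sub>R s *\<^sub>R d + m) (2 *\<^sub>R s *\<^sub>R d + m)"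
    by (rule nonneg)+
  then have "4 * s * g d m \<le> g m m + 4 * s * (s * g d d)" "- (4 * s * g d m) \<le> g m m + 4 * s * (s * g d d)"
    using sym[of m d]
    by (simp_all add: diff_left diff_right add_left add_right scale_left scale_right algebra_simps)
  then show "g d m \<le> g m m / (4 * s) + s * g d d" "- g d m \<le> g m m / (4 * s) + s * g d d"
    using assms by (simp_all add: field_simps)
qed

lemma norm_add_le: "g (u + v) (u + v) \<le> 2 * (g u u + g v v)"
  using nonneg[of "u - v"] by (simp add: diff_left diff_right add_left add_right)

text \<open>The plane \<open>\<pi>\<^sub>i\<close> is spanned by \<open>a i\<close> and \<open>b i\<close>; the vectors of \<open>Z\<close> complete the basis.\<close>

definition frame :: "nat \<Rightarrow> (nat \<Rightarrow> 'v) \<Rightarrow> (nat \<Rightarrow> 'v) \<Rightarrow> 'v set \<Rightarrow> bool"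
  where "frame q a b Z \<longleftrightarrow> orthonormal (a ` {1..q} \<union> b ` {1..q} \<union> Z) \<and>
    span (a ` {1..q} \<union> b ` {1..q} \<union> Z) = UNIV \<and> inj_on a {1..q} \<and> inj_on b {1..q} \<and>
    a ` {1..q} \<inter> b ` {1..q} = {} \<and> (a ` {1..q} \<union> b ` {1..q}) \<inter> Z = {}"

lemma frame_exists:
  assumes "\<And>i j. i \<in> {1..q} \<Longrightarrow> j \<in> {1..q} \<Longrightarrow> g (a i) (a j) = (if i = j then 1 else 0)"
    and "\<And>i j. i \<in> {1..q} \<Longrightarrow> j \<in> {1..q} \<Longrightarrow> g (b i) (b j) = (if i = j then 1 else 0)"
    and "\<And>i j. i \<in> {1..q} \<Longrightarrow> j \<in> {1..q} \<Longrightarrow> g (a i) (b j) = 0"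
  shows "\<exists>Z. frame q a b Z"
proof -
  let ?E = "a ` {1..q} \<union> b ` {1..q}"
  have inj: "inj_on a {1..q}" "inj_on b {1..q}"
    using assms(1,2) by (metis inj_onI zero_neq_one)+
  have ba: "g (b i) (a j) = 0" if "i \<in> {1..q}" "j \<in> {1..q}" for i j
    using assms(3)[OF that(2,1)] sym by simp
  have disj: "a i \<noteq> b j" if "i \<in> {1..q}" "j \<in> {1..q}" for i j
    using assms(1)[OF that(1,1)] ba[OF that(2,1)] by auto
  have "orthonormal ?E"
    unfolding orthonormal_def
  proof (intro ballI)
    fix u v assume "u \<in> ?E" "v \<in> ?E"
    then consider (aa) i j where "i \<in> {1..q}" "j \<in> {1..q}" "u = a i" "v = a j"
      | (ab) i j where "i \<in> {1..q}" "j \<in> {1..q}" "u = a i" "v = b j"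
      | (ba) i j where "i \<in> {1..q}" "j \<in> {1..q}" "u = b i" "v = a j"
      | (bb) i j where "i \<in> {1..q}" "j \<in> {1..q}" "u = b i" "v = b j"
      by blast
    then show "g u v = (if u = v then 1 else 0)"
    proof cases
      case aa then show ?thesis using assms(1)[OF aa(1,2)] inj_on_eq_iff[OF inj(1) aa(1,2)] by simp
    next
      case ab then show ?thesis using assms(3)[OF ab(1,2)] disj[OF ab(1,2)] by simp
    next
      case ba' : ba then show ?thesis using ba[OF ba'(1,2)] disj[OF ba'(2,1)] by simp
    next
      case bb then show ?thesis using assms(2)[OF bb(1,2)] inj_on_eq_iff[OF inj(2) bb(1,2)] by simp
    qed
  qed
  then obtain E' where E': "?E \<subseteq> E'" "orthonormal E'" "span E' = UNIV"
    using orthonormal_extend[of UNIV ?E] by auto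
  then have "?E \<union> (E' - ?E) = E'" by blast
  then have "frame q a b (E' - ?E)"
    using E' inj disj by (auto simp: frame_def)
  then show ?thesis ..
qed

lemma frame_finite:
  assumes "frame q a b Z" shows "finite Z"
  using assms orthonormal_finite[of "a ` {1..q} \<union> b ` {1..q} \<union> Z"] by (simp add: frame_def)

lemma sum_frame:
  assumes "frame q a b Z"
  shows "sum F (a ` {1..q} \<union> b ` {1..q} \<union> Z) = (\<Sum>i=1..q. F (a i) + F (b i)) + sum F Z"
  using assms frame_finite[OF assms]
  by (simp add: frame_def sum.union_disjoint sum.reindex sum.distrib)

lemma frame_card:
  assumes "frame q a b Z" shows "2 * q + card Z = DIM('v)"
  using orthonormal_basis_card[of "a ` {1..q} \<union> b ` {1..q} \<union> Z"] sum_frame[OF assms, of "\<lambda>_. 1::nat"] assms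
  by (simp add: frame_def)

lemma frame_orthonormal:
  assumes "frame q a b Z" "i \<in> {1..q}"
  shows "g (a i) (a i) = 1" "g (b i) (b i) = 1" "g (a i) (b i) = 0" "a i \<noteq> b i"
  using assms unfolding frame_def orthonormal_def by (auto; force)+

end

text \<open>Of its value only the independence of the frame matters.\<close>

definition chen_constant :: "nat \<Rightarrow> nat \<Rightarrow> real"
  where "chen_constant n q = (let N = real n - real q; s = real q + real n * N;
    K = s * (1 + real n * N) + real n in (real n + 1 / 4) * (4 * K) + K)"

text \<open>What the geometry leaves at one point: an Einstein metric enters later through the value
  of the Ricci sums, and the space form only through \<open>c\<close>, the ambient curvature of the
  totally real planes that orthonormal pairs span.\<close>

locale gauss_form = M: curvature_form g Rm + N: inner_form g'
  for g :: "'v::euclidean_space \<Rightarrow> 'v \<Rightarrow> real" and Rm and g' :: "'w::euclidean_space \<Rightarrow> 'w \<Rightarrow> real" +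
  fixes h :: "'v \<Rightarrow> 'v \<Rightarrow> 'w" and c :: real
  assumes linear_h: "linear (\<lambda>u. h u v)" and h_sym: "h u v = h v u"
    and gauss: "g u u = 1 \<Longrightarrow> g v v = 1 \<Longrightarrow> g u v = 0 \<Longrightarrow>
      Rm u v v u = c + g' (h u u) (h v v) - g' (h u v) (h u v)"
begin

lemma linear_h': "linear (h u)"
  using linear_h[of u] h_sym[of u] by presburger

text \<open>Both sums on the right may run over all of \<open>E\<close>, since their terms with v =
  u cancel.\<close>

lemma ricci_gauss:
  assumes E: "M.orthonormal E" "span E = UNIV" and u: "u \<in> E"
  shows "(\<Sum>v\<in>E - {u}. Rm u v v u) = (real DIM('v) - 1) * c
    + g' (h u u) (\<Sum>v\<in>E. h v v) - (\<Sum>v\<in>E. g' (h u v) (h u v))"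
proof -
  have fin: "finite E" by (rule M.orthonormal_finite[OF E(1)])
  have "(\<Sum>v\<in>E - {u}. Rm u v v u) = (\<Sum>v\<in>E - {u}. c + g' (h u u) (h v v) - g' (h u v) (h u v))"
    using E(1) u by (intro sum.cong refl gauss) (auto simp: M.orthonormal_def)
  also have "\<dots> = real (card (E - {u})) * c
      + ((\<Sum>v\<in>E - {u}. g' (h u u) (h v v)) - (\<Sum>v\<in>E - {u}. g' (h u v) (h u v)))"
    by (simp add: sum.distrib sum_subtractf)
  also have "(\<Sum>v\<in>E - {u}. g' (h u u) (h v v)) = g' (h u u) (\<Sum>v\<in>E. h v v) - g' (h u u) (h u u)"
    using fin u by (simp add: N.sum_right sum_diff1)
  also have "(\<Sum>v\<in>E - {u}. g' (h u v) (h u v)) = (\<Sum>v\<in>E. g' (h u v) (h u v)) - g' (h u u) (h u u)"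
    using fin u by (simp add: sum_diff1)
  also have "real (card (E - {u})) = real DIM('v) - 1"
    using fin u M.orthonormal_basis_card[OF E] by (simp add: of_nat_diff Suc_leI card_gt_0_iff)
  finally show ?thesis by simp
qed

text \<open>With \<open>r\<close> the Ricci curvature and \<open>t\<close> the trace of \<open>h\<close>, \<open>deficit\<close> is \<open>n\<close> times the
  difference of the two sides of the inequality for the planes spanned by \<open>a i\<close>, \<open>b i\<close>, and
  \<open>sff_norm\<close> is the squared norm of \<open>h\<close> by the Gauss equation, in a form that involves no frame.\<close>

definition deficit :: "nat \<Rightarrow> real \<Rightarrow> 'w \<Rightarrow> (nat \<Rightarrow> 'v) \<Rightarrow> (nat \<Rightarrow> 'v) \<Rightarrow> real"
  where "deficit q r t a b = (let n = real DIM('v) in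
    n * (n - 1) * c - 2 * real q * c + (1 - 1 / (n - real q)) * g' t t - n * r
    + 2 * (\<Sum>i=1..q. Rm (a i) (b i) (b i) (a i)))"

definition sff_norm :: "real \<Rightarrow> 'w \<Rightarrow> real"
  where "sff_norm r t = (let n = real DIM('v) in g' t t + n * (n - 1) * c - n * r)"

lemma sff_norm_eq:
  assumes E: "M.orthonormal E" "span E = UNIV" and t: "t = (\<Sum>u\<in>E. h u u)"
    and ric: "\<And>u. u \<in> E \<Longrightarrow> (\<Sum>v\<in>E - {u}. Rm u v v u) = r"
  shows "sff_norm r t = (\<Sum>u\<in>E. \<Sum>v\<in>E. g' (h u v) (h u v))"
proof -
  define n where "n = real DIM('v)"
  have "r = (n - 1) * c + g' (h u u) t - (\<Sum>v\<in>E. g' (h u v) (h u v))" if "u \<in> E" for u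
    using ric[OF that] ricci_gauss[OF E that] unfolding t n_def by simp
  then have "(\<Sum>u\<in>E. r) = (\<Sum>u\<in>E. (n - 1) * c + g' (h u u) t - (\<Sum>v\<in>E. g' (h u v) (h u v)))"
    by (intro sum.cong) auto
  then have "n * r = n * (n - 1) * c + (\<Sum>u\<in>E. g' (h u u) t) - (\<Sum>u\<in>E. \<Sum>v\<in>E. g' (h u v) (h u v))"
    using M.orthonormal_basis_card[OF E] by (simp add: sum.distrib sum_subtractf n_def)
  also have "(\<Sum>u\<in>E. g' (h u u) t) = g' t t"
    unfolding t by (simp add: N.sum_left)
  finally show ?thesis by (simp add: sff_norm_def n_def Let_def)
qed

lemma chen:
  assumes frame: "M.frame q a b Z" and q: "0 < q" "2 * q < DIM('v)"
    and t: "t = (\<Sum>u\<in>a ` {1..q} \<union> b ` {1..q} \<union> Z. h u u)"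
    and ric: "\<And>u. u \<in> a ` {1..q} \<union> b ` {1..q} \<union> Z \<Longrightarrow>
      (\<Sum>v\<in>a ` {1..q} \<union> b ` {1..q} \<union> Z - {u}. Rm u v v u) = r"
  shows "0 \<le> deficit q r t a b" "sff_norm r t \<le> chen_constant DIM('v) q * deficit q r t a b"
proof -
  let ?E = "a ` {1..q} \<union> b ` {1..q} \<union> Z"
  define n where "n = real DIM('v)"
  define N where "N = n - real q"
  have E: "M.orthonormal ?E" "span ?E = UNIV" and fin: "finite ?E" "finite Z"
    using frame M.frame_finite[OF frame] by (auto simp: M.frame_def)
  have cardZ: "real (card Z) = n - 2 * real q"
    using M.frame_card[OF frame] by (simp add: n_def flip: of_nat_add of_nat_mult)
  have N1: "N \<ge> real q + 1" using q by (simp add: N_def n_def)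
  have q1: "real q \<ge> 1" using q by simp
  define row where "row u = (\<Sum>v\<in>?E. g' (h u v) (h u v))" for u
  define S where "S = (\<Sum>u\<in>?E. row u)"
  have ricu: "r = (n - 1) * c + g' (h u u) t - row u" if "u \<in> ?E" for u
    using ric[OF that] ricci_gauss[OF E that]
    unfolding row_def t n_def by simp
  have norm: "sff_norm r t = S"
    unfolding S_def row_def by (rule sff_norm_eq[OF E t ric])
  then have nr: "n * r = n * (n - 1) * c + g' t t - S"
    by (simp add: sff_norm_def n_def[symmetric] Let_def)
  define ti where "ti i = h (a i) (a i) + h (b i) (b i)" for i
  \<comment> \<open>The share of |h|^2 from ordered pairs inside the i-th plane; the factor 2 counts
    (a, b) and (b, a).\<close>
  define ki where "ki i = g' (h (a i) (a i)) (h (a i) (a i)) + g' (h (b i) (b i)) (h (b i) (b i))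
    + 2 * g' (h (a i) (b i)) (h (a i) (b i))" for i
  define kz where "kz z = g' (h z z) (h z z)" for z
  define \<mu> where "\<mu> = (1 / N) *\<^sub>R t"
  define P where "P = (\<Sum>i=1..q. g' (ti i) (ti i)) + sum kz Z"
  define Off where "Off = S - (\<Sum>i=1..q. ki i) - sum kz Z"
  define m where "m = g' \<mu> \<mu>"
  have t\<mu>: "t = N *\<^sub>R \<mu>" using N1 by (simp add: \<mu>_def)
  have tt: "g' t t = N * N * m"
    unfolding t\<mu> by (simp add: N.scale_left N.scale_right m_def)
  have tsum: "t = (\<Sum>i=1..q. ti i) + (\<Sum>z\<in>Z. h z z)"
    unfolding t M.sum_frame[OF frame] ti_def ..
  have K: "2 * Rm (a i) (b i) (b i) (a i) = 2 * c + g' (ti i) (ti i) - ki i" if "i \<in> {1..q}" for i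
    using gauss[OF M.frame_orthonormal(1-3)[OF frame that]] N.sym[of "h (b i) (b i)" "h (a i) (a i)"]
    by (simp add: ti_def ki_def N.add_left N.add_right)
  have "2 * (\<Sum>i=1..q. Rm (a i) (b i) (b i) (a i)) = (\<Sum>i=1..q. 2 * c + g' (ti i) (ti i) - ki i)"
    unfolding sum_distrib_left using K by (intro sum.cong) auto
  then have Ksum: "2 * (\<Sum>i=1..q. Rm (a i) (b i) (b i) (a i))
      = 2 * real q * c + (\<Sum>i=1..q. g' (ti i) (ti i)) - (\<Sum>i=1..q. ki i)"
    by (simp add: sum.distrib sum_subtractf)
  \<comment> \<open>Since the q + card Z = N group traces add up to N \<mu>, this is the sum of
    their squared distances from \<mu>, that is, the defect in the Cauchy-Schwarz step.\<close>
  define d where "d = P - N * m"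
  have "d = (\<Sum>i=1..q. g' (ti i - \<mu>) (ti i - \<mu>)) + (\<Sum>z\<in>Z. g' (h z z - \<mu>) (h z z - \<mu>))"
  proof -
    have ex: "g' (u - \<mu>) (u - \<mu>) = g' u u - 2 * g' u \<mu> + m" for u
      using N.sym[of \<mu> u] by (simp add: N.diff_left N.diff_right m_def)
    have "g' t \<mu> = (\<Sum>i=1..q. g' (ti i) \<mu>) + (\<Sum>z\<in>Z. g' (h z z) \<mu>)"
      unfolding tsum by (simp add: N.add_left N.sum_left)
    moreover have "g' t \<mu> = N * m" unfolding t\<mu> by (simp add: N.scale_left m_def)
    moreover have "real q * m + real (card Z) * m = N * m"
      by (simp add: cardZ N_def algebra_simps)
    ultimately show ?thesis
      unfolding ex d_def P_def kz_def
      by (simp add: sum.distrib sum_subtractf flip: sum_distrib_left)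
  qed
  then have dge: "d \<ge> (\<Sum>i=1..q. g' (ti i - \<mu>) (ti i - \<mu>))"
    "\<And>z. z \<in> Z \<Longrightarrow> d \<ge> g' (h z z - \<mu>) (h z z - \<mu>)"
    using member_le_sum[of _ Z "\<lambda>z. g' (h z z - \<mu>) (h z z - \<mu>)"] N.nonneg fin
    by (smt (verit) sum_nonneg)+
  have row_ge: "row u \<ge> (\<Sum>v\<in>A. g' (h u v) (h u v))" if "A \<subseteq> ?E" for u A
    unfolding row_def using that fin N.nonneg by (intro sum_mono2) auto
  have rowab: "row (a i) + row (b i) \<ge> ki i" if "i \<in> {1..q}" for i
    using row_ge[of "{a i, b i}" "a i"] row_ge[of "{a i, b i}" "b i"] that
      M.frame_orthonormal(4)[OF frame that] h_sym[of "b i" "a i"]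
    by (simp add: ki_def)
  have rowz: "row z \<ge> kz z" if "z \<in> Z" for z
    using row_ge[of "{z}" z] that by (simp add: kz_def)
  have S_split: "S = (\<Sum>i=1..q. row (a i) + row (b i)) + sum row Z"
    unfolding S_def by (rule M.sum_frame[OF frame])
  have Off_ge: "row z - kz z \<le> Off" if "z \<in> Z" for z
  proof -
    have "row z - kz z \<le> (\<Sum>z\<in>Z. row z - kz z)"
      using that rowz fin by (intro member_le_sum) auto
    moreover have "(\<Sum>i=1..q. ki i) \<le> (\<Sum>i=1..q. row (a i) + row (b i))"
      by (intro sum_mono rowab)
    ultimately show ?thesis unfolding Off_def S_split by (simp add: sum_subtractf)
  qed
  have "Z \<noteq> {}" using cardZ q by (auto simp: n_def)
  then obtain z where z: "z \<in> Z" by blast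
  have d0: "d \<ge> 0" using dge(2)[OF z] N.nonneg order_trans by blast
  have Off0: "Off \<ge> 0" using Off_ge[OF z] rowz[OF z] by simp
  have deficit: "deficit q r t a b = d + Off"
  proof -
    have "deficit q r t a b = (1 - 1 / N) * (N * N * m) - g' t t + S
        + (\<Sum>i=1..q. g' (ti i) (ti i)) - (\<Sum>i=1..q. ki i)"
      using nr Ksum unfolding deficit_def Let_def n_def[symmetric] N_def[symmetric] tt by simp
    also have "(1 - 1 / N) * (N * N * m) = N * N * m - N * m"
      using N1 by (simp add: field_simps)
    finally show ?thesis
      by (simp add: d_def P_def Off_def tt)
  qed
  show "0 \<le> deficit q r t a b" using deficit d0 Off0 by simp
  \<comment> \<open>The Young errors m / (4 s) will occur with total coefficient q + n N, so this
    weight makes them add up to m / 4.\<close>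
  define s where "s = real q + n * N"
  have n0: "n \<ge> 1" using q by (simp add: n_def)
  have nN0: "n * N \<ge> 0" using n0 N1 by simp
  have s1: "s \<ge> 1" using q1 nN0 by (simp add: s_def)
  have m0: "m \<ge> 0" unfolding m_def by (rule N.nonneg)
  define w where "w = g' (h z z - \<mu>) \<mu>"
  have w_le: "\<bar>w\<bar> \<le> m / (4 * s) + s * d"
  proof -
    have "s * g' (h z z - \<mu>) (h z z - \<mu>) \<le> s * d"
      using dge(2)[OF z] s1 by (intro mult_left_mono) auto
    then show ?thesis
      using N.inner_le_weighted[of s "h z z - \<mu>" \<mu>] s1 unfolding w_def m_def by linarith
  qed
  \<comment> \<open>The only use of the Ricci curvature of the single vector \<open>z\<close>.
    Eliminating \<open>r\<close> between it and the mean gives |h|^2 = |t|^2 - n g'(h z z, t) + n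
    \<open>row z\<close>, where \<open>row z\<close> is close to \<open>kz z\<close>.\<close>
  have upper: "S \<le> (n - real q * N) * m + n * N * (m / (4 * s) + s * d) + n * (d + Off)"
  proof -
    have hz: "h z z = \<mu> + (h z z - \<mu>)" by simp
    have 1: "g' (h z z) t = N * m + N * w"
      unfolding t\<mu> w_def m_def by (subst hz) (simp add: N.scale_right N.add_left N.diff_left algebra_simps)
    have "kz z = m + 2 * w + g' (h z z - \<mu>) (h z z - \<mu>)"
      using N.sym[of \<mu> "h z z"] unfolding kz_def m_def w_def by (simp add: N.diff_left N.diff_right)
    then have 2: "row z \<le> m + 2 * w + d + Off"
      using Off_ge[OF z] dge(2)[OF z] by simp
    have "S = N * N * m - n * (N * m + N * w) + n * row z"
      using nr ricu[of z] z tt 1 by (simp add: algebra_simps)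
    also have "\<dots> \<le> N * N * m - n * (N * m + N * w) + n * (m + 2 * w + d + Off)"
      using 2 n0 by (intro add_left_mono mult_left_mono) auto
    also have "\<dots> = (n - real q * N) * m + n * ((2 - N) * w) + n * (d + Off)"
      by (simp add: N_def algebra_simps)
    also have "n * ((2 - N) * w) \<le> n * (N * (m / (4 * s) + s * d))"
    proof (intro mult_left_mono)
      have "(2 - N) * w \<le> \<bar>2 - N\<bar> * \<bar>w\<bar>" by (metis abs_ge_self abs_mult)
      also have "\<dots> \<le> N * (m / (4 * s) + s * d)"
        using w_le N1 q1 by (intro mult_mono) auto
      finally show "(2 - N) * w \<le> N * (m / (4 * s) + s * d)" .
    qed (use n0 in auto)
    finally show ?thesis by simp
  qed
  \<comment> \<open>Only pairs inside a group are kept. In a plane they contribute at least half the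
    squared trace, hence the coefficient N - q / 2 instead of N.\<close>
  have lower: "(N - real q / 2) * m - real q * (m / (4 * s)) - s * d \<le> S"
  proof -
    have "(\<Sum>i=1..q. g' (ti i) (ti i)) / 2 \<le> (\<Sum>i=1..q. ki i)"
      unfolding sum_divide_distrib
    proof (intro sum_mono)
      fix i
      show "g' (ti i) (ti i) / 2 \<le> ki i"
        using N.norm_add_le[of "h (a i) (a i)" "h (b i) (b i)"] N.nonneg[of "h (a i) (b i)"]
          N.nonneg[of "ti i"] unfolding ti_def[symmetric] ki_def by argo
    qed
    then have S_ge: "S \<ge> P - (\<Sum>i=1..q. g' (ti i) (ti i)) / 2"
      using Off0 by (simp add: Off_def P_def)
    have "(\<Sum>i=1..q. g' (ti i) (ti i)) = (\<Sum>i=1..q. m + 2 * g' (ti i - \<mu>) \<mu> + g' (ti i - \<mu>) (ti i - \<mu>))"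
    proof (rule sum.cong[OF refl])
      fix i
      show "g' (ti i) (ti i) = m + 2 * g' (ti i - \<mu>) \<mu> + g' (ti i - \<mu>) (ti i - \<mu>)"
        using N.sym[of \<mu> "ti i"] by (simp add: N.diff_left N.diff_right m_def)
    qed
    also have "\<dots> \<le> (\<Sum>i=1..q. m + 2 * (m / (4 * s) + s * g' (ti i - \<mu>) (ti i - \<mu>)) + g' (ti i - \<mu>) (ti i - \<mu>))"
    proof (rule sum_mono)
      fix i
      show "m + 2 * g' (ti i - \<mu>) \<mu> + g' (ti i - \<mu>) (ti i - \<mu>)
        \<le> m + 2 * (m / (4 * s) + s * g' (ti i - \<mu>) (ti i - \<mu>)) + g' (ti i - \<mu>) (ti i - \<mu>)"
        using N.inner_le_weighted(1)[of s "ti i - \<mu>" \<mu>, folded m_def] s1 by argo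
    qed
    also have "\<dots> = real q * m + 2 * (real q * (m / (4 * s))) + (2 * s + 1) * (\<Sum>i=1..q. g' (ti i - \<mu>) (ti i - \<mu>))"
      by (simp add: sum.distrib sum_distrib_left algebra_simps)
    also have "\<dots> \<le> real q * m + 2 * (real q * (m / (4 * s))) + (2 * s + 1) * d"
      using dge(1) s1 by (intro add_left_mono mult_left_mono) auto
    finally show ?thesis
      using S_ge d0 by (simp add: d_def algebra_simps)
  qed
  define K where "K = s * (1 + n * N) + n"
  have m_le: "m \<le> 4 * K * (d + Off)"
  proof -
    \<comment> \<open>The gap between the coefficients of \<open>lower\<close> and
      \<open>upper\<close>. Half of this m / 2 pays for the Young errors, which leaves m / 4 to be
      bounded by the deficit.\<close>
    have "m / 2 \<le> real q * (N - 3/2) * m"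
    proof -
      have "1 * (1/2) \<le> real q * (N - 3/2)" using q1 N1 by (intro mult_mono) auto
      from mult_right_mono[OF this m0] show ?thesis by simp
    qed
    also have "\<dots> = (N - real q / 2) * m - (n - real q * N) * m"
      by (simp add: N_def algebra_simps)
    also have "\<dots> \<le> (real q + n * N) * (m / (4 * s)) + s * (1 + n * N) * d + n * (d + Off)"
    proof -
      define e where "e = m / (4 * s)"
      show ?thesis
        using upper lower unfolding e_def[symmetric] by (simp add: algebra_simps)
    qed
    also have "(real q + n * N) * (m / (4 * s)) = m / 4"
      using s1 unfolding s_def[symmetric] by simp
    finally have "m / 4 \<le> s * (1 + n * N) * d + n * (d + Off)" by simp
    also have "\<dots> \<le> s * (1 + n * N) * (d + Off) + n * (d + Off)"
      using s1 nN0 Off0 by (intro add_right_mono mult_left_mono) auto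
    finally show ?thesis by (simp add: K_def algebra_simps)
  qed
  have "S \<le> n * m + m / 4 + K * (d + Off)"
  proof -
    have "(n - real q * N) * m \<le> n * m"
      using m0 q1 N1 by (intro mult_right_mono) auto
    moreover have "n * N * (m / (4 * s)) \<le> m / 4"
    proof -
      have "n * N * (m / (4 * s)) \<le> s * (m / (4 * s))"
        using m0 s1 by (intro mult_right_mono) (auto simp: s_def)
      then show ?thesis using s1 by simp
    qed
    moreover have "n * N * (s * d) \<le> s * (1 + n * N) * (d + Off)"
    proof -
      have "n * N * (s * d) = s * (n * N) * d" by simp
      also have "\<dots> \<le> s * (1 + n * N) * (d + Off)"
        using s1 nN0 Off0 d0 by (intro mult_mono) auto
      finally show ?thesis .
    qed
    ultimately show ?thesis
      using upper by (simp add: K_def algebra_simps)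
  qed
  also have "\<dots> \<le> (n + 1/4) * (4 * K * (d + Off)) + K * (d + Off)"
    using mult_left_mono[OF m_le, of "n + 1/4"] n0 by (simp add: algebra_simps)
  also have "\<dots> = chen_constant DIM('v) q * (d + Off)"
    unfolding chen_constant_def Let_def K_def s_def N_def n_def by (simp add: algebra_simps)
  finally show "sff_norm r t \<le> chen_constant DIM('v) q * deficit q r t a b"
    using norm deficit by simp
qed

lemma sff_norm_0_imp:
  assumes E: "M.orthonormal E" "span E = UNIV"
    and 0: "(\<Sum>u\<in>E. \<Sum>v\<in>E. g' (h u v) (h u v)) \<le> 0"
  shows "h u v = 0"
proof -
  have fin: "finite E" by (rule M.orthonormal_finite[OF E(1)])
  have "(\<Sum>u\<in>E. \<Sum>v\<in>E. g' (h u v) (h u v)) = 0"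
    using 0 N.nonneg by (intro antisym sum_nonneg) auto
  then have "g' (h e e') (h e e') = 0" if "e \<in> E" "e' \<in> E" for e e'
    using that fin N.nonneg by (simp add: sum_nonneg_eq_0_iff sum_nonneg)
  then have *: "h e e' = 0" if "e \<in> E" "e' \<in> E" for e e'
    using that N.eq_0_iff by blast
  have "u = (\<Sum>e\<in>E. g u e *\<^sub>R e)" "v = (\<Sum>e\<in>E. g v e *\<^sub>R e)"
    using M.orthonormal_expansion[OF E(1)] E(2) by auto
  then have "h u v = h (\<Sum>e\<in>E. g u e *\<^sub>R e) (\<Sum>e\<in>E. g v e *\<^sub>R e)" by simp
  also have "\<dots> = 0"
    by (simp only: linear_sum[OF linear_h])
      (simp add: linear_sum[OF linear_h'] linear_scale[OF linear_h] linear_scale[OF linear_h'] *)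
  finally show ?thesis .
qed

end

section \<open>From manifolds to coordinates\<close>

lemma param_coord:
  assumes "is_chart \<phi>" "p \<in> chart_dom \<phi>" shows "param \<phi> (coord \<phi> p) = p"
  using assms homeomorphism_apply1 unfolding is_chart_def by blast

lemma coord_param:
  assumes "is_chart \<phi>" "x \<in> coord \<phi> ` chart_dom \<phi>"
  shows "coord \<phi> (param \<phi> x) = x" "param \<phi> x \<in> chart_dom \<phi>"
proof -
  have hom: "homeomorphism (chart_dom \<phi>) (coord \<phi> ` chart_dom \<phi>) (coord \<phi>) (param \<phi>)"
    using assms(1) by (simp add: is_chart_def)
  show "coord \<phi> (param \<phi> x) = x" using homeomorphism_apply2[OF hom assms(2)] .
  show "param \<phi> x \<in> chart_dom \<phi>" using homeomorphism_image2[OF hom] assms(2) by blast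
qed

lemma open_coord_image:
  assumes "is_chart \<phi>" "open V" shows "open (coord \<phi> ` (chart_dom \<phi> \<inter> V))"
proof -
  have hom: "homeomorphism (chart_dom \<phi>) (coord \<phi> ` chart_dom \<phi>) (coord \<phi>) (param \<phi>)"
    and op: "open (coord \<phi> ` chart_dom \<phi>)"
    using assms(1) by (auto simp: is_chart_def)
  have "openin (top_of_set (chart_dom \<phi>)) (chart_dom \<phi> \<inter> V)"
    using assms(2) by (rule openin_open_Int)
  from homeomorphism_imp_open_map[OF hom this] show ?thesis
    using op openin_open_trans by blast
qed

lemma local_map_id: "local_map \<phi> \<psi> id = coord \<psi> \<circ> param \<phi>"
  by (simp add: local_map_def)

lemma local_map_coord:
  "is_chart \<phi> \<Longrightarrow> p \<in> chart_dom \<phi> \<Longrightarrow> local_map \<phi> \<psi> f (coord \<phi> p) = coord \<psi> (f p)"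
  by (simp add: local_map_def param_coord)

text \<open>Setting one of the maps to \<open>id\<close> turns it into the rule for changing the
  chart of the source or of the target.\<close>

lemma dd_local_map_comp:
  assumes "is_chart \<phi>" "is_chart \<psi>" "continuous_on UNIV f" "p \<in> chart_dom \<phi>" "f p \<in> chart_dom \<psi>"
    and "local_map \<phi> \<psi> f differentiable (at (coord \<phi> p))"
    and "local_map \<psi> \<theta> k differentiable (at (coord \<psi> (f p)))"
  shows "dd (local_map \<phi> \<theta> (k \<circ> f)) (coord \<phi> p) u
    = dd (local_map \<psi> \<theta> k) (coord \<psi> (f p)) (dd (local_map \<phi> \<psi> f) (coord \<phi> p) u)"
proof -
  let ?U = "coord \<phi> ` (chart_dom \<phi> \<inter> f -` chart_dom \<psi>)"
  have "open (chart_dom \<psi>)" using assms(2) by (simp add: is_chart_def)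
  then have "open ?U"
    using assms(1,3) by (intro open_coord_image) (auto simp: continuous_on_open_vimage)
  moreover have "coord \<phi> p \<in> ?U" using assms(4,5) by blast
  moreover have "local_map \<phi> \<theta> (k \<circ> f) x = (local_map \<psi> \<theta> k \<circ> local_map \<phi> \<psi> f) x" if "x \<in> ?U" for x
    using that param_coord[OF assms(1)] param_coord[OF assms(2)] by (auto simp: local_map_def)
  ultimately have "dd (local_map \<phi> \<theta> (k \<circ> f)) (coord \<phi> p) = dd (local_map \<psi> \<theta> k \<circ> local_map \<phi> \<psi> f) (coord \<phi> p)"
    by (rule dd_cong_open)
  then show ?thesis
    using dd_chain[OF assms(6), of "local_map \<psi> \<theta> k" u] assms(7)
    unfolding local_map_coord[OF assms(1,4)] by simp
qed

section \<open>Charts and tangent vectors\<close>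

locale smooth_manifold =
  fixes A :: "('a::{t2_space,second_countable_topology}, 'e::euclidean_space) chart set"
  assumes atlas: "smooth_atlas A"
begin

lemma is_chart: "\<phi> \<in> charts_at A p \<Longrightarrow> is_chart \<phi>" "\<phi> \<in> A \<Longrightarrow> is_chart \<phi>"
  using atlas by (auto simp: smooth_atlas_def charts_at_def)

lemma in_dom: "\<phi> \<in> charts_at A p \<Longrightarrow> p \<in> chart_dom \<phi>"
  by (simp add: charts_at_def)

lemma chart_at: "chart_at A p \<in> charts_at A p"
proof -
  have "p \<in> (\<Union>\<phi>\<in>A. chart_dom \<phi>)" using atlas by (simp add: smooth_atlas_def)
  then show ?thesis
    unfolding chart_at_def by - (rule someI_ex, auto simp: charts_at_def)
qed

lemma chart_at_param:
  assumes "\<phi> \<in> A" "x \<in> coord \<phi> ` chart_dom \<phi>"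
  shows "\<phi> \<in> charts_at A (param \<phi> x)"
  using coord_param[OF is_chart(2)[OF assms(1)] assms(2)] assms(1) by (simp add: charts_at_def)

lemma transition_differentiable:
  assumes "\<phi> \<in> charts_at A p" "\<psi> \<in> charts_at A p"
  shows "local_map \<phi> \<psi> id differentiable (at (coord \<phi> p))"
  unfolding local_map_id
  using assms atlas
  by (intro smooth_on_differentiable[of "coord \<phi> ` (chart_dom \<phi> \<inter> chart_dom \<psi>)"])
    (auto simp: smooth_atlas_def charts_at_def)

lemma transition_self:
  assumes "\<phi> \<in> charts_at A p" shows "dd (local_map \<phi> \<phi> id) (coord \<phi> p) u = u"
proof -
  have "open (coord \<phi> ` chart_dom \<phi>)"
    using is_chart(1)[OF assms] by (simp add: is_chart_def)
  then have "dd (local_map \<phi> \<phi> id) (coord \<phi> p) = dd (\<lambda>y. y) (coord \<phi> p)"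
    using in_dom[OF assms] coord_param[OF is_chart(1)[OF assms]]
    by (intro dd_cong_open[of "coord \<phi> ` chart_dom \<phi>"]) (auto simp: local_map_def)
  then show ?thesis by simp
qed

lemma transition_comp:
  assumes "\<phi> \<in> charts_at A p" "\<psi> \<in> charts_at A p" "\<theta> \<in> charts_at A p"
  shows "dd (local_map \<psi> \<theta> id) (coord \<psi> p) (dd (local_map \<phi> \<psi> id) (coord \<phi> p) u)
    = dd (local_map \<phi> \<theta> id) (coord \<phi> p) u"
proof -
  have "continuous_on UNIV (id :: 'a \<Rightarrow> 'a)" by (simp add: id_def)
  from dd_local_map_comp[OF is_chart(1)[OF assms(1)] is_chart(1)[OF assms(2)] this, of p \<theta> id u]
  show ?thesis
    using in_dom[OF assms(1)] in_dom[OF assms(2)] transition_differentiable[OF assms(1,2)]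
      transition_differentiable[OF assms(2,3)]
    by simp
qed

lemma of_coord_apply:
  "\<psi> \<in> charts_at A p \<Longrightarrow> of_coord A \<phi> p u \<psi> = dd (local_map \<phi> \<psi> id) (coord \<phi> p) u"
  by (simp add: of_coord_def local_map_id)

lemma of_coord_tangent:
  assumes "\<phi> \<in> charts_at A p" shows "of_coord A \<phi> p u \<in> tangent_space A p"
  unfolding tangent_space_def local_map_id[symmetric]
proof (intro CollectI conjI allI ballI impI)
  show "of_coord A \<phi> p u \<psi> = 0" if "\<psi> \<notin> charts_at A p" for \<psi>
    using that by (simp add: of_coord_def)
  show "of_coord A \<phi> p u \<theta> = dd (local_map \<psi> \<theta> id) (coord \<psi> p) (of_coord A \<phi> p u \<psi>)"
    if "\<psi> \<in> charts_at A p" "\<theta> \<in> charts_at A p" for \<psi> \<theta>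
    using transition_comp[OF assms that] by (simp add: of_coord_apply that)
qed

lemma of_coord_self [simp]: "\<phi> \<in> charts_at A p \<Longrightarrow> of_coord A \<phi> p u \<phi> = u"
  by (simp add: of_coord_apply transition_self)

lemma of_coord_coord:
  assumes "\<phi> \<in> charts_at A p" "X \<in> tangent_space A p" shows "of_coord A \<phi> p (X \<phi>) = X"
proof (rule ext)
  fix \<psi>
  have "\<psi> \<notin> charts_at A p \<Longrightarrow> X \<psi> = 0"
    and "\<psi> \<in> charts_at A p \<Longrightarrow>
      X \<psi> = frechet_derivative (coord \<psi> \<circ> param \<phi>) (at (coord \<phi> p)) (X \<phi>)"
    using assms unfolding tangent_space_def by blast+
  then show "of_coord A \<phi> p (X \<phi>) \<psi> = X \<psi>" by (simp add: of_coord_def)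
qed

lemma linear_of_coord: assumes \<phi>: "\<phi> \<in> charts_at A p" shows "linear (of_coord A \<phi> p)"
proof (rule linearI)
  note L = dd_linear[OF transition_differentiable[OF \<phi>]]
  show "of_coord A \<phi> p (u + v) = of_coord A \<phi> p u + of_coord A \<phi> p v" for u v
  proof (rule ext)
    fix \<psi>
    show "of_coord A \<phi> p (u + v) \<psi> = (of_coord A \<phi> p u + of_coord A \<phi> p v) \<psi>"
      using linear_add[OF L, of \<psi> u v]
      by (cases "\<psi> \<in> charts_at A p") (simp_all add: of_coord_apply, simp add: of_coord_def)
  qed
  show "of_coord A \<phi> p (r *\<^sub>R u) = r *\<^sub>R of_coord A \<phi> p u" for r u
  proof (rule ext)
    fix \<psi>
    show "of_coord A \<phi> p (r *\<^sub>R u) \<psi> = (r *\<^sub>R of_coord A \<phi> p u) \<psi>"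
      using linear_scale[OF L, of \<psi> r u]
      by (cases "\<psi> \<in> charts_at A p") (simp_all add: of_coord_apply scaleR_fun_def, simp add: of_coord_def)
  qed
qed

lemma tangent_eqI:
  assumes "\<phi> \<in> charts_at A p" "X \<in> tangent_space A p" "Y \<in> tangent_space A p" "X \<phi> = Y \<phi>"
  shows "X = Y"
  by (rule trans[OF of_coord_coord[OF assms(1,2), symmetric]]) (simp only: assms(4) of_coord_coord[OF assms(1,3)])

lemma tangent_space_range:
  assumes "\<phi> \<in> charts_at A p" shows "tangent_space A p = range (of_coord A \<phi> p)"
proof (intro subset_antisym subsetI)
  fix X assume "X \<in> tangent_space A p"
  from of_coord_coord[OF assms this] show "X \<in> range (of_coord A \<phi> p)" by (rule range_eqI[OF sym])
next
  fix X assume "X \<in> range (of_coord A \<phi> p)"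
  then show "X \<in> tangent_space A p" using of_coord_tangent[OF assms] by blast
qed

lemma inj_of_coord: "\<phi> \<in> charts_at A p \<Longrightarrow> inj (of_coord A \<phi> p)"
  by (rule inj_on_inverseI[where g = "\<lambda>X. X \<phi>"]) (rule of_coord_self)

lemma subspace_tangent: "subspace (tangent_space A p)"
  unfolding tangent_space_range[OF chart_at[of p]]
  by (rule linear_subspace_image[OF linear_of_coord[OF chart_at] subspace_UNIV])

lemma linear_eval: "linear (\<lambda>X::('a, 'e) tvec. X \<phi>)"
  by (rule linearI) (simp_all add: scaleR_fun_def)

lemma eval_span: "(\<lambda>X. X \<phi>) ` span E = span ((\<lambda>X::('a, 'e) tvec. X \<phi>) ` E)"
  using linear_span_image[OF linear_eval[of \<phi>], of E] by simp

lemma inj_on_eval: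
  assumes "\<phi> \<in> charts_at A p" "E \<subseteq> tangent_space A p" shows "inj_on (\<lambda>X. X \<phi>) E"
proof (rule inj_onI)
  fix X Y assume "X \<in> E" "Y \<in> E" and eq: "X \<phi> = Y \<phi>"
  then have "X \<in> tangent_space A p" "Y \<in> tangent_space A p" using assms(2) by auto
  from tangent_eqI[OF assms(1) this eq] show "X = Y" .
qed

text \<open>Evaluation in a chart is injective only on tangent vectors, so the dimension is compared
  through its inverse \<open>of_coord\<close>, which is linear and injective on the whole model
  space.\<close>

lemma dim_eval:
  assumes "\<phi> \<in> charts_at A p" "\<pi> \<subseteq> tangent_space A p"
  shows "dim ((\<lambda>X. X \<phi>) ` \<pi>) = dim \<pi>"
proof -
  have "(\<lambda>X. of_coord A \<phi> p (X \<phi>)) ` \<pi> = (\<lambda>X. X) ` \<pi>"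
    by (rule image_cong[OF refl], rule of_coord_coord[OF assms(1)]) (use assms(2) in blast)
  then have eq: "of_coord A \<phi> p ` ((\<lambda>X. X \<phi>) ` \<pi>) = \<pi>"
    unfolding image_image by simp
  have "dim (of_coord A \<phi> p ` ((\<lambda>X. X \<phi>) ` \<pi>)) = dim ((\<lambda>X. X \<phi>) ` \<pi>)"
    by (rule dim_image_eq[OF linear_of_coord[OF assms(1)] inj_on_subset[OF inj_of_coord[OF assms(1)]]]) simp
  then show ?thesis unfolding eq by simp
qed

end

section \<open>Curvature invariants at a point, in one chart\<close>

locale riemannian = smooth_manifold A
  for A :: "('a::{t2_space,second_countable_topology}, 'e::euclidean_space) chart set" +
  fixes g :: "('a, 'e) metric"
  assumes riemannian: "riemannian_manifold A g"
begin

lemma metric_sym: "X \<in> tangent_space A p \<Longrightarrow> Y \<in> tangent_space A p \<Longrightarrow> g p X Y = g p Y X"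
  using riemannian unfolding riemannian_manifold_def by blast

lemma metric_linear: "X \<in> tangent_space A p \<Longrightarrow> Y \<in> tangent_space A p \<Longrightarrow> Z \<in> tangent_space A p
    \<Longrightarrow> g p (r *\<^sub>R X + Y) Z = r * g p X Z + g p Y Z"
  using riemannian unfolding riemannian_manifold_def by blast

lemma metric_pos: "X \<in> tangent_space A p \<Longrightarrow> X \<noteq> 0 \<Longrightarrow> g p X X > 0"
  using riemannian unfolding riemannian_manifold_def by blast

lemma metric_coord:
  assumes "\<phi> \<in> charts_at A p" "X \<in> tangent_space A p" "Y \<in> tangent_space A p"
  shows "g p X Y = local_metric A g \<phi> (coord \<phi> p) (X \<phi>) (Y \<phi>)"
  unfolding local_metric_def param_coord[OF is_chart(1)[OF assms(1)] in_dom[OF assms(1)]]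
    of_coord_coord[OF assms(1,2)] of_coord_coord[OF assms(1,3)] ..

lemma local_riemannian:
  assumes "\<phi> \<in> A"
  shows "local_riemannian (coord \<phi> ` chart_dom \<phi>) (local_metric A g \<phi>)"
proof (rule local_riemannian.intro)
  show "open (coord \<phi> ` chart_dom \<phi>)"
    using is_chart(2)[OF assms] by (simp add: is_chart_def)
  show "smooth_on (coord \<phi> ` chart_dom \<phi>) (\<lambda>x. local_metric A g \<phi> x u v)" for u v
    using riemannian assms unfolding riemannian_manifold_def by blast
  fix x assume "x \<in> coord \<phi> ` chart_dom \<phi>"
  then have \<phi>: "\<phi> \<in> charts_at A (param \<phi> x)" by (rule chart_at_param[OF assms])
  note T = of_coord_tangent[OF \<phi>]
  show "local_metric A g \<phi> x u v = local_metric A g \<phi> x v u" for u v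
    unfolding local_metric_def by (rule metric_sym[OF T T])
  show "linear (\<lambda>u. local_metric A g \<phi> x u v)" for v
  proof (rule linearI)
    show "local_metric A g \<phi> x (a + b) v = local_metric A g \<phi> x a v + local_metric A g \<phi> x b v" for a b
      using metric_linear[OF T T T, of 1 a b v]
      by (simp add: local_metric_def linear_add[OF linear_of_coord[OF \<phi>]])
    show "local_metric A g \<phi> x (r *\<^sub>R a) v = r *\<^sub>R local_metric A g \<phi> x a v" for r a
      using metric_linear[OF T T T, of r a 0 v] metric_linear[OF T T T, of 1 0 0 v]
      by (simp add: local_metric_def linear_scale[OF linear_of_coord[OF \<phi>]] linear_0[OF linear_of_coord[OF \<phi>]])
  qed
  show "local_metric A g \<phi> x u u > 0" if "u \<noteq> 0" for u
    unfolding local_metric_def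
    using inj_of_coord[OF \<phi>] linear_0[OF linear_of_coord[OF \<phi>]] that
    by (intro metric_pos T) (metis injD)
qed

text \<open>The chosen chart identifies the tangent space at \<open>p\<close> with the model space,
  so that the algebra at every point takes place in one Euclidean type.\<close>

definition G :: "'a \<Rightarrow> 'e \<Rightarrow> 'e \<Rightarrow> real"
  where "G p = local_metric A g (chart_at A p) (coord (chart_at A p) p)"

definition Rm :: "'a \<Rightarrow> 'e \<Rightarrow> 'e \<Rightarrow> 'e \<Rightarrow> 'e \<Rightarrow> real"
  where "Rm p u v w z =
    G p (local_curvature (local_metric A g (chart_at A p)) (coord (chart_at A p) p) u v w) z"

abbreviation ev :: "'a \<Rightarrow> ('a, 'e) tvec \<Rightarrow> 'e"
  where "ev p X \<equiv> X (chart_at A p)"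

abbreviation lift :: "'a \<Rightarrow> 'e \<Rightarrow> ('a, 'e) tvec"
  where "lift p \<equiv> of_coord A (chart_at A p) p"

lemma chart_at_A: "chart_at A p \<in> A"
  using chart_at by (simp add: charts_at_def)

lemma coord_in: "coord (chart_at A p) p \<in> coord (chart_at A p) ` chart_dom (chart_at A p)"
  using in_dom[OF chart_at] by blast

lemma metric_ev: "X \<in> tangent_space A p \<Longrightarrow> Y \<in> tangent_space A p \<Longrightarrow> g p X Y = G p (ev p X) (ev p Y)"
  unfolding G_def by (rule metric_coord[OF chart_at])

lemma curvature_tensor_ev: "curvature_tensor A g p X Y Z W = Rm p (ev p X) (ev p Y) (ev p Z) (ev p W)"
  by (simp add: curvature_tensor_def Rm_def G_def Let_def)

lemma curvature_form: "curvature_form (G p) (Rm p)"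
proof -
  interpret L: local_riemannian "coord (chart_at A p) ` chart_dom (chart_at A p)" "local_metric A g (chart_at A p)"
    by (rule local_riemannian[OF chart_at_A])
  note x = coord_in[of p]
  show ?thesis
  proof (intro curvature_form.intro inner_form.intro curvature_form_axioms.intro)
    show "G p u v = G p v u" for u v unfolding G_def by (rule L.sym[OF x])
    show "linear (\<lambda>u. G p u v)" for v unfolding G_def by (rule L.linear_left[OF x])
    show "G p u u > 0" if "u \<noteq> 0" for u unfolding G_def by (rule L.pos[OF x that])
    note l = linear_compose[OF _ L.linear_left[OF x], unfolded o_def]
    show "linear (\<lambda>u. Rm p u v w z)" "linear (\<lambda>v. Rm p u v w z)" "linear (\<lambda>w. Rm p u v w z)" for u v w z
      unfolding Rm_def G_def by (intro l L.linear_curvature[OF x])+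
    show "linear (\<lambda>z. Rm p u v w z)" for u v w
      unfolding Rm_def G_def by (rule L.linear_right[OF x])
    show "Rm p u v w z = - Rm p v u w z" for u v w z
      unfolding Rm_def G_def L.curvature_antisym[of _ u v w] by (rule linear_neg[OF L.linear_left[OF x]])
    show "Rm p u v w w = 0" for u v w
      unfolding Rm_def G_def by (rule L.curvature_skew[OF x])
    show "Rm p u v w z + Rm p v w u z + Rm p w u v z = 0" for u v w z
      unfolding Rm_def G_def linear_add[OF L.linear_left[OF x], symmetric] L.bianchi[OF x, of u v w]
      by (rule linear_0[OF L.linear_left[OF x]])
  qed
qed

sublocale C: curvature_form "G p" "Rm p" for p
  by (rule curvature_form)

lemma lift_tangent: "lift p u \<in> tangent_space A p"
  by (rule of_coord_tangent[OF chart_at])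

lemma ev_lift: "ev p (lift p u) = u"
  by (rule of_coord_self[OF chart_at])

lemma lift_ev: "X \<in> tangent_space A p \<Longrightarrow> lift p (ev p X) = X"
  by (rule of_coord_coord[OF chart_at])

lemma plane_section_orthonormal:
  assumes "plane_section A p \<pi>"
  shows "\<exists>u v. u \<noteq> v \<and> C.orthonormal p {u, v} \<and> ev p ` \<pi> = span {u, v}"
proof -
  have "subspace (ev p ` \<pi>)" "dim (ev p ` \<pi>) = 2"
    using assms linear_subspace_image[OF linear_eval] dim_eval[OF chart_at]
    by (auto simp: plane_section_def)
  from C.orthonormal_pair_span[OF this] show ?thesis by metis
qed

lemma plane_section_span:
  assumes "u \<noteq> v" "C.orthonormal p {u, v}"
  shows "plane_section A p (span {lift p u, lift p v})"
    "ev p ` span {lift p u, lift p v} = span {u, v}"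
proof -
  show 1: "ev p ` span {lift p u, lift p v} = span {u, v}"
    unfolding eval_span by (simp add: ev_lift)
  have 2: "span {lift p u, lift p v} \<subseteq> tangent_space A p"
    using lift_tangent by (intro span_minimal subspace_tangent) auto
  have "dim (span {u, v}) = 2"
    using dim_eq_card_independent[OF C.orthonormal_independent[OF assms(2)]] assms(1) by simp
  then show "plane_section A p (span {lift p u, lift p v})"
    using dim_eval[OF chart_at 2] 1 2 by (simp add: plane_section_def)
qed

text \<open>By \<open>C.rotate\<close> all orthonormal pairs of the plane give the same value, and
  the pair \<open>u\<close>, \<open>v\<close> shows that there is one; so the description has
  exactly one solution.\<close>

lemma sectional_curvature_eq:
  assumes \<pi>: "plane_section A p \<pi>" and uv: "u \<noteq> v" "C.orthonormal p {u, v}" "ev p ` \<pi> = span {u, v}"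
  shows "sectional_curvature A g p \<pi> = Rm p u v v u"
  unfolding sectional_curvature_def
proof (rule the_equality)
  have \<pi>T: "\<pi> \<subseteq> tangent_space A p" using \<pi> by (simp add: plane_section_def)
  show "\<forall>X\<in>\<pi>. \<forall>Y\<in>\<pi>. g p X X = 1 \<and> g p Y Y = 1 \<and> g p X Y = 0 \<longrightarrow> Rm p u v v u = curvature_tensor A g p X Y Y X"
  proof (intro ballI impI)
    fix X Y assume XY: "X \<in> \<pi>" "Y \<in> \<pi>" and on: "g p X X = 1 \<and> g p Y Y = 1 \<and> g p X Y = 0"
    have T: "X \<in> tangent_space A p" "Y \<in> tangent_space A p" using XY \<pi>T by auto
    have o: "G p (ev p X) (ev p X) = 1" "G p (ev p Y) (ev p Y) = 1" "G p (ev p X) (ev p Y) = 0"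
      using on metric_ev T by auto
    then have ne: "ev p X \<noteq> ev p Y" by auto
    have "C.orthonormal p {ev p X, ev p Y}"
      using o C.sym[of p "ev p Y" "ev p X"] ne by (auto simp: C.orthonormal_def)
    then show "Rm p u v v u = curvature_tensor A g p X Y Y X"
      unfolding curvature_tensor_ev using XY uv ne by (intro C.rotate[symmetric]) auto
  qed
  fix k assume k: "\<forall>X\<in>\<pi>. \<forall>Y\<in>\<pi>. g p X X = 1 \<and> g p Y Y = 1 \<and> g p X Y = 0 \<longrightarrow> k = curvature_tensor A g p X Y Y X"
  have "u \<in> ev p ` \<pi>" "v \<in> ev p ` \<pi>" using uv(3) span_base[of _ "{u, v}"] by auto
  then obtain X Y where XY: "X \<in> \<pi>" "u = ev p X" "Y \<in> \<pi>" "v = ev p Y" by blast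
  have "g p X X = 1 \<and> g p Y Y = 1 \<and> g p X Y = 0"
    using uv(1,2) XY metric_ev \<pi>T by (auto simp: C.orthonormal_def subset_iff)
  then show "k = Rm p u v v u"
    using k XY by (simp add: curvature_tensor_ev)
qed

lemma sectional_curvature_span:
  assumes "u \<noteq> v" "C.orthonormal p {u, v}"
  shows "sectional_curvature A g p (span {lift p u, lift p v}) = Rm p u v v u"
  using sectional_curvature_eq[OF plane_section_span(1)[OF assms] assms plane_section_span(2)[OF assms]] .

lemma orthonormal_basis_ev:
  assumes "orthonormal_basis A g p E"
  shows "C.orthonormal p (ev p ` E)" "span (ev p ` E) = UNIV" "inj_on (ev p) E" "E \<subseteq> tangent_space A p"
proof -
  show T: "E \<subseteq> tangent_space A p" using assms span_superset by (auto simp: orthonormal_basis_def)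
  show inj: "inj_on (ev p) E" by (rule inj_on_eval[OF chart_at T])
  have "u \<in> ev p ` tangent_space A p" for u
    by (rule image_eqI[OF _ lift_tangent[of p u]]) (simp add: ev_lift)
  then have "UNIV = ev p ` tangent_space A p" by blast
  then show "span (ev p ` E) = UNIV"
    using assms by (simp add: orthonormal_basis_def eval_span[symmetric])
  show "C.orthonormal p (ev p ` E)"
    unfolding C.orthonormal_def
  proof (intro ballI, elim imageE)
    fix u v X Y assume "u = ev p X" "X \<in> E" "v = ev p Y" "Y \<in> E"
    then show "G p u v = (if u = v then 1 else 0)"
      using assms metric_ev[of X p Y] subsetD[OF T] inj_on_eq_iff[OF inj]
      by (simp add: orthonormal_basis_def)
  qed
qed

lemma orthonormal_basis_lift:
  assumes "C.orthonormal p E" "span E = UNIV"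
  shows "orthonormal_basis A g p (lift p ` E)"
proof -
  have "span (lift p ` E) = tangent_space A p"
    using linear_span_image[OF linear_of_coord[OF chart_at[of p]], of E] assms(2)
      tangent_space_range[OF chart_at[of p]]
    by simp
  moreover have "g p (lift p u) (lift p v) = (if lift p u = lift p v then 1 else 0)" if "u \<in> E" "v \<in> E" for u v
    using assms(1) that metric_ev[OF lift_tangent[of p u] lift_tangent[of p v]] ev_lift injD[OF inj_of_coord[OF chart_at]]
    by (auto simp: C.orthonormal_def)
  ultimately show ?thesis
    using C.orthonormal_finite[OF assms(1)] by (auto simp: orthonormal_basis_def)
qed

lemma orthonormal_exists:
  assumes "C.orthonormal p E" shows "\<exists>E'. E \<subseteq> E' \<and> C.orthonormal p E' \<and> span E' = UNIV"
  using C.orthonormal_extend[OF subspace_UNIV assms] by blast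

text \<open>Adding the term v = u, which is 0, makes the sum the trace of a bilinear form, hence
  independent of the basis. The lifted basis \<open>E\<close> then pins down the value.\<close>

lemma Ric_eq:
  assumes E: "C.orthonormal p E" "span E = UNIV" "u \<in> E"
  shows "Ric A g p (lift p u) = (\<Sum>v\<in>E - {u}. Rm p u v v u)"
  unfolding Ric_def
proof (rule the_equality)
  have full: "(\<Sum>v\<in>E - {u}. Rm p u v v u) = (\<Sum>v\<in>E. Rm p u v v u)" if "finite E" "u \<in> E" for E
    using that by (simp add: sum_diff1 C.skew12)
  show *: "\<forall>E'. orthonormal_basis A g p E' \<and> lift p u \<in> E' \<longrightarrow>
     (\<Sum>v\<in>E - {u}. Rm p u v v u) = (\<Sum>Y\<in>E' - {lift p u}. sectional_curvature A g p (span {lift p u, Y}))"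
  proof (intro allI impI, elim conjE)
    fix E' assume E': "orthonormal_basis A g p E'" "lift p u \<in> E'"
    note ev = orthonormal_basis_ev[OF E'(1)]
    have u: "u \<in> ev p ` E'" by (rule image_eqI[OF _ E'(2)]) (simp add: ev_lift)
    have "sectional_curvature A g p (span {lift p u, Y}) = Rm p u (ev p Y) (ev p Y) u" if "Y \<in> E' - {lift p u}" for Y
    proof -
      have Y: "lift p (ev p Y) = Y" using that ev(4) lift_ev by blast
      have ne: "u \<noteq> ev p Y" using Y that by auto
      have "C.orthonormal p {u, ev p Y}" using ev(1) u that unfolding C.orthonormal_def by auto
      from sectional_curvature_span[OF ne this] show ?thesis by (simp add: Y)
    qed
    then have "(\<Sum>Y\<in>E' - {lift p u}. sectional_curvature A g p (span {lift p u, Y}))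
        = (\<Sum>Y\<in>E' - {lift p u}. Rm p u (ev p Y) (ev p Y) u)" by simp
    also have "\<dots> = (\<Sum>v\<in>ev p ` (E' - {lift p u}). Rm p u v v u)"
      by (subst sum.reindex) (use ev(3) in \<open>auto simp: inj_on_diff\<close>)
    also have "ev p ` (E' - {lift p u}) = ev p ` E' - {u}"
      using inj_on_image_set_diff[OF ev(3), of E' "{lift p u}"] E'(2) ev_lift by simp
    also have "(\<Sum>v\<in>ev p ` E' - {u}. Rm p u v v u) = (\<Sum>v\<in>ev p ` E'. Rm p u v v u)"
      using full u C.orthonormal_finite[OF ev(1)] by blast
    also have "\<dots> = (\<Sum>v\<in>E. Rm p u v v u)"
      by (rule C.trace_independent[OF C.linear2 C.linear3 ev(1) E(1)]) (simp add: ev(2) E(2))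
    finally show "(\<Sum>v\<in>E - {u}. Rm p u v v u) = (\<Sum>Y\<in>E' - {lift p u}. sectional_curvature A g p (span {lift p u, Y}))"
      using full E(3) C.orthonormal_finite[OF E(1)] by simp
  qed
  fix r assume r: "\<forall>E'. orthonormal_basis A g p E' \<and> lift p u \<in> E' \<longrightarrow>
     r = (\<Sum>Y\<in>E' - {lift p u}. sectional_curvature A g p (span {lift p u, Y}))"
  have "orthonormal_basis A g p (lift p ` E) \<and> lift p u \<in> lift p ` E"
    using orthonormal_basis_lift[OF E(1,2)] E(3) by blast
  then show "r = (\<Sum>v\<in>E - {u}. Rm p u v v u)"
    using r[rule_format] *[rule_format] by simp
qed

end

section \<open>Submanifolds of complex space forms\<close>

context riemannian
begin

lemma orthogonal_planes_frame:
  assumes "orthogonal_planes A g p q \<pi>"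
  shows "\<exists>a b Z. C.frame p q a b Z \<and>
    (\<Sum>i=1..q. sectional_curvature A g p (\<pi> i)) = (\<Sum>i=1..q. Rm p (a i) (b i) (b i) (a i))"
proof -
  have plane: "plane_section A p (\<pi> i)" if "i \<in> {1..q}" for i
    using assms that by (simp add: orthogonal_planes_def)
  have "\<forall>i\<in>{1..q}. \<exists>w. fst w \<noteq> snd w \<and> C.orthonormal p {fst w, snd w} \<and> ev p ` \<pi> i = span {fst w, snd w}"
    using plane_section_orthonormal[OF plane] by simp
  then obtain w where w: "\<And>i. i \<in> {1..q} \<Longrightarrow> fst (w i) \<noteq> snd (w i)"
    "\<And>i. i \<in> {1..q} \<Longrightarrow> C.orthonormal p {fst (w i), snd (w i)}"
    "\<And>i. i \<in> {1..q} \<Longrightarrow> ev p ` \<pi> i = span {fst (w i), snd (w i)}"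
    unfolding bchoice_iff by blast
  define a b where "a i = fst (w i)" and "b i = snd (w i)" for i
  note ab = w[folded a_def b_def]
  have mem: "a i \<in> ev p ` \<pi> i" "b i \<in> ev p ` \<pi> i" if "i \<in> {1..q}" for i
    unfolding ab(3)[OF that] by (auto intro: span_base)
  have orth: "G p u v = 0" if ij: "i \<in> {1..q}" "j \<in> {1..q}" "i \<noteq> j"
    and uv: "u \<in> ev p ` \<pi> i" "v \<in> ev p ` \<pi> j" for i j u v
  proof -
    obtain X Y where XY: "X \<in> \<pi> i" "u = ev p X" "Y \<in> \<pi> j" "v = ev p Y" using uv by blast
    have "X \<in> tangent_space A p" "Y \<in> tangent_space A p"
      using XY plane[OF ij(1)] plane[OF ij(2)] by (auto simp: plane_section_def)
    from metric_ev[OF this] show ?thesis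
      using assms ij XY by (simp add: orthogonal_planes_def)
  qed
  have one: "G p (a i) (a i) = 1" "G p (b i) (b i) = 1" "G p (a i) (b i) = 0" if "i \<in> {1..q}" for i
    using ab(1,2)[OF that] by (auto simp: C.orthonormal_def)
  have "\<exists>Z. C.frame p q a b Z"
  proof (rule C.frame_exists)
    fix i j assume ij: "i \<in> {1..q}" "j \<in> {1..q}"
    show "G p (a i) (a j) = (if i = j then 1 else 0)"
      using one[OF ij(1)] orth[OF ij _ mem(1)[OF ij(1)] mem(1)[OF ij(2)]] by (cases "i = j") simp_all
    show "G p (b i) (b j) = (if i = j then 1 else 0)"
      using one[OF ij(1)] orth[OF ij _ mem(2)[OF ij(1)] mem(2)[OF ij(2)]] by (cases "i = j") simp_all
    show "G p (a i) (b j) = 0"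
      using one[OF ij(1)] orth[OF ij _ mem(1)[OF ij(1)] mem(2)[OF ij(2)]] by (cases "i = j") simp_all
  qed
  moreover have "(\<Sum>i=1..q. sectional_curvature A g p (\<pi> i)) = (\<Sum>i=1..q. Rm p (a i) (b i) (b i) (a i))"
    by (intro sum.cong refl sectional_curvature_eq plane ab)
  ultimately show ?thesis by blast
qed

text \<open>Ensures that \<open>K_inf\<close> is an infimum over a nonempty set. Consecutive vectors
  of an orthonormal basis are paired up.\<close>

lemma orthogonal_planes_exist:
  assumes "2 * q \<le> DIM('e)" shows "\<exists>\<pi>. orthogonal_planes A g p q \<pi>"
proof -
  obtain E where E: "C.orthonormal p E" "span E = UNIV"
    using orthonormal_exists[of p "{}"] by (auto simp: C.orthonormal_def)
  obtain e where e: "bij_betw e {0..<DIM('e)} E"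
    using ex_bij_betw_nat_finite[OF C.orthonormal_finite[OF E(1)]] C.orthonormal_basis_card[OF E] by auto
  have ge: "G p (e i) (e j) = (if i = j then 1 else 0)" if "i < DIM('e)" "j < DIM('e)" for i j
    using E(1) e that unfolding C.orthonormal_def bij_betw_def by (auto simp: inj_on_eq_iff)
  \<comment> \<open>The basis is numbered from 0 and the planes from 1, so plane \<open>i\<close>
    takes the entries 2 i - 2 and 2 i - 1.\<close>
  define u v where "u i = e (2 * i - 2)" and "v i = e (2 * i - 1)" for i :: nat
  have gi: "G p (u i) (u j) = (if i = j then 1 else 0)" "G p (v i) (v j) = (if i = j then 1 else 0)"
    "G p (u i) (v j) = 0" "G p (v i) (u j) = 0" if "i \<in> {1..q}" "j \<in> {1..q}" for i j
  proof -
    have "2 * i - 2 < DIM('e)" "2 * i - 1 < DIM('e)" "2 * j - 2 < DIM('e)" "2 * j - 1 < DIM('e)"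
      using that assms by auto
    moreover have "2 * i - 2 = 2 * j - 2 \<longleftrightarrow> i = j" "2 * i - 1 = 2 * j - 1 \<longleftrightarrow> i = j"
      "2 * i - 2 \<noteq> 2 * j - 1" "2 * i - 1 \<noteq> 2 * j - 2"
      using that by (auto; presburger)+
    ultimately show "G p (u i) (u j) = (if i = j then 1 else 0)" "G p (v i) (v j) = (if i = j then 1 else 0)"
      "G p (u i) (v j) = 0" "G p (v i) (u j) = 0"
      unfolding u_def v_def by (simp_all add: ge)
  qed
  have uv: "u i \<noteq> v i" "C.orthonormal p {u i, v i}" if "i \<in> {1..q}" for i
    using gi[OF that that] by (auto simp: C.orthonormal_def)
  have "orthogonal_planes A g p q (\<lambda>i. span {lift p (u i), lift p (v i)})"
    unfolding orthogonal_planes_def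
  proof (intro conjI ballI impI)
    show "plane_section A p (span {lift p (u i), lift p (v i)})" if "i \<in> {1..q}" for i
      by (rule plane_section_span(1)[OF uv[OF that]])
    fix i j X Y assume ij: "i \<in> {1..q}" "j \<in> {1..q}" "i \<noteq> j"
      and X: "X \<in> span {lift p (u i), lift p (v i)}" and Y: "Y \<in> span {lift p (u j), lift p (v j)}"
    have T: "X \<in> tangent_space A p" "Y \<in> tangent_space A p"
      using X Y plane_section_span(1)[OF uv[OF ij(1)]] plane_section_span(1)[OF uv[OF ij(2)]]
      by (auto simp: plane_section_def)
    have "ev p X \<in> span {u i, v i}" "ev p Y \<in> span {u j, v j}"
      using plane_section_span(2)[OF uv[OF ij(1)]] plane_section_span(2)[OF uv[OF ij(2)]] X Y by blast+
    from C.orthonormal_expansion[OF uv(2)[OF ij(1)] this(1)] C.orthonormal_expansion[OF uv(2)[OF ij(2)] this(2)]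
    obtain r s r' s' where "ev p X = r *\<^sub>R u i + s *\<^sub>R v i" "ev p Y = r' *\<^sub>R u j + s' *\<^sub>R v j"
      using uv(1)[OF ij(1)] uv(1)[OF ij(2)] by auto
    then have "G p (ev p X) (ev p Y) = 0"
      using gi[OF ij(1,2)] ij(3) by (simp add: C.add_left C.add_right C.scale_left C.scale_right)
    then show "g p X Y = 0" using metric_ev[OF T] by simp
  qed
  then show ?thesis by blast
qed

end

section \<open>Complex space forms at a point\<close>

locale complex_space_form_manifold = riemannian B g'
  for B :: "('b::{t2_space,second_countable_topology}, 'f::euclidean_space) chart set" and g' +
  fixes J :: "('b, 'f) endo_field" and c :: real
  assumes space_form: "complex_space_form B g' J (4 * c)"
begin

lemma J_tangent: "X \<in> tangent_space B y \<Longrightarrow> J y X \<in> tangent_space B y"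
  and J_J: "X \<in> tangent_space B y \<Longrightarrow> J y (J y X) = - X"
  and J_linear: "X \<in> tangent_space B y \<Longrightarrow> Y \<in> tangent_space B y \<Longrightarrow> J y (r *\<^sub>R X + Y) = r *\<^sub>R J y X + J y Y"
  and J_isometry: "X \<in> tangent_space B y \<Longrightarrow> Y \<in> tangent_space B y \<Longrightarrow> g' y (J y X) (J y Y) = g' y X Y"
  and J_smooth: "\<phi> \<in> B \<Longrightarrow> smooth_on (coord \<phi> ` chart_dom \<phi>) (\<lambda>x. local_endo B J \<phi> x u)"
  and J_parallel: "\<phi> \<in> B \<Longrightarrow> x \<in> coord \<phi> ` chart_dom \<phi> \<Longrightarrow>
       cov_deriv (local_metric B g' \<phi>) (\<lambda>y. local_endo B J \<phi> y v) x w =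
       local_endo B J \<phi> x (cov_deriv (local_metric B g' \<phi>) (\<lambda>_. v) x w)"
  and J_holomorphic: "X \<in> tangent_space B y \<Longrightarrow> X \<noteq> 0 \<Longrightarrow> sectional_curvature B g' y (span {X, J y X}) = 4 * c"
  using space_form
  unfolding complex_space_form_def kaehler_manifold_def almost_complex_structure_def by blast+

definition j :: "'b \<Rightarrow> 'f \<Rightarrow> 'f"
  where "j y v = ev y (J y (lift y v))"

lemma lift_j: "lift y (j y v) = J y (lift y v)"
  unfolding j_def by (rule lift_ev[OF J_tangent[OF lift_tangent]])

lemma linear_local_endo:
  assumes "\<phi> \<in> B" "x \<in> coord \<phi> ` chart_dom \<phi>" shows "linear (local_endo B J \<phi> x)"
proof -
  have \<phi>: "\<phi> \<in> charts_at B (param \<phi> x)" by (rule chart_at_param[OF assms])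
  note T = of_coord_tangent[OF \<phi>] and L = linear_of_coord[OF \<phi>]
  have z: "J (param \<phi> x) (of_coord B \<phi> (param \<phi> x) 0) = 0"
    using J_linear[OF T T, of 1 0 0] by (simp add: linear_0[OF L])
  show ?thesis
  proof (rule linearI)
    show "local_endo B J \<phi> x (a + b) = local_endo B J \<phi> x a + local_endo B J \<phi> x b" for a b
      using J_linear[OF T T, of 1 a b] by (simp add: local_endo_def linear_add[OF L])
    show "local_endo B J \<phi> x (r *\<^sub>R a) = r *\<^sub>R local_endo B J \<phi> x a" for r a
      using J_linear[OF T T, of r a 0] z
      by (simp add: local_endo_def linear_scale[OF L] linear_0[OF L]) (simp add: scaleR_fun_def)
  qed
qed

lemma local_endo_j: "local_endo B J (chart_at B y) (coord (chart_at B y) y) = j y"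
  by (rule ext) (simp only: local_endo_def j_def param_coord[OF is_chart(1)[OF chart_at] in_dom[OF chart_at]])

lemma linear_j: "linear (j y)"
  using linear_local_endo[OF chart_at_A coord_in, of y] by (simp only: local_endo_j)

lemma j_j: "j y (j y v) = - v"
proof -
  have "j y (j y v) = ev y (J y (J y (lift y v)))" by (simp add: j_def[of y "j y v"] lift_j)
  also have "\<dots> = - v" by (simp add: J_J[OF lift_tangent] ev_lift)
  finally show ?thesis .
qed

lemma j_isometry: "G y (j y u) (j y v) = G y u v"
  using J_isometry[OF lift_tangent[of y u] lift_tangent[of y v]]
    metric_ev[OF lift_tangent[of y "j y u"] lift_tangent[of y "j y v"]]
    metric_ev[OF lift_tangent[of y u] lift_tangent[of y v]]
  unfolding ev_lift lift_j unfolding j_def by simp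

lemma Rm_j: "Rm y u v (j y w) (j y z) = Rm y u v w z"
proof -
  interpret L: local_riemannian "coord (chart_at B y) ` chart_dom (chart_at B y)" "local_metric B g' (chart_at B y)"
    by (rule local_riemannian[OF chart_at_A])
  have "L.R (coord (chart_at B y) y) u v (j y w) = j y (L.R (coord (chart_at B y) y) u v w)"
    using L.curvature_parallel_endo[of _ "local_endo B J (chart_at B y)" u v w, OF coord_in]
      linear_local_endo[OF chart_at_A] J_smooth[OF chart_at_A] J_parallel[OF chart_at_A]
    unfolding local_endo_j by blast
  then show ?thesis unfolding Rm_def by (simp add: j_isometry)
qed

text \<open>The hypothesis on planes concerns unit vectors; the square of \<open>G y u u\<close>
  comes from the degree 4 homogeneity in \<open>u\<close>.\<close>

lemma Rm_holomorphic: "Rm y u (j y u) (j y u) u = 4 * c * (G y u u)\<^sup>2"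
proof (cases "u = 0")
  case True
  then show ?thesis by (simp add: linear_0[OF C.linear1] C.zero_left)
next
  case False
  define k where "k = 1 / sqrt (G y u u)"
  define w where "w = k *\<^sub>R u"
  have pos: "G y u u > 0" by (rule C.pos[OF False])
  then have k: "k \<noteq> 0" "k * k * G y u u = 1" by (simp_all add: k_def)
  have jw: "j y w = k *\<^sub>R j y u" unfolding w_def by (rule linear_scale[OF linear_j])
  \<comment> \<open>\<open>j\<close> preserves \<open>G\<close> and has square -1, so the number
    equals its own negative.\<close>
  have "G y u (j y u) = 0"
    using j_isometry[of y u "j y u"] C.sym[of y "j y u" u] by (simp add: j_j linear_neg[OF C.linear_right])
  then have on: "G y w w = 1" "G y (j y w) (j y w) = 1" "G y w (j y w) = 0"
    using k(2) unfolding j_isometry by (simp_all add: w_def linear_scale[OF linear_j] C.scale_left C.scale_right)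
  then have ne: "w \<noteq> j y w" and onw: "C.orthonormal y {w, j y w}"
    using C.sym[of y "j y w" w] by (auto simp: C.orthonormal_def)
  have sp: "span {lift y w, lift y (j y w)} = span {lift y u, J y (lift y u)}"
    using span_image_scale[of "{lift y u, lift y (j y u)}" "\<lambda>_. k"] k(1)
      linear_scale[OF linear_of_coord[OF chart_at[of y]], of k]
    by (simp add: jw lift_j[symmetric]) (simp add: w_def)
  have "lift y u \<noteq> 0"
    using False inj_of_coord[OF chart_at[of y]] linear_0[OF linear_of_coord[OF chart_at[of y]]]
    by (metis injD)
  then have "Rm y w (j y w) (j y w) w = 4 * c"
    using J_holomorphic[OF lift_tangent] sectional_curvature_span[OF ne onw] sp by metis
  then have "k * k * (k * k) * Rm y u (j y u) (j y u) u = 4 * c"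
    unfolding jw by (simp add: w_def C.Rm_scale mult.assoc)
  then have "(k * k * G y u u)\<^sup>2 * Rm y u (j y u) (j y u) u = 4 * c * (G y u u)\<^sup>2"
    by (simp add: power2_eq_square algebra_simps)
  then show ?thesis by (simp add: k(2))
qed

lemma totally_real_curvature:
  assumes "G y u u = 1" "G y v v = 1" "G y u v = 0" "G y u (j y v) = 0"
  shows "Rm y u v v u = c"
  by (rule C.constant_holomorphic[OF linear_j j_j Rm_j j_isometry Rm_holomorphic assms])

end

section \<open>The Gauss equation of a submanifold\<close>

locale submanifold = M: riemannian A g + N: riemannian B g'
  for A :: "('a::{t2_space,second_countable_topology}, 'e::euclidean_space) chart set" and g
    and B :: "('b::{t2_space,second_countable_topology}, 'f::euclidean_space) chart set" and g' +
  fixes f :: "'a \<Rightarrow> 'b"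
  assumes submanifold: "riemannian_submanifold A g B g' f"
begin

lemma continuous_f: "continuous_on UNIV f"
  using submanifold by (simp add: riemannian_submanifold_def smooth_map_def)

lemma local_map_smooth: "\<phi> \<in> A \<Longrightarrow> \<psi> \<in> B \<Longrightarrow>
  smooth_on (coord \<phi> ` (chart_dom \<phi> \<inter> f -` chart_dom \<psi>)) (local_map \<phi> \<psi> f)"
  using submanifold unfolding riemannian_submanifold_def smooth_map_def by blast

lemma induced_metric: "X \<in> tangent_space A p \<Longrightarrow> Y \<in> tangent_space A p \<Longrightarrow>
    g p X Y = g' (f p) (differential A B f p X) (differential A B f p Y)"
  using submanifold unfolding riemannian_submanifold_def by blast

lemma local_map_differentiable:
  assumes "\<phi> \<in> charts_at A p" "\<psi> \<in> charts_at B (f p)"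
  shows "local_map \<phi> \<psi> f differentiable (at (coord \<phi> p))"
  by (rule smooth_on_differentiable[OF local_map_smooth]) (use assms in \<open>auto simp: charts_at_def\<close>)

text \<open>\<open>differential\<close> uses the chart chosen at each point, and these may change
  from point to point. Differentiating the induced metric requires one pair of charts on a whole
  neighbourhood, so any pair must be admissible.\<close>

lemma differential_of_coord:
  assumes \<phi>: "\<phi> \<in> charts_at A p" and \<psi>: "\<psi> \<in> charts_at B (f p)"
  shows "differential A B f p (of_coord A \<phi> p u) =
    of_coord B \<psi> (f p) (dd (local_map \<phi> \<psi> f) (coord \<phi> p) u)"
proof -
  have cid: "continuous_on UNIV (id :: 'a \<Rightarrow> 'a)" by (simp add: id_def)
  have post: "of_coord B \<psi> (f p) (dd (local_map \<phi> \<psi> f) (coord \<phi> p) u) =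
      of_coord B \<psi>' (f p) (dd (local_map \<phi> \<psi>' f) (coord \<phi> p) u)"
    if \<psi>: "\<psi> \<in> charts_at B (f p)" and \<psi>': "\<psi>' \<in> charts_at B (f p)" for \<psi> \<psi>'
  proof (rule N.tangent_eqI[OF \<psi>' N.of_coord_tangent[OF \<psi>] N.of_coord_tangent[OF \<psi>']])
    have "dd (local_map \<psi> \<psi>' id) (coord \<psi> (f p)) (dd (local_map \<phi> \<psi> f) (coord \<phi> p) u)
        = dd (local_map \<phi> \<psi>' f) (coord \<phi> p) u"
      using dd_local_map_comp[where k = id, OF M.is_chart(1)[OF \<phi>] N.is_chart(1)[OF \<psi>] continuous_f M.in_dom[OF \<phi>]
          N.in_dom[OF \<psi>] local_map_differentiable[OF \<phi> \<psi>] N.transition_differentiable[OF \<psi> \<psi>'], of u]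
      by simp
    then show "of_coord B \<psi> (f p) (dd (local_map \<phi> \<psi> f) (coord \<phi> p) u) \<psi>' =
      of_coord B \<psi>' (f p) (dd (local_map \<phi> \<psi>' f) (coord \<phi> p) u) \<psi>'"
      by (simp add: N.of_coord_apply[OF \<psi>'] N.transition_self[OF \<psi>'])
  qed
  let ?\<phi>' = "chart_at A p" and ?\<psi>' = "chart_at B (f p)"
  note \<phi>' = M.chart_at[of p] and \<psi>' = N.chart_at[of "f p"]
  have "dd (local_map ?\<phi>' ?\<psi>' f) (coord ?\<phi>' p) (of_coord A \<phi> p u ?\<phi>') = dd (local_map \<phi> ?\<psi>' f) (coord \<phi> p) u"
    using dd_local_map_comp[OF M.is_chart(1)[OF \<phi>] M.is_chart(1)[OF \<phi>'] cid M.in_dom[OF \<phi>] _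
        M.transition_differentiable[OF \<phi> \<phi>'], of ?\<psi>' f u] M.in_dom[OF \<phi>'] local_map_differentiable[OF \<phi>' \<psi>']
    by (simp add: M.of_coord_apply[OF \<phi>'])
  then show ?thesis
    unfolding differential_def Let_def post[OF \<psi> \<psi>'] by simp
qed

lemma isometric_immersion:
  assumes "\<phi> \<in> A" "\<psi> \<in> B"
  shows "isometric_immersion (coord \<phi> ` chart_dom \<phi>) (local_metric A g \<phi>)
    (coord \<psi> ` chart_dom \<psi>) (local_metric B g' \<psi>)
    (coord \<phi> ` (chart_dom \<phi> \<inter> f -` chart_dom \<psi>)) (local_map \<phi> \<psi> f)"
proof (intro isometric_immersion.intro isometric_immersion_axioms.intro M.local_riemannian N.local_riemannian assms)
  have "open (f -` chart_dom \<psi>)"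
    using continuous_f N.is_chart(2)[OF assms(2)] by (auto simp: is_chart_def continuous_on_open_vimage)
  then show "open (coord \<phi> ` (chart_dom \<phi> \<inter> f -` chart_dom \<psi>))"
    by (rule open_coord_image[OF M.is_chart(2)[OF assms(1)]])
  show "coord \<phi> ` (chart_dom \<phi> \<inter> f -` chart_dom \<psi>) \<subseteq> coord \<phi> ` chart_dom \<phi>" by blast
  show "smooth_on (coord \<phi> ` (chart_dom \<phi> \<inter> f -` chart_dom \<psi>)) (local_map \<phi> \<psi> f)"
    by (rule local_map_smooth[OF assms])
  fix x assume "x \<in> coord \<phi> ` (chart_dom \<phi> \<inter> f -` chart_dom \<psi>)"
  then obtain p where p: "p \<in> chart_dom \<phi>" "f p \<in> chart_dom \<psi>" and x: "x = coord \<phi> p" by blast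
  have ch: "is_chart \<phi>" "is_chart \<psi>" using M.is_chart(2)[OF assms(1)] N.is_chart(2)[OF assms(2)] .
  have Fx: "local_map \<phi> \<psi> f x = coord \<psi> (f p)" unfolding x by (rule local_map_coord[OF ch(1) p(1)])
  show "local_map \<phi> \<psi> f x \<in> coord \<psi> ` chart_dom \<psi>" unfolding Fx using p(2) by blast
  have \<phi>: "\<phi> \<in> charts_at A p" and \<psi>: "\<psi> \<in> charts_at B (f p)" using p assms by (auto simp: charts_at_def)
  show "local_metric A g \<phi> x u v = local_metric B g' \<psi> (local_map \<phi> \<psi> f x)
      (dd (local_map \<phi> \<psi> f) x u) (dd (local_map \<phi> \<psi> f) x v)" for u v
    unfolding Fx unfolding x local_metric_def param_coord[OF ch(1) p(1)] param_coord[OF ch(2) p(2)]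
      induced_metric[OF M.of_coord_tangent[OF \<phi>] M.of_coord_tangent[OF \<phi>]] differential_of_coord[OF \<phi> \<psi>] ..
qed

definition D :: "'a \<Rightarrow> 'e \<Rightarrow> 'f"
  where "D p = dd (local_map (chart_at A p) (chart_at B (f p)) f) (coord (chart_at A p) p)"

definition h :: "'a \<Rightarrow> 'e \<Rightarrow> 'e \<Rightarrow> 'f"
  where "h p u v = (let \<phi> = chart_at A p; \<psi> = chart_at B (f p); F = local_map \<phi> \<psi> f; x = coord \<phi> p in
    cov_along (local_metric B g' \<psi>) F (\<lambda>y. dd F y v) x u - dd F x (christoffel (local_metric A g \<phi>) x u v))"

lemma differential_lift: "differential A B f p (M.lift p u) = N.lift (f p) (D p u)"
  unfolding D_def by (rule differential_of_coord[OF M.chart_at N.chart_at])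

lemma second_fundamental_form_ev:
  "second_fundamental_form A g B g' f p X Y = N.lift (f p) (h p (M.ev p X) (M.ev p Y))"
  by (simp add: second_fundamental_form_def h_def Let_def) (simp add: cov_along_def)

lemma pointwise_gauss:
  shows "M.G p u v = N.G (f p) (D p u) (D p v)" "h p u v = h p v u" "linear (\<lambda>u. h p u v)"
    "M.Rm p u v w z = N.Rm (f p) (D p u) (D p v) (D p w) (D p z)
      + N.G (f p) (h p v w) (h p u z) - N.G (f p) (h p u w) (h p v z)"
proof -
  let ?\<phi> = "chart_at A p" and ?\<psi> = "chart_at B (f p)"
  interpret I: isometric_immersion "coord ?\<phi> ` chart_dom ?\<phi>" "local_metric A g ?\<phi>"
    "coord ?\<psi> ` chart_dom ?\<psi>" "local_metric B g' ?\<psi>"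
    "coord ?\<phi> ` (chart_dom ?\<phi> \<inter> f -` chart_dom ?\<psi>)" "local_map ?\<phi> ?\<psi> f"
    by (rule isometric_immersion[OF M.chart_at_A N.chart_at_A])
  have x: "coord ?\<phi> p \<in> coord ?\<phi> ` (chart_dom ?\<phi> \<inter> f -` chart_dom ?\<psi>)"
    using M.in_dom[OF M.chart_at[of p]] N.in_dom[OF N.chart_at[of "f p"]] by blast
  have Fx: "local_map ?\<phi> ?\<psi> f (coord ?\<phi> p) = coord ?\<psi> (f p)"
    by (rule local_map_coord[OF M.is_chart(1)[OF M.chart_at] M.in_dom[OF M.chart_at]])
  have h: "h p = I.sff (coord ?\<phi> p)" by (simp add: h_def I.sff_def Let_def fun_eq_iff)
  show "M.G p u v = N.G (f p) (D p u) (D p v)"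
    unfolding M.G_def N.G_def D_def using I.isometric[OF x] unfolding Fx .
  show "h p u v = h p v u" unfolding h by (rule I.sff_sym[OF x])
  show "linear (\<lambda>u. h p u v)" unfolding h by (rule I.linear_sff[OF x])
  show "M.Rm p u v w z = N.Rm (f p) (D p u) (D p v) (D p w) (D p z)
      + N.G (f p) (h p v w) (h p u z) - N.G (f p) (h p u w) (h p v z)"
    unfolding M.Rm_def N.Rm_def M.G_def N.G_def D_def h using I.gauss_equation[OF x, of u v w z] unfolding Fx .
qed

lemma mean_curvature_vector_eq:
  assumes E: "M.C.orthonormal p E" "span E = UNIV"
  shows "mean_curvature_vector A g B g' f p = N.lift (f p) ((1 / real DIM('e)) *\<^sub>R (\<Sum>u\<in>E. h p u u))"
proof -
  note L = N.linear_of_coord[OF N.chart_at[of "f p"]]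
  have sum: "(\<Sum>X\<in>E'. second_fundamental_form A g B g' f p X X) = N.lift (f p) (\<Sum>u\<in>E. h p u u)"
    if E': "orthonormal_basis A g p E'" for E'
  proof -
    note ev = M.orthonormal_basis_ev[OF E']
    have "(\<Sum>X\<in>E'. second_fundamental_form A g B g' f p X X) = N.lift (f p) (\<Sum>X\<in>E'. h p (M.ev p X) (M.ev p X))"
      by (simp only: second_fundamental_form_ev linear_sum[OF L])
    also have "(\<Sum>X\<in>E'. h p (M.ev p X) (M.ev p X)) = (\<Sum>u\<in>M.ev p ` E'. h p u u)"
      using ev(3) by (simp add: sum.reindex)
    also have "\<dots> = (\<Sum>u\<in>E. h p u u)"
    proof (rule M.C.trace_independent[OF pointwise_gauss(3) _ ev(1) E(1)])
      show "linear (h p u)" for u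
        using pointwise_gauss(3)[of p u] pointwise_gauss(2)[of p u] by presburger
    qed (simp add: ev(2) E(2))
    finally show ?thesis .
  qed
  have "(THE t. \<forall>E. orthonormal_basis A g p E \<longrightarrow> t = (\<Sum>X\<in>E. second_fundamental_form A g B g' f p X X))
      = N.lift (f p) (\<Sum>u\<in>E. h p u u)"
    using sum M.orthonormal_basis_lift[OF E] by (intro the_equality) auto
  then show ?thesis
    by (simp add: mean_curvature_vector_def linear_scale[OF L])
qed

lemma mean_curvature_eq:
  assumes E: "M.C.orthonormal p E" "span E = UNIV"
  shows "(mean_curvature A g B g' f p)\<^sup>2 = N.G (f p) (\<Sum>u\<in>E. h p u u) (\<Sum>u\<in>E. h p u u) / (real DIM('e))\<^sup>2"
  unfolding mean_curvature_def mean_curvature_vector_eq[OF E]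
    N.metric_ev[OF N.lift_tangent N.lift_tangent] N.ev_lift
  using N.C.nonneg[of "f p" "\<Sum>u\<in>E. h p u u"]
  by (simp add: N.C.scale_left N.C.scale_right power2_eq_square)

lemma totally_geodesic_iff: "totally_geodesic A g B g' f \<longleftrightarrow> (\<forall>p u v. h p u v = 0)"
proof -
  have "N.lift q w = 0 \<longleftrightarrow> w = 0" for q w
    using injD[OF N.inj_of_coord[OF N.chart_at[of q]], of w 0] linear_0[OF N.linear_of_coord[OF N.chart_at[of q]]]
    by auto
  then have "second_fundamental_form A g B g' f p X Y = 0 \<longleftrightarrow> h p (M.ev p X) (M.ev p Y) = 0" for p X Y
    by (simp add: second_fundamental_form_ev)
  then show ?thesis
    unfolding totally_geodesic_def using M.lift_tangent M.ev_lift by metis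
qed

end

text \<open>The second claim replaces a compactness argument: the infimum is not known to be attained.\<close>

lemma INF_affine:
  fixes S :: "'i \<Rightarrow> real"
  assumes "I \<noteq> {}" "q > 0" and ge: "\<And>i. i \<in> I \<Longrightarrow> 0 \<le> \<kappa> + 2 * S i"
    and \<sigma>: "\<And>i. i \<in> I \<Longrightarrow> \<sigma> \<le> C * (\<kappa> + 2 * S i)"
  shows "0 \<le> \<kappa> + 2 * q * (INF i\<in>I. S i / q)"
    and "\<kappa> + 2 * q * (INF i\<in>I. S i / q) = 0 \<Longrightarrow> \<sigma> \<le> 0"
proof -
  have lb: "- \<kappa> / (2 * q) \<le> S i / q" if "i \<in> I" for i
    using ge[OF that] \<open>q > 0\<close> by (simp add: field_simps)
  then have "- \<kappa> / (2 * q) \<le> (INF i\<in>I. S i / q)"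
    using \<open>I \<noteq> {}\<close> by (intro cINF_greatest)
  then show "0 \<le> \<kappa> + 2 * q * (INF i\<in>I. S i / q)"
    using \<open>q > 0\<close> by (simp add: field_simps)
  assume eq: "\<kappa> + 2 * q * (INF i\<in>I. S i / q) = 0"
  show "\<sigma> \<le> 0"
  proof (rule ccontr)
    assume "\<not> \<sigma> \<le> 0"
    \<comment> \<open>Chosen so that the bound below becomes exactly \<sigma>;
      \<open>\<bar>C\<bar> + 1\<close> is positive whatever the sign of \<open>C\<close>.\<close>
    define \<epsilon> where "\<epsilon> = \<sigma> / (2 * q * (\<bar>C\<bar> + 1))"
    have "\<epsilon> > 0" using \<open>\<not> \<sigma> \<le> 0\<close> \<open>q > 0\<close> by (simp add: \<epsilon>_def)
    then have "(INF i\<in>I. S i / q) < (INF i\<in>I. S i / q) + \<epsilon>" by simp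
    moreover have "bdd_below ((\<lambda>i. S i / q) ` I)"
      using lb by (intro bdd_belowI[of _ "- \<kappa> / (2 * q)"]) auto
    ultimately obtain i where i: "i \<in> I" "S i / q < (INF i\<in>I. S i / q) + \<epsilon>"
      using cINF_less_iff[OF \<open>I \<noteq> {}\<close>] by blast
    have "2 * S i < 2 * q * (INF i\<in>I. S i / q) + 2 * q * \<epsilon>"
      using i(2) \<open>q > 0\<close> by (simp add: field_simps)
    then have small: "\<kappa> + 2 * S i < 2 * q * \<epsilon>" using eq by simp
    have "\<sigma> \<le> C * (\<kappa> + 2 * S i)" by (rule \<sigma>[OF i(1)])
    also have "\<dots> \<le> (\<bar>C\<bar> + 1) * (\<kappa> + 2 * S i)"
      using ge[OF i(1)] by (intro mult_right_mono) auto
    also have "\<dots> < (\<bar>C\<bar> + 1) * (2 * q * \<epsilon>)"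
      using small by (intro mult_strict_left_mono) auto
    also have "\<dots> = (2 * q * (\<bar>C\<bar> + 1)) * \<epsilon>" by simp
    also have "\<dots> = \<sigma>"
    proof -
      have "2 * q * (\<bar>C\<bar> + 1) \<noteq> 0" using \<open>q > 0\<close> by (simp add: add_eq_0_iff)
      then show ?thesis unfolding \<epsilon>_def by simp
    qed
    finally show False by simp
  qed
qed

section \<open>The inequality at a point and the theorem\<close>

locale einstein_totally_real = submanifold A g B g' f + N: complex_space_form_manifold B g' J c
  for A :: "('a::{t2_space,second_countable_topology}, 'e::euclidean_space) chart set" and g
    and B :: "('b::{t2_space,second_countable_topology}, 'f::euclidean_space) chart set" and g' f J c +
  assumes totally_real: "totally_real A B g' J f" and einstein: "einstein A g"
begin

text \<open>Total reality makes J of a tangent vector normal, hence the images of an orthonormal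
  pair satisfy the extra orthogonality in \<open>totally_real_curvature\<close>.\<close>

lemma gauss_form: "gauss_form (M.G p) (M.Rm p) (N.G (f p)) (h p) c"
proof (intro gauss_form.intro M.curvature_form gauss_form_axioms.intro pointwise_gauss(2,3))
  show "inner_form (N.G (f p))" by (rule N.C.inner_form_axioms)
  fix u v assume uv: "M.G p u u = 1" "M.G p v v = 1" "M.G p u v = 0"
  have "J (f p) (differential A B f p (M.lift p v)) \<in> normal_space A B g' f p"
    using totally_real M.lift_tangent unfolding totally_real_def by blast
  then have "g' (f p) (N.lift (f p) (N.j (f p) (D p v))) (N.lift (f p) (D p u)) = 0"
    unfolding normal_space_def N.lift_j differential_lift[symmetric] using M.lift_tangent by blast
  then have "N.G (f p) (D p u) (N.j (f p) (D p v)) = 0"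
    unfolding N.metric_ev[OF N.lift_tangent N.lift_tangent] N.ev_lift using N.C.sym by simp
  then have "N.Rm (f p) (D p u) (D p v) (D p v) (D p u) = c"
    using uv pointwise_gauss(1) by (intro N.totally_real_curvature) auto
  then show "M.Rm p u v v u = c + N.G (f p) (h p u u) (h p v v) - N.G (f p) (h p u v) (h p u v)"
    using pointwise_gauss(4)[of p u v v u] pointwise_gauss(2)[of p v u]
      N.C.sym[of "f p" "h p v v" "h p u u"] by simp
qed

text \<open>Equality at a single point already forces \<open>h\<close> to vanish at that point, so
  the statement about all of the submanifold follows by quantifying over \<open>p\<close>.\<close>

lemma delta_pointwise:
  assumes q: "0 < q" "2 * q < DIM('e)"
  defines "n \<equiv> real DIM('e)"
  defines "rhs \<equiv> \<lambda>p. (n - 1 - 2 * real q / n) * c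
    + n * (n - real q - 1) / (n - real q) * (mean_curvature A g B g' f p)\<^sup>2"
  shows "delta_Ric A g q p \<le> rhs p" (is ?le)
    and "delta_Ric A g q p = rhs p \<longleftrightarrow> (\<forall>u v. h p u v = 0)" (is "_ \<longleftrightarrow> ?geodesic")
proof -
  interpret L: gauss_form "M.G p" "M.Rm p" "N.G (f p)" "h p" c by (rule gauss_form)
  obtain E where E: "M.C.orthonormal p E" "span E = UNIV"
    using M.orthonormal_exists[of p "{}"] by (auto simp: M.C.orthonormal_def)
  have n: "n > 2 * real q" "real q > 0" using q by (simp_all add: n_def)
  define t where "t = (\<Sum>u\<in>E. h p u u)"
  have t: "t = (\<Sum>u\<in>E'. h p u u)" if "M.C.orthonormal p E'" "span E' = UNIV" for E'
    unfolding t_def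
    by (rule M.C.trace_independent[OF L.linear_h L.linear_h' E(1) that(1)]) (simp add: E(2) that(2))
  have H: "(mean_curvature A g B g' f p)\<^sup>2 = N.G (f p) t t / n\<^sup>2"
    unfolding t_def n_def by (rule mean_curvature_eq[OF E])
  have "E \<noteq> {}" using M.C.orthonormal_basis_card[OF E] q by auto
  then obtain e where e: "e \<in> E" by blast
  define r where "r = Ric A g p (M.lift p e)"
  have unit: "M.lift p u \<in> unit_tangent A g p" if "M.C.orthonormal p E'" "u \<in> E'" for u E'
    using that M.lift_tangent M.metric_ev[OF M.lift_tangent[of p u] M.lift_tangent[of p u]]
    by (simp add: unit_tangent_def M.ev_lift M.C.orthonormal_def)
  have Ric: "Ric A g p X = r" if "X \<in> unit_tangent A g p" for X
    using einstein that unit[OF E(1) e] unfolding einstein_def r_def by blast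
  have ric: "(\<Sum>v\<in>E' - {u}. M.Rm p u v v u) = r"
    if "M.C.orthonormal p E'" "span E' = UNIV" "u \<in> E'" for E' u
    using M.Ric_eq[OF that] Ric[OF unit[OF that(1,3)]] by simp
  have "(SUP X\<in>unit_tangent A g p. Ric A g p X) = (SUP X\<in>unit_tangent A g p. r)"
    using Ric by (intro SUP_cong) auto
  also have "\<dots> = r" using unit[OF E(1) e] by (intro cSUP_const) auto
  finally have delta: "delta_Ric A g q p = r - 2 * real q / n * K_inf A g q p"
    by (simp add: delta_Ric_def n_def)
  define S where "S \<pi> = (\<Sum>i=1..q. sectional_curvature A g p (\<pi> i))" for \<pi>
  define I where "I = {\<pi>. orthogonal_planes A g p q \<pi>}"
  \<comment> \<open>The deficit without its plane term. It is the same for all families of planes,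
    so the infimum acts on \<open>S\<close> alone and \<open>INF_affine\<close> applies.\<close>
  define \<kappa> where "\<kappa> = n * (n - 1) * c - 2 * real q * c + (1 - 1 / (n - real q)) * N.G (f p) t t - n * r"
  have K: "K_inf A g q p = (INF \<pi>\<in>I. S \<pi> / real q)"
    by (simp add: K_inf_def I_def S_def)
  have I: "I \<noteq> {}" using M.orthogonal_planes_exist[of q p] q by (auto simp: I_def)
  have chen: "0 \<le> \<kappa> + 2 * S \<pi>" "L.sff_norm r t \<le> chen_constant DIM('e) q * (\<kappa> + 2 * S \<pi>)"
    if "\<pi> \<in> I" for \<pi>
  proof -
    obtain a b Z where fr: "M.C.frame p q a b Z"
      and S: "S \<pi> = (\<Sum>i=1..q. M.Rm p (a i) (b i) (b i) (a i))"
      using M.orthogonal_planes_frame \<open>\<pi> \<in> I\<close> unfolding I_def S_def by blast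
    let ?E = "a ` {1..q} \<union> b ` {1..q} \<union> Z"
    have E': "M.C.orthonormal p ?E" "span ?E = UNIV" using fr by (simp_all add: M.C.frame_def)
    have "L.deficit q r t a b = \<kappa> + 2 * S \<pi>"
      unfolding L.deficit_def Let_def \<kappa>_def S n_def ..
    then show "0 \<le> \<kappa> + 2 * S \<pi>" "L.sff_norm r t \<le> chen_constant DIM('e) q * (\<kappa> + 2 * S \<pi>)"
      using L.chen(1,2)[OF fr q t[OF E'] ric[OF E']] by simp_all
  qed
  have nrhs: "n * (rhs p - delta_Ric A g q p) = \<kappa> + 2 * real q * (INF \<pi>\<in>I. S \<pi> / real q)"
  proof -
    have "n * rhs p = n * (n - 1) * c - 2 * real q * c + (n - real q - 1) / (n - real q) * N.G (f p) t t"
      unfolding rhs_def H using n by (simp add: field_simps power2_eq_square)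
    also have "(n - real q - 1) / (n - real q) = 1 - 1 / (n - real q)"
      using n by (simp add: field_simps)
    finally have "n * rhs p = n * (n - 1) * c - 2 * real q * c + (1 - 1 / (n - real q)) * N.G (f p) t t" .
    moreover have "n * (rhs p - (r - 2 * real q / n * k)) = n * rhs p - n * r + 2 * real q * k" for k
      using n by (simp add: right_diff_distrib)
    ultimately show ?thesis
      unfolding delta K \<kappa>_def by simp
  qed
  show ?le
  proof -
    have "0 \<le> n * (rhs p - delta_Ric A g q p)"
      unfolding nrhs by (rule INF_affine(1)[OF I n(2) chen])
    then show ?thesis using n by (simp add: zero_le_mult_iff)
  qed
  have sff: "L.sff_norm r t = (\<Sum>u\<in>E. \<Sum>v\<in>E. N.G (f p) (h p u v) (h p u v))"
    by (rule L.sff_norm_eq[OF E t_def ric[OF E]])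
  show "delta_Ric A g q p = rhs p \<longleftrightarrow> ?geodesic"
  proof
    assume "delta_Ric A g q p = rhs p"
    then have "L.sff_norm r t \<le> 0"
      using INF_affine(2)[OF I n(2) chen] nrhs by simp
    then show ?geodesic using L.sff_norm_0_imp[OF E] sff by simp
  next
    assume ?geodesic
    then have h0: "h p u v = 0" for u v by blast
    have t0: "t = 0" by (simp add: t_def h0)
    have rc: "r = (n - 1) * c"
      using L.ricci_gauss[OF E e] ric[OF E e] by (simp add: h0 N.C.zero_left n_def)
    have "S \<pi> / real q = c" if "\<pi> \<in> I" for \<pi>
    proof -
      obtain a b Z where fr: "M.C.frame p q a b Z"
        and S: "S \<pi> = (\<Sum>i=1..q. M.Rm p (a i) (b i) (b i) (a i))"
        using M.orthogonal_planes_frame \<open>\<pi> \<in> I\<close> unfolding I_def S_def by blast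
      have "M.Rm p (a i) (b i) (b i) (a i) = c" if "i \<in> {1..q}" for i
        using L.gauss[OF M.C.frame_orthonormal(1-3)[OF fr that]] by (simp add: h0 N.C.zero_left)
      then show ?thesis unfolding S using n by simp
    qed
    then have "(INF \<pi>\<in>I. S \<pi> / real q) = (INF \<pi>\<in>I. c)" by (intro INF_cong) auto
    also have "\<dots> = c" by (rule cINF_const[OF I])
    finally have "n * (rhs p - delta_Ric A g q p) = 0"
      unfolding nrhs \<kappa>_def t0 rc by (simp add: N.C.zero_left)
    then show "delta_Ric A g q p = rhs p" using n by simp
  qed
qed

end

theorem theorem4p1:
  fixes A :: "('a::{t2_space,second_countable_topology}, 'e::euclidean_space) chart set"
    and B :: "('b::{t2_space,second_countable_topology}, 'f::euclidean_space) chart set"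
    and g :: "('a, 'e) metric" and g' :: "('b, 'f) metric" and J :: "('b, 'f) endo_field"
    and f :: "'a \<Rightarrow> 'b" and c :: real and n m q :: nat
  assumes "DIM('e) = n" and "DIM('f) = 2 * m"
    and "complex_space_form B g' J (4 * c)"
    and "riemannian_submanifold A g B g' f"
    and "totally_real A B g' J f"
    and "einstein A g"
    and "0 < q" and "real q < real n / 2"
  shows "(\<forall>p. delta_Ric A g q p \<le> (real n - 1 - 2 * real q / real n) * c
            + real n * (real n - real q - 1) / (real n - real q) * (mean_curvature A g B g' f p)\<^sup>2)
       \<and> ((\<forall>p. delta_Ric A g q p = (real n - 1 - 2 * real q / real n) * c
            + real n * (real n - real q - 1) / (real n - real q) * (mean_curvature A g B g' f p)\<^sup>2)
          \<longleftrightarrow> totally_geodesic A g B g' f)"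
proof -
  have rm: "riemannian_manifold A g" "riemannian_manifold B g'"
    using assms(4) by (simp_all add: riemannian_submanifold_def)
  interpret S: einstein_totally_real A g B g' f J c
    using rm assms(3-6)
    by unfold_locales (simp_all add: riemannian_manifold_def)
  have q: "2 * q < DIM('e)" using assms(1,8) by linarith
  show ?thesis
    unfolding S.totally_geodesic_iff
    using S.delta_pointwise[OF assms(7) q, unfolded assms(1)] by simp
qed

end
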